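(* Let $\lambda\vdash n$, let $i$ be a part of $\lambda$, and let $r\ge 1$. For $\pi\in\mathcal{C}_{\lambda,i}$, the number of sequences $(\tau_1,\dots,\tau_r)$ of star transpositions with $\tau_1\tau_2\cdots\tau_r=\pi$ is \[ [K_{\lambda,i}]J_n^r = \sum_{\substack{\mu\vdash n\\ j\in\mu}}\frac{d_\mu}{n!}\,\gamma^{\mu,j}_{\lambda,i}\,c_{\mu,j}^{\,r}, \] where the sum is over all $\mu\vdash n$ and distinct parts $j$ of $\mu$.
   Context: $\mathfrak{S}_n$ is the symmetric group on $\{1,\dots,n\}$ (products read right to left), $\mathbb{C}[\mathfrak{S}_n]$ its group algebra, and $Z_1(n)$ the set of elements commuting with every element of the subgroup $\mathfrak{S}_{n-1}$ fixing $n$. A star transposition is a transposition $(j,n)$ with $1\le j\le n-1$; $J_n=\sum_{1\le j<n}(j,n)$. For a part $i$ of $\lambda\vdash n$, $\mathcal{C}_{\lambda,i}$ is the set of permutations of cycle type $\lambda$ in which $n$ lies on a cycle of length $i$, and $K_{\lambda,i}$ is the sum of its elements; these form a basis of $Z_1(n)$ and $[K_{\lambda,i}]g$ denotes the coefficient. $d_\mu$ is the number of standard Young tableaux of shape $\mu$. $c_{\mu,j}:=j-\sum_{k\ge j}m_k(\mu)$, where $m_k(\mu)$ is the multiplicity of $k$ as a part of $\mu$ (the content, column minus row, of the cell containing $n$ when $n$ sits at the end of a row of length $j$). $e_T$ is Young's seminormal unit of a standard Young tableau $T$; $\mathrm{SYT}_{\mu,j}$ is the set of standard Young tableaux of shape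 $\mu$ with $n$ at the end of a row of length $j$; $\Gamma^{\mu,j}=\sum_{T\in\mathrm{SYT}_{\mu,j}}e_T\in Z_1(n)$. Generalized characters: $\gamma^{\mu,j}_{\lambda,i}:=\frac{n!}{d_\mu}[K_{\lambda,i}]\Gamma^{\mu,j}$. *)

theory Defs
  imports Complex_Main
    "HOL-Library.Multiset"
    "HOL-Combinatorics.Orbits"
    "HOL-Algebra.Sym_Groups"
    "HOL-Algebra.Module"
begin

section \<open>The group algebra of the symmetric group\<close>

text \<open>Elements of \<open>\<complex>[S\<^sub>n]\<close> are coefficient functions vanishing off \<open>S\<^sub>n\<close>.  As permutations in
  \<open>S\<^sub>n\<^sub>-\<^sub>1\<close> are maps on all of \<^typ>\<open>nat\<close> fixing \<open>n\<close>, the inclusion of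
  \<open>\<complex>[S\<^sub>n\<^sub>-\<^sub>1]\<close> into \<open>\<complex>[S\<^sub>n]\<close> is the identity on functions.\<close>

type_synonym alg_elt = "(nat \<Rightarrow> nat) \<Rightarrow> complex"

definition of_perm :: "(nat \<Rightarrow> nat) \<Rightarrow> alg_elt" where
  "of_perm \<pi> = (\<lambda>\<sigma>. if \<sigma> = \<pi> then 1 else 0)"

definition sym_alg :: "nat \<Rightarrow> (complex, alg_elt) module" where
  "sym_alg n =
     \<lparr> carrier = {a. \<forall>\<sigma>. \<sigma> \<notin> carrier (sym_group n) \<longrightarrow> a \<sigma> = 0},
       mult = (\<lambda>a b \<sigma>. \<Sum>\<rho>\<in>carrier (sym_group n). a \<rho> * b (Hilbert_Choice.inv \<rho> \<circ> \<sigma>)),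
       one = of_perm id,
       zero = (\<lambda>\<sigma>. 0),
       add = (\<lambda>a b \<sigma>. a \<sigma> + b \<sigma>),
       smult = (\<lambda>c a \<sigma>. c * a \<sigma>) \<rparr>"

definition star_transpositions :: "nat \<Rightarrow> (nat \<Rightarrow> nat) set" where
  "star_transpositions n = {Transposition.transpose j n | j. 1 \<le> j \<and> j < n}"

definition jucys_murphy :: "nat \<Rightarrow> alg_elt" where
  "jucys_murphy n = (\<Oplus>\<^bsub>sym_alg n\<^esub>j\<in>{1..<n}. of_perm (Transposition.transpose j n))"


section \<open>Partitions and near-central classes\<close>

definition partition_of :: "nat multiset \<Rightarrow> nat \<Rightarrow> bool" (infix \<open>\<turnstile>\<close> 50) where
  "\<mu> \<turnstile> n \<longleftrightarrow> 0 \<notin># \<mu> \<and> \<Sum>\<^sub># \<mu> = n"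

definition marked_partitions :: "nat \<Rightarrow> (nat multiset \<times> nat) set" where
  "marked_partitions n = {(\<mu>, j). \<mu> \<turnstile> n \<and> j \<in># \<mu>}"

definition cycle_type :: "nat \<Rightarrow> (nat \<Rightarrow> nat) \<Rightarrow> nat multiset" where
  "cycle_type n \<sigma> = image_mset card (mset_set (Orbits.orbit \<sigma> ` {1..n}))"

definition marked_class :: "nat \<Rightarrow> nat multiset \<Rightarrow> nat \<Rightarrow> (nat \<Rightarrow> nat) set" where
  "marked_class n \<mu> j =
     {\<sigma> \<in> carrier (sym_group n). cycle_type n \<sigma> = \<mu> \<and> card (Orbits.orbit \<sigma> n) = j}"

definition class_sum :: "nat \<Rightarrow> nat multiset \<Rightarrow> nat \<Rightarrow> alg_elt" where
  "class_sum n \<mu> j = (\<Oplus>\<^bsub>sym_alg n\<^esub>\<sigma>\<in>marked_class n \<mu> j. of_perm \<sigma>)"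

text \<open>\<open>[K\<^sub>\<mu>\<^sub>,\<^sub>j] g\<close>: the coefficient of \<^term>\<open>class_sum n \<mu> j\<close> in the expansion of \<open>g\<close> in the basis of all the
  \<^const>\<open>class_sum\<close>; it is meaningful only for \<open>g\<close> in their span, the centralizer \<open>Z\<^sub>1(n)\<close> of
  \<open>S\<^sub>n\<^sub>-\<^sub>1\<close>.\<close>

definition K_coeff :: "nat \<Rightarrow> nat multiset \<Rightarrow> nat \<Rightarrow> alg_elt \<Rightarrow> complex" where
  "K_coeff n \<mu> j g =
     (THE c. \<exists>a. c = a (\<mu>, j) \<and>
        g = (\<Oplus>\<^bsub>sym_alg n\<^esub>p\<in>marked_partitions n. a p \<odot>\<^bsub>sym_alg n\<^esub> class_sum n (fst p) (snd p)))"

definition end_content :: "nat multiset \<Rightarrow> nat \<Rightarrow> int" where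
  "end_content \<mu> j = int j - int (\<Sum>k | k \<in># \<mu> \<and> j \<le> k. count \<mu> k)"


section \<open>Standard Young tableaux and Young's seminormal units\<close>

text \<open>A tableau is the list of its rows, longest row first (English notation).\<close>

type_synonym tableau = "nat list list"

definition standard_tableau :: "nat \<Rightarrow> tableau \<Rightarrow> bool" where
  "standard_tableau n T \<longleftrightarrow>
     [] \<notin> set T \<and> sorted_wrt (\<ge>) (map length T) \<and>
     distinct (concat T) \<and> set (concat T) = {1..n} \<and>
     (\<forall>row\<in>set T. sorted_wrt (<) row) \<and>
     (\<forall>r c. Suc r < length T \<longrightarrow> c < length (T ! Suc r) \<longrightarrow> T ! r ! c < T ! Suc r ! c)"

definition tableau_shape :: "tableau \<Rightarrow> nat multiset" where
  "tableau_shape T = mset (map length T)"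

definition SYT :: "nat multiset \<Rightarrow> tableau set" where
  "SYT \<mu> = {T. standard_tableau (\<Sum>\<^sub># \<mu>) T \<and> tableau_shape T = \<mu>}"

definition num_SYT :: "nat multiset \<Rightarrow> nat" where
  "num_SYT \<mu> = card (SYT \<mu>)"

definition SYT_marked :: "nat \<Rightarrow> nat multiset \<Rightarrow> nat \<Rightarrow> tableau set" where
  "SYT_marked n \<mu> j =
     {T. standard_tableau n T \<and> tableau_shape T = \<mu> \<and> (\<exists>row\<in>set T. length row = j \<and> last row = n)}"

definition tableau_column :: "tableau \<Rightarrow> nat \<Rightarrow> nat set" where
  "tableau_column T c = {T ! r ! c | r. r < length T \<and> c < length (T ! r)}"

definition row_stabilizer :: "nat \<Rightarrow> tableau \<Rightarrow> (nat \<Rightarrow> nat) set" where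
  "row_stabilizer n T = {\<sigma> \<in> carrier (sym_group n). \<forall>row\<in>set T. \<sigma> ` set row = set row}"

definition column_stabilizer :: "nat \<Rightarrow> tableau \<Rightarrow> (nat \<Rightarrow> nat) set" where
  "column_stabilizer n T = {\<sigma> \<in> carrier (sym_group n). \<forall>c. \<sigma> ` tableau_column T c = tableau_column T c}"

definition row_symmetrizer :: "nat \<Rightarrow> tableau \<Rightarrow> alg_elt" where
  "row_symmetrizer n T = (\<Oplus>\<^bsub>sym_alg n\<^esub>\<sigma>\<in>row_stabilizer n T. of_perm \<sigma>)"

definition column_antisymmetrizer :: "nat \<Rightarrow> tableau \<Rightarrow> alg_elt" where
  "column_antisymmetrizer n T =
     (\<Oplus>\<^bsub>sym_alg n\<^esub>\<sigma>\<in>column_stabilizer n T. of_int (sign \<sigma>) \<odot>\<^bsub>sym_alg n\<^esub> of_perm \<sigma>)"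

definition young_symmetrizer :: "nat \<Rightarrow> tableau \<Rightarrow> alg_elt" where
  "young_symmetrizer n T =
     (of_nat (num_SYT (tableau_shape T)) / fact n) \<odot>\<^bsub>sym_alg n\<^esub>
       (row_symmetrizer n T \<otimes>\<^bsub>sym_alg n\<^esub> column_antisymmetrizer n T)"

definition remove_entry :: "nat \<Rightarrow> tableau \<Rightarrow> tableau" where
  "remove_entry m T = filter (\<lambda>row. row \<noteq> []) (map (removeAll m) T)"

text \<open>Young's recursion: if \<open>T'\<close> is \<open>T\<close> without its largest entry, then
  \<open>e\<^sub>T = e\<^sub>T\<^sub>' (d\<^sub>\<mu> / n!) P\<^sub>T N\<^sub>T e\<^sub>T\<^sub>'\<close>, starting from \<open>e\<^sub>T = 1\<close>.  The first argument is
  the size of the tableau.\<close>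

primrec seminormal_unit :: "nat \<Rightarrow> tableau \<Rightarrow> alg_elt" where
  "seminormal_unit 0 T = \<one>\<^bsub>sym_alg 0\<^esub>"
| "seminormal_unit (Suc n) T =
     seminormal_unit n (remove_entry (Suc n) T) \<otimes>\<^bsub>sym_alg (Suc n)\<^esub>
     young_symmetrizer (Suc n) T \<otimes>\<^bsub>sym_alg (Suc n)\<^esub>
     seminormal_unit n (remove_entry (Suc n) T)"

definition Gamma_elt :: "nat \<Rightarrow> nat multiset \<Rightarrow> nat \<Rightarrow> alg_elt" where
  "Gamma_elt n \<mu> j = (\<Oplus>\<^bsub>sym_alg n\<^esub>T\<in>SYT_marked n \<mu> j. seminormal_unit n T)"

definition gen_char :: "nat \<Rightarrow> nat multiset \<Rightarrow> nat \<Rightarrow> nat multiset \<Rightarrow> nat \<Rightarrow> complex" where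
  "gen_char n \<mu> j lam i = fact n / of_nat (num_SYT \<mu>) * K_coeff n lam i (Gamma_elt n \<mu> j)"

end

theory Submission
  imports Defs "HOL-Library.Poly_Mapping"
begin

text \<open>Young's seminormal units \<open>e\<^sub>T\<close>, with \<open>T\<close> ranging over the standard tableaux of size \<open>n\<close>, form a complete
  system of orthogonal idempotents of \<open>\<complex>[S\<^sub>n]\<close>, and \<open>J\<^sub>n e\<^sub>T = c e\<^sub>T\<close>, where \<open>c\<close> is the content of the cell of \<open>n\<close>
  in \<open>T\<close>. Hence \<open>J\<^sub>n\<^sup>r = \<Sum>\<^sub>T c\<^sup>r e\<^sub>T\<close>, and grouping the tableaux by shape and by the row of \<open>n\<close> gives the formula.

  Let \<open>P N\<close> be the product of the row symmetrizer and the column antisymmetrizer of \<open>T\<close>. By von Neumann's lemma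
  \<open>P x N\<close> is a multiple of \<open>P N\<close> for every \<open>x\<close>, so \<open>(P N)\<^sup>2 = \<theta> P N\<close> for a scalar \<open>\<theta>\<close>, and \<open>\<theta> \<noteq> 0\<close>. The units are
  first built with the factor \<open>1 / \<theta>\<close>; reading off the coefficient of the identity shows that they are orthogonal
  idempotents. Completeness is a dimension count: the corner \<open>e\<^sub>T \<complex>[S\<^sub>n\<^sub>+\<^sub>1] e\<^sub>T\<close> has dimension at most one plus the
  number of removable cells of \<open>T\<close>, which is the number of addable cells and hence of units refining \<open>e\<^sub>T\<close>. Only then
  is \<open>\<theta>\<close> identified with \<open>n! / d\<^sub>\<mu>\<close>, by averaging \<open>e\<^sub>T\<close> over conjugation. The eigenvalues come from
  \<open>J\<^sub>n = z\<^sub>n - z\<^sub>n\<^sub>-\<^sub>1\<close>, where the sum \<open>z\<^sub>n\<close> of all transpositions of \<open>S\<^sub>n\<close> is central and acts on \<open>P N\<close> by the sum of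
  the contents.\<close>

section \<open>The group algebra of the finitary symmetric group\<close>

text \<open>The constant \<open>d_mu / n!\<close> is what makes the units idempotent, but its value
  comes from comparing traces over all units of a size, so it is available only after completeness.
  The scalar \<open>theta\<close> breaks this circle: it is defined and shown to be nonzero without
  counting tableaux. The coefficient \<open>K_coeff\<close> is a definite description and has the
  expected value only on combinations of class sums. So \<open>Gamma_elt\<close> and the powers of
  the Jucys-Murphy element are shown to commute with the smaller symmetric group, and elements with
  this property are shown to be constant on marked classes. The former holds for
  \<open>Gamma_elt\<close> because it is a product of a central element of the larger algebra and
  one of the smaller; the latter because two members of a marked class are conjugate by a
  permutation fixing the largest point. Lattice words stand in for tableaux because deleting the
  largest entry becomes taking the tail, which makes every recursion structural; actual tableaux
  enter only in the final translation.\<close>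

typedef fperm = "{f :: nat \<Rightarrow> nat. \<exists>n. f permutes {1..n}}"
  morphisms app Fperm
  using permutes_id by blast

setup_lifting type_definition_fperm

lemma finitary_perm_comp:
  assumes "\<exists>n. f permutes {1..n::nat}" "\<exists>n. g permutes {1..n}"
  shows "\<exists>n. f \<circ> g permutes {1..n}"
proof -
  obtain n m where "f permutes {1..n}" "g permutes {1..m}" using assms by blast
  then have "f permutes {1..max n m}" "g permutes {1..max n m}"
    by (auto elim!: permutes_subset)
  then show ?thesis using permutes_compose by blast
qed

text \<open>Composition is written additively so that \<open>fperm \<Rightarrow>\<^sub>0 complex\<close>, with the convolution product of
  \<^typ>\<open>'a \<Rightarrow>\<^sub>0 'b\<close>, is the union of all group algebras \<open>\<complex>[S\<^sub>n]\<close>.\<close>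

instantiation fperm :: group_add
begin

lift_definition zero_fperm :: fperm is id using permutes_id by blast

lift_definition plus_fperm :: "fperm \<Rightarrow> fperm \<Rightarrow> fperm" is "(\<circ>)"
  by (rule finitary_perm_comp)

lift_definition uminus_fperm :: "fperm \<Rightarrow> fperm" is "Hilbert_Choice.inv"
  using permutes_inv by blast

definition minus_fperm :: "fperm \<Rightarrow> fperm \<Rightarrow> fperm" where
  "minus_fperm a b = a + - b"

instance
proof
  show "a + b + c = a + (b + c)" for a b c :: fperm by transfer (rule comp_assoc)
  show "0 + a = a" for a :: fperm by transfer simp
  show "a + 0 = a" for a :: fperm by transfer simp
  show "- a + a = 0" for a :: fperm by transfer (auto simp: permutes_inv_o)
  show "a + - b = a - b" for a b :: fperm by (simp add: minus_fperm_def)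
qed

end

lemma app_plus [simp]: "app (a + b) x = app a (app b x)"
  by transfer simp

lemma app_zero [simp]: "app 0 x = x"
  by transfer simp

lemma app_uminus_app [simp]: "app (- a) (app a x) = x" "app a (app (- a) x) = x"
  by (metis app_plus app_zero left_minus) (metis app_plus app_zero right_minus)

lemma fperm_eqI: "(\<And>x. app a x = app b x) \<Longrightarrow> a = b"
  by (metis app_inject ext)

lemma app_eq_iff [simp]: "app a x = app a y \<longleftrightarrow> x = y"
  by (metis app_uminus_app(1))

lemma permutation_app: "permutation (app a)"
  using app[of a] permutation_permutes by blast

definition sgn_of :: "fperm \<Rightarrow> complex" where
  "sgn_of a = of_int (sign (app a))"

lemma sgn_of_plus: "sgn_of (a + b) = sgn_of a * sgn_of b"
  by (simp add: sgn_of_def plus_fperm.rep_eq sign_compose permutation_app)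

lemma sgn_of_zero [simp]: "sgn_of 0 = 1"
  by (simp add: sgn_of_def zero_fperm.rep_eq)

lemma sgn_of_uminus [simp]: "sgn_of (- a) = sgn_of a"
  by (simp add: sgn_of_def uminus_fperm.rep_eq sign_inverse permutation_app)

lemma sgn_of_square [simp]: "sgn_of a * sgn_of a = 1" "sgn_of a * (sgn_of a * c) = c"
  by (simp_all add: sgn_of_def sign_def)

section \<open>The finite symmetric groups as nested subgroups\<close>

definition Sn :: "nat \<Rightarrow> fperm set" where
  "Sn n = {a. app a permutes {1..n}}"

lemma app_Fperm: "f permutes {1..n} \<Longrightarrow> app (Fperm f) = f"
  by (auto intro!: Fperm_inverse)

lemma Fperm_in_Sn: "f permutes {1..n} \<Longrightarrow> Fperm f \<in> Sn n"
  by (simp add: Sn_def app_Fperm)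

lemma bij_betw_app_Sn: "bij_betw app (Sn n) {f. f permutes {1..n}}"
  unfolding bij_betw_def inj_on_def
  by (auto simp: app_inject Sn_def image_iff) (metis One_nat_def app_Fperm)

lemma finite_Sn [simp]: "finite (Sn n)"
  using bij_betw_finite[OF bij_betw_app_Sn, of n] finite_permutations[of "{1..n}"] by simp

lemma card_Sn: "card (Sn n) = fact n"
  using bij_betw_same_card[OF bij_betw_app_Sn, of n] card_permutations[of "{1..n}" n] by simp

lemma zero_in_Sn [simp]: "0 \<in> Sn n"
  by (simp add: Sn_def zero_fperm.rep_eq permutes_id)

lemma plus_in_Sn: "a \<in> Sn n \<Longrightarrow> b \<in> Sn n \<Longrightarrow> a + b \<in> Sn n"
  by (simp add: Sn_def plus_fperm.rep_eq permutes_compose)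

lemma uminus_in_Sn [simp]: "- a \<in> Sn n \<longleftrightarrow> a \<in> Sn n"
  by (metis Sn_def mem_Collect_eq minus_minus permutes_inv uminus_fperm.rep_eq)

lemma Sn_mono: "m \<le> n \<Longrightarrow> Sn m \<subseteq> Sn n"
  by (auto simp: Sn_def intro: permutes_subset)

lemma app_in_iff: "a \<in> Sn n \<Longrightarrow> app a x \<in> {1..n} \<longleftrightarrow> x \<in> {1..n}"
  by (simp only: Sn_def mem_Collect_eq permutes_in_image)

lemma app_outside: "a \<in> Sn n \<Longrightarrow> x \<notin> {1..n} \<Longrightarrow> app a x = x"
  by (simp add: Sn_def permutes_not_in del: atLeastAtMost_iff)

lemma Sn_Suc_fixing: "a \<in> Sn (Suc n) \<Longrightarrow> app a (Suc n) = Suc n \<Longrightarrow> a \<in> Sn n"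
  unfolding Sn_def mem_Collect_eq
  by (rule permutes_superset) (auto simp: le_Suc_eq)

lemma Sn_0: "Sn 0 = {0}"
  by (auto simp: Sn_def zero_fperm.rep_eq permutes_id intro!: fperm_eqI)

type_synonym galg = "fperm \<Rightarrow>\<^sub>0 complex"

abbreviation cst :: "complex \<Rightarrow> galg" where
  "cst c \<equiv> Poly_Mapping.single 0 c"

abbreviation grp :: "fperm \<Rightarrow> galg" where
  "grp a \<equiv> Poly_Mapping.single a 1"

abbreviation coef :: "galg \<Rightarrow> fperm \<Rightarrow> complex" where
  "coef \<equiv> Poly_Mapping.lookup"

abbreviation tr :: "galg \<Rightarrow> complex" where
  "tr x \<equiv> coef x 0"

lemma grp_plus: "grp (a + b) = grp a * grp b"
  by (simp add: mult_single)

lemma grp_cancel [simp]: "grp a * grp (- a) = 1" "grp (- a) * grp a = 1"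
  by (simp_all flip: grp_plus)

lemma grp_cancel_left [simp]: "grp a * (grp (- a) * x) = x" "grp (- a) * (grp a * x) = x"
  by (simp_all flip: mult.assoc)

lemma cst_mult: "cst (c * d) = cst c * cst d"
  by (simp add: mult_single)

lemma cst_grp: "cst c * grp a = Poly_Mapping.single a c"
  by (simp add: mult_single)

lemma lookup_times:
  fixes x y :: galg
  assumes "finite S" "Poly_Mapping.keys x \<subseteq> S"
  shows "coef (x * y) a =
    (\<Sum>b\<in>S. coef x b * coef y (- b + a))"
proof -
  have *: "a = b + q \<longleftrightarrow> q = - b + a" for b q
    by (metis add.assoc add.left_neutral left_minus right_minus)
  have "coef (x * y) a =
      (\<Sum>b. coef x b * coef y (- b + a))"
    unfolding lookup_mult * by simp
  also have "\<dots> = (\<Sum>b\<in>S. coef x b * coef y (- b + a))"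
    using assms by (intro Sum_any.expand_superset) (auto simp: in_keys_iff)
  finally show ?thesis .
qed

lemma lookup_cst_mult [simp]: "coef (cst c * x) a = c * coef x a"
  by (subst lookup_times[of "{0}"]) auto

lemma lookup_grp_mult: "coef (grp b * x) a = coef x (- b + a)"
  by (subst lookup_times[of "{b}"]) auto

lemma galg_expand:
  fixes x :: galg
  assumes "finite S" "Poly_Mapping.keys x \<subseteq> S"
  shows "x = (\<Sum>a\<in>S. cst (coef x a) * grp a)"
proof (rule poly_mapping_eqI)
  fix b
  have "coef (\<Sum>a\<in>S. cst (coef x a) * grp a) b =
      (\<Sum>a\<in>S. if b = a then coef x a else 0)"
    by (auto simp: lookup_sum cst_grp lookup_single when_def intro!: sum.cong)
  also have "\<dots> = coef x b"
    using assms by (auto simp: in_keys_iff)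
  finally show "coef x b =
    coef (\<Sum>a\<in>S. cst (coef x a) * grp a) b" by simp
qed

lemma cst_commute: "x * cst c = cst c * x" for x :: galg
proof -
  define s where "s = (\<Sum>a\<in>Poly_Mapping.keys x. cst (coef x a) * grp a)"
  have "x = s" unfolding s_def by (rule galg_expand) auto
  moreover have "s * cst c = cst c * s"
    by (simp add: s_def sum_distrib_left sum_distrib_right mult_single mult.commute)
  ultimately show ?thesis by simp
qed

lemma cst_left_commute: "x * (cst c * y) = cst c * (x * y)" for x :: galg
  by (metis cst_commute mult.assoc)

text \<open>Reindexing by inversion turns one convolution into the other. On \<open>An n\<close>
  this trace is the character of the regular representation divided by \<open>n!\<close>; unknown
  scalars are computed with it throughout.\<close>

lemma tr_commute: "tr (x * y) = tr (y * x)"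
proof -
  define S where "S = Poly_Mapping.keys x \<union> uminus ` Poly_Mapping.keys y"
  have "tr (x * y) = (\<Sum>b\<in>S. coef x b * coef y (- b))"
    by (subst lookup_times[of S]) (auto simp: S_def)
  also have "\<dots> = (\<Sum>b\<in>uminus ` S. coef y b * coef x (- b))"
    by (subst sum.reindex) (auto simp: inj_on_def mult.commute)
  also have "\<dots> = tr (y * x)"
    by (subst lookup_times[of "uminus ` S"]) (auto simp: S_def image_Un image_image)
  finally show ?thesis .
qed

lemma tr_mult_grp: "tr (x * grp a) = coef x (- a)"
  by (subst tr_commute) (simp add: lookup_grp_mult)

text \<open>All the algebras are subsets of one type, so multiplying a unit of size \<open>n\<close>
  by a symmetrizer of size \<open>n + 1\<close> needs no embedding.\<close>

definition An :: "nat \<Rightarrow> galg set" where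
  "An n = {x. Poly_Mapping.keys x \<subseteq> Sn n}"

lemma An_lookup: "x \<in> An n \<Longrightarrow> a \<notin> Sn n \<Longrightarrow> coef x a = 0"
  by (auto simp: An_def in_keys_iff)

lemma An_I: "(\<And>a. a \<notin> Sn n \<Longrightarrow> coef x a = 0) \<Longrightarrow> x \<in> An n"
  by (auto simp: An_def in_keys_iff)

lemma An_single [simp]: "a \<in> Sn n \<Longrightarrow> Poly_Mapping.single a c \<in> An n"
  by (auto simp: An_def)

lemma An_zero [simp]: "0 \<in> An n"
  by (simp add: An_def)

lemma An_one [simp]: "1 \<in> An n"
  using An_single[OF zero_in_Sn, of 1] by simp

lemma An_add: "x \<in> An n \<Longrightarrow> y \<in> An n \<Longrightarrow> x + y \<in> An n"
  by (auto simp: lookup_add An_lookup intro!: An_I)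

lemma An_minus: "x \<in> An n \<Longrightarrow> y \<in> An n \<Longrightarrow> x - y \<in> An n"
  by (auto simp: lookup_minus An_lookup intro!: An_I)

lemma An_sum: "(\<And>i. i \<in> I \<Longrightarrow> f i \<in> An n) \<Longrightarrow> sum f I \<in> An n"
  by (intro An_I) (auto simp: lookup_sum intro!: sum.neutral intro: An_lookup)

lemma An_mult: "x \<in> An n \<Longrightarrow> y \<in> An n \<Longrightarrow> x * y \<in> An n"
  using keys_mult[of x y] by (auto simp: An_def plus_in_Sn subset_iff)

lemma An_mono: "m \<le> n \<Longrightarrow> An m \<subseteq> An n"
  using Sn_mono by (fastforce simp: An_def)

lemmas An_closed = An_add An_minus An_sum An_mult

lemma An_expand: "x \<in> An n \<Longrightarrow> x = (\<Sum>a\<in>Sn n. cst (coef x a) * grp a)"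
  by (rule galg_expand) (auto simp: An_def)

lemma An_induct [consumes 1, case_names zero grp add]:
  assumes "x \<in> An n" "Q 0" "\<And>a c. a \<in> Sn n \<Longrightarrow> Q (cst c * grp a)"
    "\<And>x y. Q x \<Longrightarrow> Q y \<Longrightarrow> Q (x + y)"
  shows "Q x"
proof -
  have "Q (\<Sum>a\<in>A. cst (coef x a) * grp a)" if "A \<subseteq> Sn n" for A
  proof -
    have "finite A" using that finite_Sn finite_subset by blast
    then show ?thesis using that
      by (induction A rule: finite_induct) (auto intro: assms)
  qed
  from this[OF order_refl] show ?thesis by (simp only: An_expand[OF assms(1), symmetric])
qed

lemma An_0: "x \<in> An 0 \<Longrightarrow> \<exists>c. x = cst c"
  by (rule exI[of _ "tr x"], rule trans[OF An_expand]) (auto simp: Sn_0)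

lemma An_commute:
  assumes "x \<in> An n" "\<And>a. a \<in> Sn n \<Longrightarrow> y * grp a = grp a * y"
  shows "y * x = x * y"
  using assms(1)
  by (induction rule: An_induct)
    (simp_all add: distrib_left distrib_right cst_left_commute mult.assoc assms(2))

section \<open>Row symmetrizers and column antisymmetrizers\<close>

text \<open>A filling is given by the functions \<open>f\<close> that send an entry to the index of its row, respectively of its
  column.\<close>

definition stab :: "nat \<Rightarrow> (nat \<Rightarrow> nat) \<Rightarrow> fperm set" where
  "stab n f = {a \<in> Sn n. \<forall>x\<in>{1..n}. f (app a x) = f x}"

definition symm :: "nat \<Rightarrow> (nat \<Rightarrow> nat) \<Rightarrow> galg" where
  "symm n f = (\<Sum>a\<in>stab n f. grp a)"

definition antisymm :: "nat \<Rightarrow> (nat \<Rightarrow> nat) \<Rightarrow> galg" where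
  "antisymm n f = (\<Sum>a\<in>stab n f. cst (sgn_of a) * grp a)"

lemma stab_subset: "stab n f \<subseteq> Sn n"
  by (auto simp: stab_def)

lemma finite_stab [simp]: "finite (stab n f)"
  using finite_subset[OF stab_subset] by simp

lemma zero_in_stab [simp]: "0 \<in> stab n f"
  by (simp add: stab_def)

lemma plus_in_stab: "a \<in> stab n f \<Longrightarrow> b \<in> stab n f \<Longrightarrow> a + b \<in> stab n f"
  using app_in_iff[of b n] by (simp add: stab_def plus_in_Sn del: atLeastAtMost_iff)

lemma uminus_in_stab:
  assumes "a \<in> stab n f"
  shows "- a \<in> stab n f"
proof -
  have "f (app (- a) x) = f x" if "x \<in> {1..n}" for x
  proof -
    have "app (- a) x \<in> {1..n}"
      using app_in_iff[of "- a" n x] assms that by (simp add: stab_def)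
    then have "f (app a (app (- a) x)) = f (app (- a) x)"
      using assms by (simp add: stab_def del: app_uminus_app)
    then show ?thesis by simp
  qed
  then show ?thesis using assms by (simp add: stab_def)
qed

lemma uminus_in_stab_iff [simp]: "- a \<in> stab n f \<longleftrightarrow> a \<in> stab n f"
  by (metis minus_minus uminus_in_stab)

lemma symm_An: "symm n f \<in> An n" and antisymm_An: "antisymm n f \<in> An n"
  by (auto simp: symm_def antisymm_def mult_single stab_def intro!: An_sum)

lemma stab_cong: "(\<And>x. x \<in> {1..n} \<Longrightarrow> f x = g x) \<Longrightarrow> stab n f = stab n g"
  unfolding stab_def by (rule Collect_cong) (metis app_in_iff)

lemma symm_cong: "(\<And>x. x \<in> {1..n} \<Longrightarrow> f x = g x) \<Longrightarrow> symm n f = symm n g"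
  and antisymm_cong: "(\<And>x. x \<in> {1..n} \<Longrightarrow> f x = g x) \<Longrightarrow> antisymm n f = antisymm n g"
  using stab_cong[of n f g] by (auto simp: symm_def antisymm_def)

lemma bij_plus_left_stab: "a \<in> stab n f \<Longrightarrow> bij_betw ((+) a) (stab n f) (stab n f)"
  by (rule bij_betw_byWitness[where f' = "(+) (- a)"])
    (auto simp: plus_in_stab)

lemma bij_plus_right_stab: "a \<in> stab n f \<Longrightarrow> bij_betw (\<lambda>b. b + a) (stab n f) (stab n f)"
  by (rule bij_betw_byWitness[where f' = "\<lambda>b. b - a"])
    (auto simp: plus_in_stab simp flip: add_uminus_conv_diff,
      simp_all add: add.assoc del: add_uminus_conv_diff)

lemma grp_symm:
  assumes "a \<in> stab n f"
  shows "grp a * symm n f = symm n f" "symm n f * grp a = symm n f"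
proof -
  show "grp a * symm n f = symm n f"
    unfolding symm_def sum_distrib_left
    using sum.reindex_bij_betw[OF bij_plus_left_stab[OF assms], of grp] by (simp add: mult_single)
  show "symm n f * grp a = symm n f"
    unfolding symm_def sum_distrib_right
    using sum.reindex_bij_betw[OF bij_plus_right_stab[OF assms], of grp] by (simp add: mult_single)
qed

lemma grp_antisymm:
  assumes "a \<in> stab n f"
  shows "grp a * antisymm n f = cst (sgn_of a) * antisymm n f" "antisymm n f * grp a = cst (sgn_of a) * antisymm n f"
proof -
  have "grp a * antisymm n f = (\<Sum>b\<in>stab n f. cst (sgn_of a) * (cst (sgn_of (a + b)) * grp (a + b)))"
    unfolding antisymm_def sum_distrib_left by (simp add: mult_single sgn_of_plus)
  also have "\<dots> = cst (sgn_of a) * antisymm n f"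
    unfolding antisymm_def sum_distrib_left
    by (rule sum.reindex_bij_betw[OF bij_plus_left_stab[OF assms]])
  finally show "grp a * antisymm n f = cst (sgn_of a) * antisymm n f" .
  have "antisymm n f * grp a = (\<Sum>b\<in>stab n f. cst (sgn_of a) * (cst (sgn_of (b + a)) * grp (b + a)))"
    unfolding antisymm_def sum_distrib_right
    by (simp add: mult_single sgn_of_plus mult.commute[of "sgn_of _" "sgn_of a"])
  also have "\<dots> = cst (sgn_of a) * antisymm n f"
    unfolding antisymm_def sum_distrib_left
    by (rule sum.reindex_bij_betw[OF bij_plus_right_stab[OF assms]])
  finally show "antisymm n f * grp a = cst (sgn_of a) * antisymm n f" .
qed

lemma symm_symm: "symm n f * symm n f = of_nat (card (stab n f)) * symm n f"
  by (subst (1) symm_def) (simp add: sum_distrib_right grp_symm)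

lemma bij_conj_stab:
  assumes "a \<in> Sn n"
  shows "bij_betw (\<lambda>b. a + b + - a) (stab n f) (stab n (\<lambda>x. f (app (- a) x)))"
proof (rule bij_betw_byWitness[where f' = "\<lambda>b. - a + b + a"])
  show "\<forall>b\<in>stab n f. - a + (a + b + - a) + a = b"
    by (metis add.assoc add.left_neutral add.right_neutral left_minus)
  show "\<forall>b\<in>stab n (\<lambda>x. f (app (- a) x)). a + (- a + b + a) + - a = b"
    by (metis add.assoc add.left_neutral add.right_neutral right_minus)
  have in_iff: "app (- a) x \<in> {1..n} \<longleftrightarrow> x \<in> {1..n}" "app a x \<in> {1..n} \<longleftrightarrow> x \<in> {1..n}" for x
    using app_in_iff assms uminus_in_Sn by blast+
  show "(\<lambda>b. a + b + - a) ` stab n f \<subseteq> stab n (\<lambda>x. f (app (- a) x))"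
    using assms in_iff
    by (auto simp: stab_def plus_in_Sn simp del: add_uminus_conv_diff atLeastAtMost_iff)
  show "(\<lambda>b. - a + b + a) ` stab n (\<lambda>x. f (app (- a) x)) \<subseteq> stab n f"
    using assms in_iff
    by (auto simp: stab_def plus_in_Sn simp del: add_uminus_conv_diff atLeastAtMost_iff)
qed

lemma grp_conj_symm:
  assumes "a \<in> Sn n"
  shows "grp a * symm n f = symm n (\<lambda>x. f (app (- a) x)) * grp a"
proof -
  have "symm n (\<lambda>x. f (app (- a) x)) = (\<Sum>b\<in>stab n f. grp (a + b + - a))"
    unfolding symm_def by (rule sum.reindex_bij_betw[OF bij_conj_stab[OF assms], symmetric])
  then show ?thesis
    by (simp add: symm_def sum_distrib_left sum_distrib_right mult_single add.assoc
        del: add_uminus_conv_diff)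
qed

lemma grp_conj_antisymm:
  assumes "a \<in> Sn n"
  shows "grp a * antisymm n f = antisymm n (\<lambda>x. f (app (- a) x)) * grp a"
proof -
  have "antisymm n (\<lambda>x. f (app (- a) x)) = (\<Sum>b\<in>stab n f. cst (sgn_of (a + b + - a)) * grp (a + b + - a))"
    unfolding antisymm_def by (rule sum.reindex_bij_betw[OF bij_conj_stab[OF assms], symmetric])
  then show ?thesis
    by (simp add: antisymm_def sum_distrib_left sum_distrib_right mult_single add.assoc sgn_of_plus
        mult.commute[of "sgn_of _" "sgn_of a"] del: add_uminus_conv_diff)
qed

text \<open>Members of \<open>fperm\<close> fix 0, so an index 0 yields the identity as a default
  value.\<close>

lift_definition fswap :: "nat \<Rightarrow> nat \<Rightarrow> fperm" is
  "\<lambda>a b. if 1 \<le> a \<and> 1 \<le> b then Transposition.transpose a b else id"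
proof -
  fix a b :: nat
  show "\<exists>n. (if 1 \<le> a \<and> 1 \<le> b then Transposition.transpose a b else id) permutes {1..n}"
    by (rule exI[of _ "max a b"]) (auto intro: permutes_swap_id permutes_id)
qed

lemma app_fswap: "1 \<le> a \<Longrightarrow> 1 \<le> b \<Longrightarrow> app (fswap a b) = Transposition.transpose a b"
  by transfer simp

lemma fswap_in_Sn: "a \<in> {1..n} \<Longrightarrow> b \<in> {1..n} \<Longrightarrow> fswap a b \<in> Sn n"
  by (simp add: Sn_def app_fswap permutes_swap_id)

lemma sgn_of_fswap: "1 \<le> a \<Longrightarrow> 1 \<le> b \<Longrightarrow> a \<noteq> b \<Longrightarrow> sgn_of (fswap a b) = - 1"
  by (simp add: sgn_of_def app_fswap sign_swap_id)

lemma fswap_in_stab: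
  "a \<in> {1..n} \<Longrightarrow> b \<in> {1..n} \<Longrightarrow> f a = f b \<Longrightarrow> fswap a b \<in> stab n f"
  by (simp add: stab_def fswap_in_Sn) (simp add: app_fswap Transposition.transpose_def)

text \<open>The transposition of \<open>a\<close> and \<open>b\<close> lies in both stabilizers:
  \<open>symm\<close> absorbs it with sign 1 and \<open>antisymm\<close> with sign -1, so the
  product equals its own negative.\<close>

lemma symm_antisymm_eq_zero:
  assumes "a \<in> {1..n}" "b \<in> {1..n}" "a \<noteq> b" "f a = f b" "g a = g b"
  shows "symm n f * antisymm n g = 0" "antisymm n g * symm n f = 0"
proof -
  let ?t = "fswap a b"
  have s: "sgn_of ?t = - 1" using assms sgn_of_fswap by simp
  have t: "?t \<in> stab n f" "?t \<in> stab n g" using assms fswap_in_stab by blast+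
  have neg: "x = 0" if "x = - x" for x :: galg
  proof (rule poly_mapping_eqI)
    show "coef x k = coef 0 k" for k
      using arg_cong[OF that, of "\<lambda>y. coef y k"] by simp
  qed
  have "symm n f * antisymm n g = symm n f * (grp ?t * antisymm n g)"
    by (simp flip: mult.assoc add: grp_symm t)
  also have "\<dots> = - (symm n f * antisymm n g)"
    by (simp add: grp_antisymm t s single_uminus)
  finally show "symm n f * antisymm n g = 0" by (rule neg)
  have "antisymm n g * symm n f = (antisymm n g * grp ?t) * symm n f"
    by (simp add: mult.assoc grp_symm t)
  also have "\<dots> = - (antisymm n g * symm n f)"
    by (simp add: grp_antisymm t s single_uminus)
  finally show "antisymm n g * symm n f = 0" by (rule neg)
qed

lemma stab_Suc_inter: "stab (Suc n) f \<inter> Sn n = stab n f"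
  using Sn_mono[of n "Suc n"] by (auto simp: stab_def le_Suc_eq app_outside)

text \<open>A product \<open>p q\<close> of a row and a column permutation fixes \<open>n + 1\<close> only if both factors do, because
  \<open>q (n + 1) = p\<^sup>-\<^sup>1 (n + 1)\<close> lies both in the row and in the column of \<open>n + 1\<close>.\<close>

lemma tr_symm_antisymm_Suc:
  assumes inj: "inj_on (\<lambda>x. (f x, g x)) {1..Suc n}" and x: "x \<in> An n"
  shows "tr (x * (symm (Suc n) f * antisymm (Suc n) g)) = tr (x * (symm n f * antisymm n g))"
proof -
  have expand: "tr (x * (symm m f * antisymm m g)) =
      (\<Sum>(p, q)\<in>stab m f \<times> stab m g. sgn_of q * coef x (- (p + q)))" for m
  proof -
    have "x * (symm m f * antisymm m g) =
        (\<Sum>(p, q)\<in>stab m f \<times> stab m g. cst (sgn_of q) * (x * grp (p + q)))"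
      unfolding symm_def antisymm_def sum_product sum.cartesian_product grp_plus
      unfolding sum_distrib_left
      by (rule sum.cong) (auto simp: cst_left_commute[of x] cst_left_commute[of "grp _"])
    then show ?thesis
      by (simp add: lookup_sum tr_mult_grp case_prod_unfold del: minus_add)
  qed
  have fix_both: "p \<in> stab n f \<and> q \<in> stab n g"
    if "p \<in> stab (Suc n) f" "q \<in> stab (Suc n) g" "p + q \<in> Sn n" for p q
  proof -
    have "app p (app q (Suc n)) = Suc n"
      using app_outside[OF that(3), of "Suc n"] by simp
    then have eq: "app q (Suc n) = app (- p) (Suc n)" by (metis app_uminus_app(1))
    have "g (app q (Suc n)) = g (Suc n)" using that by (simp add: stab_def)
    moreover have "f (app q (Suc n)) = f (Suc n)"
      using uminus_in_stab[OF that(1)] unfolding eq by (simp add: stab_def)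
    moreover have "app q (Suc n) \<in> {1..Suc n}"
      using that app_in_iff[of q "Suc n" "Suc n"] by (simp add: stab_def)
    ultimately have "app q (Suc n) = Suc n"
      by (intro inj_onD[OF inj]) auto
    moreover from this have "app p (Suc n) = Suc n" using eq by (metis app_uminus_app(2))
    ultimately have "p \<in> Sn n" "q \<in> Sn n" using that Sn_Suc_fixing by (auto simp: stab_def)
    then show ?thesis using that stab_Suc_inter by blast
  qed
  have "(\<Sum>(p, q)\<in>stab (Suc n) f \<times> stab (Suc n) g. sgn_of q * coef x (- (p + q))) =
      (\<Sum>(p, q)\<in>stab n f \<times> stab n g. sgn_of q * coef x (- (p + q)))"
  proof (rule sum.mono_neutral_right)
    show "stab n f \<times> stab n g \<subseteq> stab (Suc n) f \<times> stab (Suc n) g"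
      using stab_Suc_inter by blast
    show "\<forall>i\<in>stab (Suc n) f \<times> stab (Suc n) g - stab n f \<times> stab n g.
        (case i of (p, q) \<Rightarrow> sgn_of q * coef x (- (p + q))) = 0"
      using fix_both An_lookup[OF x] by (auto simp del: minus_add) (metis uminus_in_Sn)+
  qed simp
  then show ?thesis unfolding expand .
qed

lemma tr_symm_antisymm:
  assumes "inj_on (\<lambda>x. (f x, g x)) {1..n}"
  shows "tr (symm n f * antisymm n g) = 1"
  using assms
proof (induction n)
  case 0
  have "stab 0 f = {0}" for f using stab_subset[of 0 f] zero_in_stab[of 0 f] Sn_0 by blast
  then show ?case by (simp add: symm_def antisymm_def)
next
  case (Suc n)
  have "inj_on (\<lambda>x. (f x, g x)) {1..n}" by (rule inj_on_subset[OF Suc.prems]) auto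
  then show ?case using tr_symm_antisymm_Suc[OF Suc.prems, of 1] Suc.IH by simp
qed

section \<open>Fillings of Young diagrams\<close>

text \<open>The shape is recorded by its weakly decreasing row lengths \<open>l\<close>, rows being
  indexed from 0. The last clause lets sums over rows run over \<open>i < n\<close>.\<close>

definition filling :: "(nat \<Rightarrow> nat) \<Rightarrow> nat \<Rightarrow> (nat \<Rightarrow> nat) \<Rightarrow> (nat \<Rightarrow> nat) \<Rightarrow> bool" where
  "filling l n f g \<longleftrightarrow> bij_betw (\<lambda>x. (f x, g x)) {1..n} {(i, c). c < l i} \<and>
     (\<forall>i j. i \<le> j \<longrightarrow> l j \<le> l i) \<and> (\<forall>i\<ge>n. l i = 0)"

lemma filling_inj: "filling l n f g \<Longrightarrow> inj_on (\<lambda>x. (f x, g x)) {1..n}"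
  by (simp add: filling_def bij_betw_def)

lemma filling_cell: "filling l n f g \<Longrightarrow> x \<in> {1..n} \<Longrightarrow> g x < l (f x)"
  by (auto simp: filling_def bij_betw_def)

lemma filling_row_less: "filling l n f g \<Longrightarrow> x \<in> {1..n} \<Longrightarrow> f x < n"
  using filling_cell[of l n f g x] by (auto simp: filling_def not_less[symmetric])

lemma filling_conj:
  assumes "filling l n f g" "a \<in> Sn n"
  shows "filling l n (\<lambda>x. f (app a x)) (\<lambda>x. g (app a x))"
proof -
  have "bij_betw (app a) {1..n} {1..n}"
    using assms(2) by (simp add: Sn_def permutes_imp_bij)
  then have "bij_betw ((\<lambda>x. (f x, g x)) \<circ> app a) {1..n} {(i, c). c < l i}"
    using assms(1) by (auto simp: filling_def intro: bij_betw_trans)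
  then show ?thesis using assms(1) by (simp add: filling_def o_def)
qed

lemma card_row_part:
  assumes "filling l n f g"
  shows "card {x\<in>{1..n}. f x = i \<and> g x < k} = min (l i) k"
proof -
  have bij: "bij_betw (\<lambda>x. (f x, g x)) {1..n} {(i, c). c < l i}"
    using assms by (simp add: filling_def)
  let ?F = "\<lambda>x. (f x, g x)"
  have "?F ` {x\<in>{1..n}. f x = i \<and> g x < k} = ?F ` {1..n} \<inter> {i} \<times> {..<k}"
    by auto
  also have "\<dots> = {i} \<times> {..<min (l i) k}"
    using bij by (auto simp: bij_betw_def)
  finally have c: "card (?F ` {x\<in>{1..n}. f x = i \<and> g x < k}) = min (l i) k" by simp
  have inj: "inj_on ?F {x\<in>{1..n}. f x = i \<and> g x < k}"
    by (rule inj_on_subset[OF filling_inj[OF assms]]) auto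
  show ?thesis using c by (rule trans[OF card_image[OF inj, symmetric]])
qed

lemma card_row:
  assumes "filling l n f g"
  shows "card {x\<in>{1..n}. f x = i} = l i"
proof -
  have "{x\<in>{1..n}. f x = i} = {x\<in>{1..n}. f x = i \<and> g x < l i}"
    using filling_cell[OF assms] by auto
  then show ?thesis using card_row_part[OF assms, of i "l i"] by simp
qed

lemma card_by_rows:
  assumes "filling l n f g"
  shows "card {x\<in>{1..n}. g' x < k} = (\<Sum>i<n. card {x\<in>{1..n}. f x = i \<and> g' x < k})"
proof -
  have "{x\<in>{1..n}. g' x < k} = (\<Union>i<n. {x\<in>{1..n}. f x = i \<and> g' x < k})"
    using filling_row_less[OF assms] by auto
  then show ?thesis by (simp only:) (subst card_UN_disjoint, auto)
qed

text \<open>For the conjugate partition \<lambda>' this number is \<lambda>'_1 + ... + \<lambda>'_k;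
  comparing it for all \<open>k\<close> is the dominance order on conjugates.\<close>

lemma card_columns_less:
  assumes "filling l n f g"
  shows "card {x\<in>{1..n}. g x < k} = (\<Sum>i<n. min (l i) k)"
  using card_by_rows[OF assms, of g k] card_row_part[OF assms] by simp

text \<open>Entries in one row of the first filling lie in different columns of the second, so at
  most \<open>k\<close> of them lie in the first \<open>k\<close> columns.\<close>

lemma card_row_part_le:
  assumes "filling l n f g" "inj_on (\<lambda>x. (f x, g' x)) {1..n}"
  shows "card {x\<in>{1..n}. f x = i \<and> g' x < k} \<le> min (l i) k"
proof -
  have "card {x\<in>{1..n}. f x = i \<and> g' x < k} \<le> card {x\<in>{1..n}. f x = i}"
    by (rule card_mono) auto
  moreover have "card {x\<in>{1..n}. f x = i \<and> g' x < k} \<le> card {..<k}"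
  proof (rule card_inj_on_le[of g'])
    show "inj_on g' {x\<in>{1..n}. f x = i \<and> g' x < k}"
      by (rule inj_onI, rule inj_onD[OF assms(2)]) auto
  qed auto
  ultimately show ?thesis using card_row[OF assms(1)] by simp
qed

text \<open>Count the entries in the first \<open>k\<close> columns of the second filling row by row
  of the first.\<close>

lemma filling_transversal_dominance:
  assumes "filling l n f g" "filling l' n f' g'" "inj_on (\<lambda>x. (f x, g' x)) {1..n}"
  shows "(\<Sum>i<n. min (l' i) k) \<le> (\<Sum>i<n. min (l i) k)"
  using card_columns_less[OF assms(2), of k] card_by_rows[OF assms(1), of g' k]
    card_row_part_le[OF assms(1,3)] by (simp add: sum_mono)

text \<open>Equal shapes turn the dominance inequality into an equality, so every row of the first
  filling meets the first \<open>k\<close> columns of the second in as many entries as possible.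
  Taking the row length for \<open>k\<close> shows that row \<open>i\<close> occupies the columns
  below \<open>l i\<close>.\<close>

lemma filling_transversal_same_shape:
  assumes f: "filling l n f g" and f': "filling l n f' g'"
    and inj: "inj_on (\<lambda>x. (f x, g' x)) {1..n}"
  shows "filling l n f g'"
proof -
  let ?D = "{(i, c). c < l i}"
  have eq: "card {x\<in>{1..n}. f x = i \<and> g' x < k} = min (l i) k" if "i < n" for i k
  proof (rule ccontr)
    assume ne: "card {x\<in>{1..n}. f x = i \<and> g' x < k} \<noteq> min (l i) k"
    have "(\<Sum>i<n. card {x\<in>{1..n}. f x = i \<and> g' x < k}) < (\<Sum>i<n. min (l i) k)"
    proof (rule sum_strict_mono_ex1)
      show "\<forall>i\<in>{..<n}. card {x\<in>{1..n}. f x = i \<and> g' x < k} \<le> min (l i) k"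
        using card_row_part_le[OF f inj] by blast
      have "card {x\<in>{1..n}. f x = i \<and> g' x < k} < min (l i) k"
        using card_row_part_le[OF f inj] ne le_neq_implies_less by blast
      then show "\<exists>i\<in>{..<n}. card {x\<in>{1..n}. f x = i \<and> g' x < k} < min (l i) k"
        using that by blast
    qed simp
    then show False
      using card_columns_less[OF f', of k] card_by_rows[OF f, of g' k] by simp
  qed
  have "g' x < l (f x)" if x: "x \<in> {1..n}" for x
  proof -
    have "card {y\<in>{1..n}. f y = f x \<and> g' y < l (f x)} = card {y\<in>{1..n}. f y = f x}"
      using eq[OF filling_row_less[OF f x]] card_row[OF f] by simp
    then have "{y\<in>{1..n}. f y = f x \<and> g' y < l (f x)} = {y\<in>{1..n}. f y = f x}"
      by (intro card_subset_eq) auto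
    then show ?thesis using x by blast
  qed
  then have sub: "(\<lambda>x. (f x, g' x)) ` {1..n} \<subseteq> ?D" by auto
  have "card ?D = n" "finite ?D"
    using f bij_betw_same_card[of _ "{1..n}" ?D] bij_betw_finite[of _ "{1..n}" ?D]
    by (auto simp: filling_def)
  then have "(\<lambda>x. (f x, g' x)) ` {1..n} = ?D"
    using sub inj by (intro card_subset_eq) (auto simp: card_image)
  then show ?thesis using f inj by (simp add: filling_def bij_betw_def)
qed

text \<open>Passing from \<open>k\<close> to \<open>k + 1\<close> adds the number of rows longer
  than \<open>k\<close>. For both shapes these rows form an initial segment, so equal numbers mean
  equal sets.\<close>

lemma sum_min_determines_shape:
  assumes l: "\<And>i j. i \<le> j \<Longrightarrow> l j \<le> l i" "\<And>i. i \<ge> n \<Longrightarrow> l i = 0"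
    and l': "\<And>i j. i \<le> j \<Longrightarrow> l' j \<le> l' i" "\<And>i. i \<ge> n \<Longrightarrow> l' i = 0"
    and eq: "\<And>k. (\<Sum>i<n. min (l i) k) = (\<Sum>i<n. min (l' i) k)"
  shows "l = (l' :: nat \<Rightarrow> nat)"
proof -
  have diff: "(\<Sum>i<n. min (l i) (Suc k)) = (\<Sum>i<n. min (l i) k) + card {i. i < n \<and> k < l i}"
    for l :: "nat \<Rightarrow> nat" and k
  proof -
    have "(\<Sum>i<n. min (l i) (Suc k)) = (\<Sum>i<n. min (l i) k + (if k < l i then 1 else 0))"
      by (rule sum.cong) auto
    also have "\<dots> = (\<Sum>i<n. min (l i) k) + card {i. i < n \<and> k < l i}"
      by (simp add: sum.distrib sum.If_cases Int_def)
    finally show ?thesis .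
  qed
  have sets: "{i. i < n \<and> k < l i} = {i. i < n \<and> k < l' i}" for k
  proof -
    let ?A = "{i. i < n \<and> k < l i}" and ?B = "{i. i < n \<and> k < l' i}"
    have c: "card ?A = card ?B"
      using diff[of l k] diff[of l' k] eq by simp
    have "?A \<subseteq> ?B \<or> ?B \<subseteq> ?A"
    proof (rule ccontr)
      assume "\<not> (?A \<subseteq> ?B \<or> ?B \<subseteq> ?A)"
      then obtain i j where ij: "i < n" "k < l i" "\<not> k < l' i" "j < n" "k < l' j" "\<not> k < l j"
        by blast
      then show False using l(1)[of j i] l'(1)[of i j] by (cases "i \<le> j") auto
    qed
    then show ?thesis
    proof
      assume "?A \<subseteq> ?B"
      then show ?thesis using c by (intro card_subset_eq) auto
    next
      assume "?B \<subseteq> ?A"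
      then have "?B = ?A" using c by (intro card_subset_eq) auto
      then show ?thesis by simp
    qed
  qed
  show ?thesis
  proof
    fix i
    have "k < l i \<longleftrightarrow> k < l' i" for k
      using sets[of k] l(2)[of i] l'(2)[of i] by (cases "i < n") auto
    from this[of "l i"] this[of "l' i"] show "l i = l' i" by simp
  qed
qed

text \<open>Two transversal pairs, one in each direction, give dominance both ways, and dominance is
  antisymmetric.\<close>

lemma filling_shapes_eq:
  assumes f: "filling l n f g" and f': "filling l' n f' g'"
    and "inj_on (\<lambda>x. (f x, g' x)) {1..n}" "inj_on (\<lambda>x. (h' x, h x)) {1..n}"
    and h: "filling l n k h" "filling l' n h' k'"
  shows "l = l'"
proof (rule sum_min_determines_shape[of l n l'])
  show "(\<Sum>i<n. min (l i) k) = (\<Sum>i<n. min (l' i) k)" for k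
    using filling_transversal_dominance[OF f f' assms(3), of k]
      filling_transversal_dominance[OF h(2,1) assms(4), of k] by simp
qed (use f f' in \<open>auto simp: filling_def\<close>)

lemma filling_transport:
  assumes "filling l n f g" "filling l n f' g'"
  obtains p where "p \<in> Sn n" "\<And>x. x \<in> {1..n} \<Longrightarrow> f (app p x) = f' x"
    "\<And>x. x \<in> {1..n} \<Longrightarrow> g (app p x) = g' x"
proof -
  let ?F = "\<lambda>x. (f x, g x)" and ?F' = "\<lambda>x. (f' x, g' x)" and ?D = "{(i, c). c < l i}"
  have F: "bij_betw ?F {1..n} ?D" and F': "bij_betw ?F' {1..n} ?D"
    using assms by (auto simp: filling_def)
  define h where "h = (\<lambda>x. if x \<in> {1..n} then inv_into {1..n} ?F (?F' x) else x)"
  have "bij_betw (inv_into {1..n} ?F \<circ> ?F') {1..n} {1..n}"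
    using F' bij_betw_inv_into[OF F] by (rule bij_betw_trans)
  then have "bij_betw h {1..n} {1..n}"
    by (rule bij_betw_cong[THEN iffD1, rotated]) (simp add: h_def)
  then have h: "h permutes {1..n}"
    by (rule bij_imp_permutes) (simp add: h_def del: atLeastAtMost_iff)
  have "?F (h x) = ?F' x" if "x \<in> {1..n}" for x
  proof -
    have "?F' x \<in> ?F ` {1..n}" using that F F' unfolding bij_betw_def by blast
    from f_inv_into_f[OF this] show ?thesis using that by (simp only: h_def if_True)
  qed
  then show ?thesis using that[of "Fperm h"] Fperm_in_Sn[OF h] by (simp add: app_Fperm[OF h])
qed

text \<open>Von Neumann's lemma: \<open>P \<sigma> N = 0\<close> unless \<open>\<sigma>\<close> is a product of a row and a column permutation. If no two
  entries share both a row of the filling and a column of its \<open>\<sigma>\<close>-translate, counting the entries in the first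
  columns shows that each row of the filling meets the leftmost columns of the translate.\<close>

lemma symm_grp_antisymm_cases:
  assumes fg: "filling l n f g" and a: "a \<in> Sn n"
  obtains "symm n f * grp a * antisymm n g = 0" |
    p where "p \<in> stab n f" "p + a \<in> stab n g"
proof -
  let ?g = "\<lambda>x. g (app (- a) x)"
  have eq: "symm n f * grp a * antisymm n g = symm n f * antisymm n ?g * grp a"
    by (simp add: mult.assoc grp_conj_antisymm[OF a])
  show thesis
  proof (cases "inj_on (\<lambda>x. (f x, ?g x)) {1..n}")
    case False
    then obtain x y where "x \<in> {1..n}" "y \<in> {1..n}" "x \<noteq> y" "f x = f y" "?g x = ?g y"
      by (auto simp: inj_on_def)
    then have "symm n f * antisymm n ?g = 0" by (rule symm_antisymm_eq_zero)
    then show ?thesis using that(1) eq by simp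
  next
    case True
    have "filling l n f ?g"
      by (rule filling_transversal_same_shape[OF fg filling_conj[OF fg] True]) (simp add: a)
    \<comment> \<open>Both fillings have the row function \<open>f\<close>, so the transporting
      \<open>p\<close> is a row permutation, while \<open>p + a\<close> preserves the columns
      \<open>g\<close>.\<close>
    from filling_transport[OF fg this] obtain p where p: "p \<in> Sn n"
      "\<And>x. x \<in> {1..n} \<Longrightarrow> f (app p x) = f x" "\<And>x. x \<in> {1..n} \<Longrightarrow> g (app p x) = ?g x" by metis
    have "p \<in> stab n f" using p by (simp add: stab_def)
    moreover have "p + a \<in> stab n g"
      unfolding stab_def using p(1,3) a app_in_iff[OF a]
      by (simp add: plus_in_Sn del: atLeastAtMost_iff)
    ultimately show ?thesis by (rule that(2))
  qed
qed

text \<open>Split \<open>a\<close> into \<open>- p\<close> and \<open>p + a\<close>: the row factor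
  is absorbed by \<open>symm\<close>, the column factor by \<open>antisymm\<close> up to its
  sign.\<close>

lemma symm_grp_antisymm_factor:
  assumes "p \<in> stab n f" "p + a \<in> stab n g"
  shows "symm n f * grp a * antisymm n g = cst (sgn_of (p + a)) * (symm n f * antisymm n g)"
proof -
  have "grp a = grp (- p) * grp (p + a)"
    by (simp flip: grp_plus)
  then have "symm n f * grp a * antisymm n g = (symm n f * grp (- p)) * (grp (p + a) * antisymm n g)"
    by (simp only: mult.assoc)
  also have "\<dots> = cst (sgn_of (p + a)) * (symm n f * antisymm n g)"
    using assms by (simp only: grp_symm grp_antisymm uminus_in_stab_iff cst_left_commute)
  finally show ?thesis .
qed

lemma symm_An_antisymm:
  assumes fg: "filling l n f g" and x: "x \<in> An n"
  shows "\<exists>c. symm n f * x * antisymm n g = cst c * (symm n f * antisymm n g)"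
  using x
proof (induction rule: An_induct)
  case zero
  show ?case by (rule exI[of _ 0]) simp
next
  case (grp a c)
  from fg grp have "\<exists>d. symm n f * grp a * antisymm n g = cst d * (symm n f * antisymm n g)"
    by (cases rule: symm_grp_antisymm_cases[of l n f g a]) (auto simp: symm_grp_antisymm_factor intro: exI[of _ 0])
  then obtain d where "symm n f * grp a * antisymm n g = cst d * (symm n f * antisymm n g)" ..
  then have "symm n f * (cst c * grp a) * antisymm n g = cst (c * d) * (symm n f * antisymm n g)"
    by (simp add: cst_mult mult.assoc cst_left_commute[of "symm n f"] del: cst_grp)
  then show ?case ..
next
  case (add x y)
  then obtain c d where "symm n f * x * antisymm n g = cst c * (symm n f * antisymm n g)"
    "symm n f * y * antisymm n g = cst d * (symm n f * antisymm n g)" by blast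
  then have "symm n f * (x + y) * antisymm n g = cst (c + d) * (symm n f * antisymm n g)"
    by (simp add: distrib_left distrib_right single_add)
  then show ?case ..
qed

lemma symm_antisymm_nonzero_imp_inj:
  "symm n f * antisymm n g \<noteq> 0 \<Longrightarrow> inj_on (\<lambda>x. (f x, g x)) {1..n}"
  "antisymm n g * symm n f \<noteq> 0 \<Longrightarrow> inj_on (\<lambda>x. (f x, g x)) {1..n}"
  by (rule inj_onI, rule ccontr, simp add: symm_antisymm_eq_zero)+

text \<open>If the product is nonzero, so are the inner block \<open>N x P'\<close> and the outer
  block \<open>P (N x P') N'\<close>. Each block survives for some group element and so yields a
  transversal pair of fillings, one with the rows of the second shape against the columns of the
  first, one the other way round.\<close>

lemma symm_antisymm_different_shapes:
  assumes fg: "filling l n f g" and fg': "filling l' n f' g'" and "l \<noteq> l'" and x: "x \<in> An n"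
  shows "symm n f * antisymm n g * x * (symm n f' * antisymm n g') = 0"
proof (rule ccontr)
  assume ne: "symm n f * antisymm n g * x * (symm n f' * antisymm n g') \<noteq> 0"
  \<comment> \<open>By linearity a nonzero sandwich is already nonzero for some group element in the
    middle.\<close>
  have *: "\<exists>a\<in>Sn n. u * grp a * v \<noteq> 0" if y: "y \<in> An n" and "u * y * v \<noteq> 0" for y u v
  proof (rule ccontr)
    assume "\<not> (\<exists>a\<in>Sn n. u * grp a * v \<noteq> 0)"
    then have z: "u * grp a * v = 0" if "a \<in> Sn n" for a using that by blast
    have "u * y * v = 0" using y
    proof (induction rule: An_induct)
      case (grp a c)
      have "u * (cst c * grp a) * v = cst c * (u * grp a * v)"
        by (simp only: mult.assoc cst_left_commute)
      then show ?case using z[OF grp] by simp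
    qed (simp_all add: distrib_left distrib_right)
    then show False using that by simp
  qed
  have nz: "symm n f * (antisymm n g * x * symm n f') * antisymm n g' \<noteq> 0" using ne by (simp add: mult.assoc)
  then have "antisymm n g * x * symm n f' \<noteq> 0" by (rule contrapos_nn) simp
  from *[OF x this] obtain a where a: "a \<in> Sn n" "antisymm n g * grp a * symm n f' \<noteq> 0" by blast
  have "antisymm n g * x * symm n f' \<in> An n" by (intro An_mult antisymm_An symm_An x)
  from *[OF this nz] obtain b where b: "b \<in> Sn n" "symm n f * grp b * antisymm n g' \<noteq> 0" by blast
  let ?f' = "\<lambda>x. f' (app (- a) x)" and ?g' = "\<lambda>x. g' (app (- b) x)"
  have "antisymm n g * symm n ?f' * grp a \<noteq> 0"
    using a(2) grp_conj_symm[OF a(1), of f'] by (simp add: mult.assoc)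
  then have "antisymm n g * symm n ?f' \<noteq> 0" by (rule contrapos_nn) simp
  then have 1: "inj_on (\<lambda>x. (?f' x, g x)) {1..n}" by (rule symm_antisymm_nonzero_imp_inj(2))
  have "symm n f * antisymm n ?g' * grp b \<noteq> 0"
    using b(2) grp_conj_antisymm[OF b(1), of g'] by (simp add: mult.assoc)
  then have "symm n f * antisymm n ?g' \<noteq> 0" by (rule contrapos_nn) simp
  then have 2: "inj_on (\<lambda>x. (f x, ?g' x)) {1..n}" by (rule symm_antisymm_nonzero_imp_inj(1))
  have "filling l' n ?f' (\<lambda>x. g' (app (- a) x))" "filling l' n (\<lambda>x. f' (app (- b) x)) ?g'"
    using filling_conj[OF fg'] a(1) b(1) by simp_all
  from filling_shapes_eq[OF fg this(2) 2 1 fg this(1)] show False using \<open>l \<noteq> l'\<close> by simp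
qed

section \<open>Scalar multiplication on the group algebra\<close>

definition scl :: "complex \<Rightarrow> galg \<Rightarrow> galg"  (infixr \<open>\<star>\<close> 75) where
  "c \<star> x = cst c * x"

lemma scl_simps:
  "c \<star> (d \<star> x) = (c * d) \<star> x" "x * (c \<star> y) = c \<star> (x * y)" "(c \<star> x) * y = c \<star> (x * y)"
  by (simp_all add: scl_def cst_mult mult.assoc cst_left_commute[of x])

lemma scl_unit [simp]: "1 \<star> x = x" "0 \<star> x = 0" "c \<star> 0 = 0"
  by (simp_all add: scl_def)

lemma scl_distrib: "c \<star> (x + y) = c \<star> x + c \<star> y" "(c + d) \<star> x = c \<star> x + d \<star> x"
    "c \<star> (x - y) = c \<star> x - c \<star> y" "(c - d) \<star> x = c \<star> x - d \<star> x"
  by (simp_all add: scl_def algebra_simps single_add single_diff)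

lemma scl_sum: "c \<star> sum f I = (\<Sum>i\<in>I. c \<star> f i)"
  by (simp add: scl_def sum_distrib_left)

lemma sum_scl: "sum f I \<star> x = (\<Sum>i\<in>I. f i \<star> x)"
  by (induction I rule: infinite_finite_induct) (auto simp: scl_distrib)

lemma lookup_scl [simp]: "coef (c \<star> x) a = c * coef x a"
  by (simp add: scl_def)

lemma An_scl: "x \<in> An n \<Longrightarrow> c \<star> x \<in> An n"
  by (simp add: scl_def An_mult)

lemma scl_one: "c \<star> 1 = cst c"
  by (simp add: scl_def)

lemma scl_eq_zero_iff [simp]: "c \<star> x = 0 \<longleftrightarrow> c = 0 \<or> x = 0"
proof
  assume "c \<star> x = 0"
  show "c = 0 \<or> x = 0"
  proof (rule disjCI)
    assume "x \<noteq> 0"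
    then obtain a where "coef x a \<noteq> 0"
      by (metis lookup_zero poly_mapping_eqI)
    then show "c = 0"
      using arg_cong[OF \<open>c \<star> x = 0\<close>, of "\<lambda>y. coef y a"] by simp
  qed
qed auto

lemma scl_cancel: "c \<noteq> 0 \<Longrightarrow> c \<star> x = c \<star> y \<Longrightarrow> x = y"
  using scl_eq_zero_iff[of c "x - y"] by (simp add: scl_distrib)

section \<open>Lattice words\<close>

definition addable :: "(nat \<Rightarrow> nat) \<Rightarrow> nat \<Rightarrow> bool" where
  "addable l r \<longleftrightarrow> r = 0 \<or> l r < l (r - 1)"

text \<open>The word \<open>r # w\<close> stands for the tableau obtained from that of \<open>w\<close> by appending the entry
  \<open>length w + 1\<close> to row \<open>r\<close>; its shape is \<^term>\<open>count_list (r # w)\<close>. Rows and columns are counted from 0.\<close>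

primrec yam :: "nat list \<Rightarrow> bool" where
  "yam [] \<longleftrightarrow> True"
| "yam (r # w) \<longleftrightarrow> yam w \<and> addable (count_list w) r"

primrec row_of :: "nat list \<Rightarrow> nat \<Rightarrow> nat" where
  "row_of [] x = 0"
| "row_of (r # w) x = (if x = Suc (length w) then r else row_of w x)"

primrec col_of :: "nat list \<Rightarrow> nat \<Rightarrow> nat" where
  "col_of [] x = 0"
| "col_of (r # w) x = (if x = Suc (length w) then count_list w r else col_of w x)"

lemma yam_antimono: "yam w \<Longrightarrow> i \<le> j \<Longrightarrow> count_list w j \<le> count_list w i"
proof -
  assume "yam w"
  then have "count_list w (Suc i) \<le> count_list w i" for i
    by (induction w) (auto simp: addable_def le_Suc_eq)
  then show "i \<le> j \<Longrightarrow> count_list w j \<le> count_list w i" by (rule lift_Suc_antimono_le)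
qed

lemma yam_letter_less: "yam w \<Longrightarrow> r \<in> set w \<Longrightarrow> r < length w"
proof (induction w arbitrary: r)
  case (Cons s w)
  have "s < Suc (length w)"
  proof (cases "s = 0")
    case False
    then have "count_list w (s - 1) \<noteq> 0" using Cons.prems by (auto simp: addable_def)
    then have "s - 1 \<in> set w" using count_notin by fastforce
    then show ?thesis using Cons by fastforce
  qed simp
  then show ?case using Cons by fastforce
qed simp

lemma bij_betw_cells:
  "bij_betw (\<lambda>x. (row_of w x, col_of w x)) {1..length w} {(i, c). c < count_list w i}"
proof (induction w)
  case (Cons r w)
  let ?F = "\<lambda>x. (row_of (r # w) x, col_of (r # w) x)"
  have "bij_betw ?F {1..length w} {(i, c). c < count_list w i}"
    by (rule bij_betw_cong[THEN iffD1, OF _ Cons.IH]) auto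
  then have "bij_betw ?F ({1..length w} \<union> {Suc (length w)})
      ({(i, c). c < count_list w i} \<union> {?F (Suc (length w))})"
    by (intro notIn_Un_bij_betw) auto
  also have "{1..length w} \<union> {Suc (length w)} = {1..length (r # w)}" by auto
  also have "{(i, c). c < count_list w i} \<union> {?F (Suc (length w))} = {(i, c). c < count_list (r # w) i}"
    by (auto split: if_splits)
  finally show ?case .
qed (simp add: bij_betw_def)

lemma yam_filling: "yam w \<Longrightarrow> filling (count_list w) (length w) (row_of w) (col_of w)"
  unfolding filling_def using bij_betw_cells yam_antimono yam_letter_less
  by (metis count_notin leD)

section \<open>Young symmetrizers of lattice words\<close>

definition ysym :: "nat list \<Rightarrow> galg" where
  "ysym w = symm (length w) (row_of w) * antisymm (length w) (col_of w)"

text \<open>For a lattice word \<open>ysym w\<close> has trace 1, so this trace is the scalar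
  \<theta> by which the symmetrizer differs from an idempotent.\<close>

definition theta :: "nat list \<Rightarrow> complex" where
  "theta w = tr (ysym w * ysym w)"

lemma ysym_An: "ysym w \<in> An (length w)"
  by (simp add: ysym_def An_mult symm_An antisymm_An)

lemma tr_ysym: "yam w \<Longrightarrow> tr (ysym w) = 1"
  unfolding ysym_def by (rule tr_symm_antisymm[OF filling_inj[OF yam_filling]])

lemma symm_An_antisymm_word:
  assumes "yam w" "x \<in> An (length w)"
  shows "\<exists>c. symm (length w) (row_of w) * x * antisymm (length w) (col_of w) = c \<star> ysym w"
  using symm_An_antisymm[OF yam_filling[OF assms(1)] assms(2)] by (simp add: ysym_def scl_def)

text \<open>Von Neumann's lemma, applied to \<open>N x P\<close>, provides some scalar. As
  \<open>ysym w\<close> has trace 1, taking traces identifies it, cyclicity bringing the two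
  symmetrizers together.\<close>

lemma ysym_sandwich:
  assumes "yam w" "x \<in> An (length w)"
  shows "ysym w * x * ysym w = (theta w * tr (x * ysym w)) \<star> ysym w"
proof -
  have *: "ysym w * x * ysym w = tr (ysym w * x * ysym w) \<star> ysym w" if "x \<in> An (length w)" for x
  proof -
    let ?P = "symm (length w) (row_of w)" and ?N = "antisymm (length w) (col_of w)"
    have "?N * x * ?P \<in> An (length w)" by (intro An_mult symm_An antisymm_An that)
    from symm_An_antisymm_word[OF assms(1) this] obtain c where "?P * (?N * x * ?P) * ?N = c \<star> ysym w" ..
    then have "ysym w * x * ysym w = c \<star> ysym w" by (simp add: ysym_def mult.assoc)
    moreover from this have "tr (ysym w * x * ysym w) = c" by (simp add: tr_ysym[OF assms(1)])
    ultimately show ?thesis by (simp only:)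
  qed
  have sq: "ysym w * ysym w = theta w \<star> ysym w"
    using *[OF An_one] by (simp add: theta_def)
  have "tr (ysym w * x * ysym w) = tr (x * (ysym w * ysym w))"
    by (metis mult.assoc tr_commute)
  also have "\<dots> = theta w * tr (x * ysym w)"
    by (simp add: sq scl_simps)
  finally show ?thesis using *[OF assms(2)] by simp
qed

lemma ysym_square: "yam w \<Longrightarrow> ysym w * ysym w = theta w \<star> ysym w"
  using ysym_sandwich[of w 1] by (simp add: tr_ysym)

lemma sgn_of_cases: "sgn_of a = 1 \<or> sgn_of a = - 1"
  by (auto simp: sgn_of_def sign_def)

text \<open>The element \<open>P N P\<close> is self-adjoint, so the trace of its square is a sum of squares.\<close>

lemma theta_nonzero:
  assumes "yam w"
  shows "theta w \<noteq> 0"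
proof
  assume theta: "theta w = 0"
  let ?n = "length w"
  define P where "P = symm ?n (row_of w)"
  define N where "N = antisymm ?n (col_of w)"
  define R where "R = stab ?n (row_of w)"
  define C where "C = stab ?n (col_of w)"
  define b where "b = P * N * P"
  have y: "ysym w = P * N" by (simp add: ysym_def P_def N_def)
  have PP: "P * P = of_nat (card R) \<star> P"
    by (simp add: P_def R_def symm_symm scl_def)
  have "b * b = P * N * (P * P) * N * P" by (simp add: b_def mult.assoc)
  also have "\<dots> = of_nat (card R) \<star> (ysym w * ysym w * P)"
    by (simp add: PP y scl_simps mult.assoc)
  finally have "tr (b * b) = 0" using theta ysym_square[OF assms] by (simp add: scl_simps)
  \<comment> \<open>The coefficients of \<open>b\<close>, written out so that reality and invariance
    under inversion can be read off: inverting \<open>p + q + p'\<close> gives a sum of the same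
    form with the row factors exchanged.\<close>
  define co where "co a = (\<Sum>(p, p', q)\<in>R \<times> R \<times> C. if p + q + p' = a then sgn_of q else 0)" for a
  have lookup_b: "coef b a = co a" for a
  proof -
    have "b = (\<Sum>p\<in>R. \<Sum>p'\<in>R. \<Sum>q\<in>C. Poly_Mapping.single (p + q + p') (sgn_of q))"
      unfolding b_def P_def N_def R_def C_def symm_def antisymm_def sum_product
      by (simp add: sum_product sum_distrib_right mult_single)
    then show ?thesis
      by (simp add: co_def lookup_sum lookup_single when_def sum.cartesian_product case_prod_unfold)
  qed
  have co_uminus: "co (- a) = co a" for a
  proof -
    have inv_eq: "p + q + p' = - a \<longleftrightarrow> - p' + - q + - p = a" for p q p' :: fperm
      by (metis add.assoc minus_add minus_minus)
    have "co (- a) = (\<Sum>(p, p', q)\<in>R \<times> R \<times> C. if - p' + - q + - p = a then sgn_of (- q) else 0)"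
      unfolding co_def inv_eq by (intro sum.cong) auto
    also have "\<dots> = co a"
      unfolding co_def
      by (rule sum.reindex_bij_witness[of _ "\<lambda>(p, p', q). (- p', - p, - q)" "\<lambda>(p, p', q). (- p', - p, - q)"])
        (auto simp: R_def C_def)
    finally show ?thesis .
  qed
  have co_real: "Im (co a) = 0" for a
  proof -
    have "Im (sgn_of q) = 0" for q using sgn_of_cases[of q] by auto
    then show ?thesis by (auto simp: co_def intro!: sum.neutral)
  qed
  have "b \<in> An ?n" by (simp add: b_def P_def N_def An_mult symm_An antisymm_An)
  then have "tr (b * b) = (\<Sum>a\<in>Sn ?n. co a * co a)"
    by (subst lookup_times[of "Sn ?n"]) (auto simp: An_def lookup_b co_uminus)
  then have "Re (tr (b * b)) = (\<Sum>a\<in>Sn ?n. Re (co a) * Re (co a))"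
    by (simp add: co_real)
  then have "(\<Sum>a\<in>Sn ?n. Re (co a) * Re (co a)) = 0" using \<open>tr (b * b) = 0\<close> by simp
  then have "Re (co 0) = 0"
    by (subst (asm) sum_nonneg_eq_0_iff) auto
  \<comment> \<open>At the identity the coefficient of \<open>b\<close> is \<open>card R\<close>,
    which is positive; so the sum of squares cannot vanish.\<close>
  moreover have "co 0 = of_nat (card R)"
  proof -
    have "tr b = tr (P * P * N)" unfolding b_def by (metis mult.assoc tr_commute)
    then show ?thesis using tr_ysym[OF assms] by (simp add: PP scl_simps y lookup_b)
  qed
  moreover have "card R \<noteq> 0"
    using finite_stab zero_in_stab unfolding R_def by (metis card_0_eq empty_iff)
  ultimately show False by simp
qed

section \<open>Seminormal units: idempotence, orthogonality, matrix units\<close>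

primrec se :: "nat list \<Rightarrow> galg" where
  "se [] = 1"
| "se (r # w) = (1 / theta (r # w)) \<star> (se w * ysym (r # w) * se w)"

lemma se_An: "se w \<in> An (length w)"
proof (induction w)
  case (Cons r w)
  then have "se w \<in> An (length (r # w))" using An_mono[of "length w" "length (r # w)"] by auto
  then show ?case using ysym_An[of "r # w"] by (simp add: An_scl An_mult)
qed simp

lemma se_An_Suc: "se w \<in> An (Suc (length w))"
  using se_An An_mono[of "length w" "Suc (length w)"] by auto

text \<open>Only the terms of the large symmetrizer that lie in the smaller group pair with
  \<open>se w\<close>, and these form the symmetrizer of \<open>w\<close>.\<close>

lemma tr_se_ysym_Cons:
  assumes "yam (r # w)"
  shows "tr (se w * ysym (r # w)) = tr (se w * ysym w)"
proof -
  let ?f = "row_of (r # w)" and ?g = "col_of (r # w)" and ?n = "length w"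
  have "inj_on (\<lambda>x. (?f x, ?g x)) {1..Suc ?n}"
    using filling_inj[OF yam_filling[OF assms]] by simp
  from tr_symm_antisymm_Suc[OF this se_An]
  have "tr (se w * ysym (r # w)) = tr (se w * (symm ?n ?f * antisymm ?n ?g))"
    by (simp add: ysym_def del: row_of.simps col_of.simps)
  moreover have "symm ?n ?f = symm ?n (row_of w)" "antisymm ?n ?g = antisymm ?n (col_of w)"
    by (auto intro!: symm_cong antisymm_cong)
  ultimately show ?thesis by (simp add: ysym_def)
qed

text \<open>Because this trace is 1 for every lattice word, inserting \<open>se w\<close> between
  two symmetrizers of \<open>r # w\<close> gives the same multiple as inserting 1. The factors
  \<open>theta\<close> then cancel and the units are idempotent.\<close>

lemma tr_se_ysym: "yam w \<Longrightarrow> tr (se w * ysym w) = 1"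
proof (induction w)
  case Nil
  then show ?case using tr_ysym[of "[]"] by simp
next
  case (Cons r w)
  let ?y = "ysym (r # w)" and ?t = "theta (r # w)"
  have IH: "tr (se w * ?y) = 1" using Cons tr_se_ysym_Cons[of r w] by simp
  have "?y * se w * ?y = ?t \<star> ?y"
    using ysym_sandwich[OF Cons.prems, of "se w"] se_An_Suc IH by simp
  then have "se w * (?y * se w * ?y) = ?t \<star> (se w * ?y)" by (simp add: scl_simps)
  \<comment> \<open>Right multiplication by the symmetrizer undoes one step of the
    recursion.\<close>
  then have "se (r # w) * ?y = se w * ?y"
    using theta_nonzero[OF Cons.prems] by (simp add: scl_simps mult.assoc)
  then show ?case using IH by simp
qed

lemma ysym_se_ysym:
  assumes "yam (r # w)"
  shows "ysym (r # w) * se w * ysym (r # w) = theta (r # w) \<star> ysym (r # w)"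
  using ysym_sandwich[OF assms, of "se w"] se_An_Suc tr_se_ysym_Cons[OF assms] tr_se_ysym[of w] assms
  by simp

lemma ysym_se_ysym':
  "yam (r # w) \<Longrightarrow> ysym (r # w) * (se w * (ysym (r # w) * x)) = theta (r # w) \<star> (ysym (r # w) * x)"
  using ysym_se_ysym[of r w] by (metis mult.assoc scl_simps(3))

lemma se_idem: "yam w \<Longrightarrow> se w * se w = se w"
proof (induction w)
  case (Cons r w)
  then have "se w * se w = se w" by simp
  then have "se w * (se w * x) = se w * x" for x by (metis mult.assoc)
  then show ?case
    using Cons.prems theta_nonzero[OF Cons.prems]
    by (simp add: scl_simps mult.assoc ysym_se_ysym' del: yam.simps)
qed simp

lemma se_idem': "yam w \<Longrightarrow> se w * (se w * x) = se w * x"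
  by (metis mult.assoc se_idem)

lemma se_Cons_absorb:
  "yam (r # w) \<Longrightarrow> se w * se (r # w) = se (r # w)" "yam (r # w) \<Longrightarrow> se (r # w) * se w = se (r # w)"
  by (simp_all add: scl_simps mult.assoc se_idem se_idem')

text \<open>Cyclicity and the idempotence of \<open>se v\<close> reduce this to
  \<open>tr_se_ysym\<close>. Once \<theta> is known, it is the familiar trace
  \<open>d_mu / n!\<close> of a primitive idempotent.\<close>

lemma tr_se: "yam w \<Longrightarrow> tr (se w) = 1 / theta w"
proof (cases w)
  case Nil
  then show "yam w \<Longrightarrow> ?thesis"
    using ysym_square[of "[]"] tr_ysym[of "[]"] An_0[OF ysym_An[of "[]", simplified]]
    by (auto simp: theta_def mult_single)
next
  case (Cons r v)
  assume w: "yam w"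
  have "tr (se v * ysym w * se v) = tr (se v * (se v * ysym w))" by (rule tr_commute)
  also have "\<dots> = 1"
    using w tr_se_ysym[of v] tr_se_ysym_Cons[of r v] by (simp add: Cons se_idem')
  finally show ?thesis by (simp add: Cons)
qed

lemma se_nonzero: "yam w \<Longrightarrow> se w \<noteq> 0"
  using tr_se[of w] theta_nonzero[of w] by auto

text \<open>The units are primitive: the symmetrizers of the two outer units enclose an element of
  the algebra and collapse it to a scalar.\<close>

lemma se_corner:
  assumes "yam w" "x \<in> An (length w)"
  shows "\<exists>c. se w * x * se w = c \<star> se w"
proof (cases w)
  case Nil
  then obtain c where "x = cst c" using assms An_0 by fastforce
  then show ?thesis by (auto simp: Nil scl_one)
next
  case (Cons r v)
  let ?t = "theta w" and ?y = "ysym w"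
  have "se v * x * se v \<in> An (length w)"
    using se_An_Suc[of v] assms by (simp add: Cons An_mult)
  from ysym_sandwich[OF assms(1) this] obtain c where c: "?y * (se v * x * se v) * ?y = c \<star> ?y"
    by blast
  have "se w * x * se w = (1 / ?t * (1 / ?t)) \<star> (se v * (?y * (se v * x * se v) * ?y) * se v)"
    by (simp add: Cons scl_simps mult.assoc)
  also have "\<dots> = (c / ?t) \<star> se w"
    unfolding c by (simp add: Cons scl_simps mult.assoc)
  finally show ?thesis by blast
qed

lemma se_different_shapes:
  assumes "yam w" "yam v" "length w = length v" "count_list w \<noteq> count_list v" "x \<in> An (length w)"
  shows "se w * x * se v = 0"
proof -
  obtain r w' s v' where w: "w = r # w'" "v = s # v'"
    using assms(3,4) by (cases w; cases v) auto
  have "se w' * x * se v' \<in> An (length w)"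
    using se_An_Suc[of w'] se_An_Suc[of v'] assms(3,5) by (auto simp: w intro!: An_mult)
  then have "ysym w * (se w' * x * se v') * ysym v = 0"
    unfolding ysym_def
    using symm_antisymm_different_shapes[OF yam_filling[OF assms(1)], of "count_list v" "row_of v" "col_of v"]
      yam_filling[OF assms(2)] assms(3,4) by simp
  then have "se w' * (ysym w * (se w' * x * se v') * ysym v) * se v' = 0" by simp
  then show ?thesis by (simp add: w scl_simps mult.assoc)
qed

text \<open>Words with equal tails have different shapes; for different tails the units of the tails
  are already orthogonal, and they can be inserted between the two factors by absorption.\<close>

lemma se_orthogonal:
  "yam w \<Longrightarrow> yam v \<Longrightarrow> length w = length v \<Longrightarrow> w \<noteq> v \<Longrightarrow> se w * se v = 0"
proof (induction w arbitrary: v)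
  case (Cons r w)
  then obtain s u where v: "v = s # u" by (cases v) auto
  show ?case
  proof (cases "u = w")
    case True
    have "count_list (r # w) s \<noteq> count_list v s" using Cons.prems v True by auto
    then have "count_list (r # w) \<noteq> count_list v" by metis
    from se_different_shapes[OF Cons.prems(1-3) this, of 1] show ?thesis by simp
  next
    case False
    then have "se w * se u = 0" using Cons v by simp
    moreover have "se (r # w) * se v = se (r # w) * se w * (se u * se v)"
      using se_Cons_absorb Cons.prems v by metis
    ultimately show ?thesis by (metis mult.assoc mult_zero_left mult_zero_right)
  qed
qed simp

lemma same_shape_length: "count_list w = count_list v \<Longrightarrow> length w = length v"
proof -
  assume "count_list w = count_list v"
  then show ?thesis
    using sum_count_set[of w "set w \<union> set v"] sum_count_set[of v "set w \<union> set v"] by simp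
qed

text \<open>A relabelling \<open>p\<close> conjugates the symmetrizer of \<open>v\<close> into that
  of \<open>w\<close>, and \<open>ysym v\<close> can be rewritten with \<open>se v\<close> in its
  middle; so \<open>se w\<close> factors through \<open>se v\<close>.\<close>

lemma se_same_shape_factor:
  assumes w: "yam w" and v: "yam v" and eq: "count_list w = count_list v"
  shows "\<exists>x\<in>An (length w). \<exists>y\<in>An (length w). se w = x * se v * y"
proof (cases w)
  case Nil
  then have "v = []" using same_shape_length[OF eq] by simp
  then show ?thesis using Nil An_one by (intro bexI[of _ 1]) auto
next
  case (Cons r w')
  let ?n = "length w"
  have len: "length v = ?n" using same_shape_length[OF eq] by simp
  then obtain s v' where v_eq: "v = s # v'" using Cons by (cases v) auto
  have "filling (count_list w) ?n (row_of v) (col_of v)" using yam_filling[OF v] eq len by simp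
  from filling_transport[OF this yam_filling[OF w]] obtain p where p: "p \<in> Sn ?n"
    "\<And>x. x \<in> {1..?n} \<Longrightarrow> row_of v (app p x) = row_of w x"
    "\<And>x. x \<in> {1..?n} \<Longrightarrow> col_of v (app p x) = col_of w x" by metis
  have "grp (- p) * symm ?n (row_of v) = symm ?n (row_of w) * grp (- p)"
    using grp_conj_symm[of "- p" ?n "row_of v"] p symm_cong[of ?n "\<lambda>x. row_of v (app p x)" "row_of w"]
    by simp
  moreover have "grp (- p) * antisymm ?n (col_of v) = antisymm ?n (col_of w) * grp (- p)"
    using grp_conj_antisymm[of "- p" ?n "col_of v"] p antisymm_cong[of ?n "\<lambda>x. col_of v (app p x)" "col_of w"]
    by simp
  ultimately have "grp (- p) * ysym v = ysym w * grp (- p)"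
    unfolding ysym_def len by (metis (no_types, lifting) mult.assoc)
  then have conj: "ysym w = grp (- p) * ysym v * grp p"
    by (simp add: mult.assoc)
  have "ysym v * se v * ysym v = theta v \<star> ysym v"
    using theta_nonzero[OF v] v unfolding v_eq
    by (simp add: scl_simps mult.assoc ysym_se_ysym' ysym_se_ysym[unfolded mult.assoc] del: yam.simps)
  then have "(1 / theta v) \<star> (ysym v * se v * ysym v) = ysym v"
    using theta_nonzero[OF v] by (simp add: scl_simps)
  then have "ysym w = grp (- p) * ((1 / theta v) \<star> (ysym v * se v * ysym v)) * grp p"
    using conj by (simp only:)
  then have "se w = ((1 / theta w * (1 / theta v)) \<star> (se w' * grp (- p) * ysym v)) * se v *
      (ysym v * grp p * se w')"
    by (simp add: Cons scl_simps mult.assoc)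
  moreover have "(1 / theta w * (1 / theta v)) \<star> (se w' * grp (- p) * ysym v) \<in> An ?n"
    "ysym v * grp p * se w' \<in> An ?n"
    using p(1) ysym_An[of v] se_An_Suc[of w'] len by (auto simp: Cons intro!: An_scl An_mult)
  ultimately show ?thesis by blast
qed

text \<open>These are off-diagonal matrix units in the simple block of the common shape:
  \<open>a\<close> absorbs \<open>se v\<close> on the right and \<open>b\<close> absorbs it on the
  left.\<close>

lemma se_matrix_units:
  assumes w: "yam w" and v: "yam v" and eq: "count_list w = count_list v"
  obtains a b where "a \<in> An (length w)" "b \<in> An (length w)" "a * b = se w" "b * a = se v"
    "a * se v = a" "se v * b = b"
proof -
  let ?n = "length w"
  have len: "length v = ?n" using same_shape_length[OF eq] by simp
  from se_same_shape_factor[OF assms] obtain x y where xy: "x \<in> An ?n" "y \<in> An ?n" "se w = x * se v * y"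
    by blast
  define a where "a = se w * x * se v"
  define b where "b = se v * y * se w"
  have An: "a \<in> An ?n" "b \<in> An ?n"
    using xy(1,2) se_An[of w] se_An[of v] len by (auto simp: a_def b_def intro!: An_mult)
  have "a * b = se w * (x * se v * y) * se w"
    by (simp add: a_def b_def mult.assoc se_idem'[OF v])
  then have ab: "a * b = se w" by (simp add: xy(3)[symmetric] se_idem[OF w])
  have av: "a * se v = a" "se v * b = b" "se w * a = a"
    by (simp_all add: a_def b_def mult.assoc se_idem se_idem' v w)
  have "y * se w * (se w * x) \<in> An (length v)"
    using xy(1,2) se_An[of w] len by (auto intro!: An_mult)
  from se_corner[OF v this] obtain c where c: "b * a = c \<star> se v"
    by (auto simp: a_def b_def mult.assoc)
  \<comment> \<open>Evaluating \<open>a * b * a\<close> in two ways forces the scalar to be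
    1.\<close>
  have "c \<star> a = a * (b * a)" by (simp add: c scl_simps av)
  also have "\<dots> = a" by (simp add: ab av flip: mult.assoc)
  finally have "(c - 1) \<star> a = 0" by (simp add: scl_distrib)
  moreover have "a \<noteq> 0" using ab se_nonzero[OF w] by auto
  ultimately have "c = 1" by simp
  then show ?thesis using that An ab av c by simp
qed

section \<open>Completeness of the seminormal units\<close>

interpretation galg: vector_space scl
  by unfold_locales (simp_all add: scl_distrib scl_simps)

text \<open>Nonzero orthogonal idempotents are linearly independent: multiplying a relation by
  \<open>f i\<close> isolates one coefficient.\<close>

lemma card_orthogonal_idempotents_le:
  assumes "finite F" "finite I"
    and span: "\<And>i. i \<in> I \<Longrightarrow> f i \<in> galg.span F"
    and nz: "\<And>i. i \<in> I \<Longrightarrow> f i \<noteq> 0" and idem: "\<And>i. i \<in> I \<Longrightarrow> f i * f i = f i"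
    and orth: "\<And>i j. i \<in> I \<Longrightarrow> j \<in> I \<Longrightarrow> i \<noteq> j \<Longrightarrow> f i * f j = 0"
  shows "card I \<le> card F"
proof -
  have inj: "inj_on f I"
  proof (rule inj_onI, rule ccontr)
    fix i j assume ij: "i \<in> I" "j \<in> I" "f i = f j" "i \<noteq> j"
    then have "f i * f i = 0" using orth[OF ij(1,2,4)] by simp
    then show False using idem nz ij(1) by simp
  qed
  have "galg.independent (f ` I)"
  proof (rule galg.independent_if_scalars_zero)
    fix u x assume sum0: "(\<Sum>x\<in>f ` I. u x \<star> x) = 0" and "x \<in> f ` I"
    then obtain i where i: "i \<in> I" "x = f i" by blast
    have "0 = (\<Sum>j\<in>I. u (f j) \<star> f j) * f i"
      using sum0 by (simp add: sum.reindex[OF inj])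
    also have "\<dots> = (\<Sum>j\<in>I. if j = i then u (f i) \<star> f i else 0)"
      unfolding sum_distrib_right scl_simps
      by (rule sum.cong) (use i(1) in \<open>auto simp: idem orth\<close>)
    also have "\<dots> = u x \<star> f i" using i \<open>finite I\<close> by simp
    finally have "u x \<star> f i = 0" by (rule sym)
    then show "u x = 0" using nz[OF i(1)] by simp
  qed (use \<open>finite I\<close> in simp)
  moreover have "f ` I \<subseteq> galg.span F" using span by blast
  ultimately have "card (f ` I) \<le> card F"
    using galg.independent_span_bound[OF \<open>finite F\<close>] by blast
  then show ?thesis by (simp add: card_image[OF inj])
qed

definition words :: "nat \<Rightarrow> nat list set" where
  "words n = {w. yam w \<and> length w = n}"

definition adds :: "nat list \<Rightarrow> nat set" where
  "adds w = {r. addable (count_list w) r}"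

definition removable_rows :: "nat list \<Rightarrow> nat set" where
  "removable_rows w = {r. count_list w (Suc r) < count_list w r}"

lemma finite_words: "finite (words n)"
proof (rule finite_subset)
  show "words n \<subseteq> {w. set w \<subseteq> {..<n} \<and> length w = n}"
    using yam_letter_less by (auto simp: words_def)
qed (simp add: finite_lists_length_eq)

lemma finite_removable_rows: "finite (removable_rows w)"
proof (rule finite_subset)
  show "removable_rows w \<subseteq> set w"
  proof
    fix r assume "r \<in> removable_rows w"
    then have "count_list w r \<noteq> 0" by (simp add: removable_rows_def)
    then show "r \<in> set w" by (metis count_notin)
  qed
qed simp

text \<open>Row \<open>r + 1\<close> can take a cell exactly when row \<open>r\<close> can lose one,
  and row 0 can always take one. The resulting surplus of one addable cell is what closes the
  dimension count.\<close>

lemma adds_eq: "adds w = insert 0 (Suc ` removable_rows w)"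
proof (rule Set.set_eqI)
  show "r \<in> adds w \<longleftrightarrow> r \<in> insert 0 (Suc ` removable_rows w)" for r
    by (cases r) (auto simp: adds_def addable_def removable_rows_def)
qed

lemma finite_adds: "finite (adds w)"
  by (simp add: adds_eq finite_removable_rows)

lemma card_adds: "card (adds w) = Suc (card (removable_rows w))"
  by (simp add: adds_eq finite_removable_rows card_image card_insert_if)

lemma yam_Cons_iff: "yam (r # w) \<longleftrightarrow> yam w \<and> r \<in> adds w"
  by (simp add: adds_def)

lemma words_Suc: "words (Suc n) = (\<lambda>(w, r). r # w) ` (SIGMA w:words n. adds w)"
proof (rule Set.set_eqI)
  show "v \<in> words (Suc n) \<longleftrightarrow> v \<in> (\<lambda>(w, r). r # w) ` (SIGMA w:words n. adds w)" for v
    by (cases v) (auto simp: words_def adds_def image_iff)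
qed

lemma sum_words_Suc: "(\<Sum>v\<in>words (Suc n). h v) = (\<Sum>w\<in>words n. \<Sum>r\<in>adds w. h (r # w))"
  unfolding words_Suc
  by (subst sum.reindex) (auto simp: inj_on_def sum.Sigma finite_words finite_adds case_prod_unfold)

section \<open>Double cosets of the smaller group and refinement of units\<close>

lemma fswap_twice [simp]: "fswap a b + fswap a b = 0"
  by (rule fperm_eqI) (simp add: fswap.rep_eq)

text \<open>Let \<open>a\<close> send \<open>m + 2\<close> to \<open>j\<close>. With
  \<open>b\<close> swapping \<open>j\<close> and \<open>m + 1\<close>, the product of
  \<open>b\<close> and the middle transposition also sends \<open>m + 2\<close> to \<open>j\<close>,
  so the remaining factor fixes \<open>m + 2\<close>.\<close>

lemma Sn_Suc_double_coset:
  assumes "a \<in> Sn (Suc (Suc m))" "a \<notin> Sn (Suc m)"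
  obtains b c where "b \<in> Sn (Suc m)" "c \<in> Sn (Suc m)"
    "a = b + fswap (Suc m) (Suc (Suc m)) + c"
proof -
  let ?s = "fswap (Suc m) (Suc (Suc m))"
  define j where "j = app a (Suc (Suc m))"
  have "j \<noteq> Suc (Suc m)" using assms Sn_Suc_fixing by (auto simp: j_def)
  moreover have "j \<in> {1..Suc (Suc m)}"
    using app_in_iff[OF assms(1), of "Suc (Suc m)"] by (simp add: j_def)
  ultimately have j: "j \<in> {1..Suc m}" by auto
  define b where "b = fswap j (Suc m)"
  have b: "b \<in> Sn (Suc m)" using j by (simp add: b_def fswap_in_Sn)
  define c where "c = ?s + b + a"
  have "b \<in> Sn (Suc (Suc m))" using b Sn_mono[of "Suc m" "Suc (Suc m)"] by auto
  then have "c \<in> Sn (Suc (Suc m))"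
    using assms(1) by (auto simp: c_def intro!: plus_in_Sn fswap_in_Sn)
  moreover have "app c (Suc (Suc m)) = Suc (Suc m)"
    using j by (simp add: c_def b_def j_def[symmetric] app_fswap)
  ultimately have c: "c \<in> Sn (Suc m)" by (rule Sn_Suc_fixing)
  have "b + b = 0" "?s + ?s = 0" by (simp_all add: b_def)
  then have "b + ?s + c = a"
    unfolding c_def by (metis add.assoc add.left_neutral)
  then show ?thesis using that b c by blast
qed

lemma fswap_commute_An:
  assumes "x \<in> An m"
  shows "grp (fswap (Suc m) (Suc (Suc m))) * x = x * grp (fswap (Suc m) (Suc (Suc m)))"
proof (rule An_commute[OF assms])
  fix a assume a: "a \<in> Sn m"
  let ?s = "fswap (Suc m) (Suc (Suc m))"
  have "?s + a = a + ?s"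
  proof (rule fperm_eqI)
    fix x
    have fixed: "app a (Suc m) = Suc m" "app a (Suc (Suc m)) = Suc (Suc m)"
      using app_outside[OF a] by auto
    moreover from fixed have "app a x = Suc m \<longleftrightarrow> x = Suc m" "app a x = Suc (Suc m) \<longleftrightarrow> x = Suc (Suc m)"
      using app_eq_iff[of a x "Suc m"] app_eq_iff[of a x "Suc (Suc m)"] by simp_all
    ultimately show "app (?s + a) x = app (a + ?s) x"
      by (simp add: app_fswap Transposition.transpose_def)
  qed
  then show "grp ?s * grp a = grp a * grp ?s" by (simp flip: grp_plus)
qed

text \<open>Refining \<open>se R\<close> by one entry makes both outer units the same size;
  refinements whose shape differs from that of \<open>w\<close> are annihilated.\<close>

lemma se_refine_right:
  assumes w: "w \<in> words (Suc m)" and R: "R \<in> words m"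
    and branch: "se R = (\<Sum>r\<in>adds R. se (r # R))" and x: "x \<in> An (Suc m)"
  shows "se w * x * se R = (\<Sum>r | r \<in> adds R \<and> count_list (r # R) = count_list w. se w * x * se (r # R))"
    and "se R * x * se w = (\<Sum>r | r \<in> adds R \<and> count_list (r # R) = count_list w. se (r # R) * x * se w)"
proof -
  have yam: "yam (r # R)" "length (r # R) = Suc m" if "r \<in> adds R" for r
    using that R by (auto simp: words_def adds_def)
  have w': "yam w" "length w = Suc m" using w by (auto simp: words_def)
  have "se w * x * se R = (\<Sum>r\<in>adds R. se w * x * se (r # R))"
    unfolding branch sum_distrib_left ..
  also have "\<dots> = (\<Sum>r | r \<in> adds R \<and> count_list (r # R) = count_list w. se w * x * se (r # R))"
  proof (rule sum.mono_neutral_right)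
    show "\<forall>r\<in>adds R - {r \<in> adds R. count_list (r # R) = count_list w}. se w * x * se (r # R) = 0"
      using w' yam x by (auto intro!: se_different_shapes simp del: se.simps yam.simps)
  qed (auto simp: finite_adds)
  finally show "se w * x * se R =
      (\<Sum>r | r \<in> adds R \<and> count_list (r # R) = count_list w. se w * x * se (r # R))" .
  have "se R * x * se w = (\<Sum>r\<in>adds R. se (r # R) * x * se w)"
    unfolding branch sum_distrib_right ..
  also have "\<dots> = (\<Sum>r | r \<in> adds R \<and> count_list (r # R) = count_list w. se (r # R) * x * se w)"
  proof (rule sum.mono_neutral_right)
    show "\<forall>r\<in>adds R - {r \<in> adds R. count_list (r # R) = count_list w}. se (r # R) * x * se w = 0"
      using w' yam x by (auto intro!: se_different_shapes simp del: se.simps yam.simps)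
  qed (auto simp: finite_adds)
  finally show "se R * x * se w =
      (\<Sum>r | r \<in> adds R \<and> count_list (r # R) = count_list w. se (r # R) * x * se w)" .
qed

lemma count_list_Cons_eq_imp_same_row:
  assumes "count_list (r # R) = count_list (s # R)"
  shows "r = s"
  using fun_cong[OF assms, of r] by (auto split: if_splits)

text \<open>The row added to \<open>R\<close> is determined by the resulting shape, so a single
  summand survives.\<close>

lemma se_refine_unique:
  assumes w: "w \<in> words (Suc m)" and R: "R \<in> words m"
    and branch: "se R = (\<Sum>r\<in>adds R. se (r # R))" and x: "x \<in> An (Suc m)"
    and r: "r \<in> adds R" "count_list (r # R) = count_list w"
  shows "se w * x * se R = se w * x * se (r # R)" "se R * x * se w = se (r # R) * x * se w"
proof -
  have "s = r" if "count_list (s # R) = count_list w" for s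
    by (rule count_list_Cons_eq_imp_same_row[of s R r]) (simp only: that r(2))
  then have "{r \<in> adds R. count_list (r # R) = count_list w} = {r}" using r by blast
  then show "se w * x * se R = se w * x * se (r # R)" "se R * x * se w = se (r # R) * x * se w"
    using se_refine_right[OF w R branch x] by simp_all
qed

text \<open>The corner \<open>e \<complex>[S\<^sub>n\<^sub>+\<^sub>1] e\<close> at a unit \<open>e\<close> of shape \<open>\<nu> \<turnstile> n\<close> is spanned by \<open>e\<close> and one element
  \<open>a s b\<close> for each shape \<open>\<rho>\<close> obtained from \<open>\<nu>\<close> by removing a cell, because
  \<open>\<complex>[S\<^sub>n\<^sub>+\<^sub>1] = \<complex>[S\<^sub>n] + \<complex>[S\<^sub>n] s \<complex>[S\<^sub>n]\<close> and \<open>s = (n n+1)\<close> commutes with \<open>\<complex>[S\<^sub>n\<^sub>-\<^sub>1]\<close>. As \<open>\<nu>\<close> has one more addable than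
  removable cell, the units refining \<open>e\<close> already exhaust the corner.\<close>

lemma se_corner_spanned:
  assumes w: "w \<in> words n"
    and branch: "\<And>m R. n = Suc m \<Longrightarrow> R \<in> words m \<Longrightarrow> se R = (\<Sum>r\<in>adds R. se (r # R))"
    and one: "\<And>m. n = Suc m \<Longrightarrow> (\<Sum>R\<in>words m. se R) = 1"
  shows "\<exists>F. finite F \<and> card F \<le> card (adds w) \<and>
    (\<forall>x\<in>An (Suc n). se w * x * se w \<in> galg.span F)"
proof -
  have yw: "yam w" and lw: "length w = n" using w by (auto simp: words_def)
  let ?s = "fswap n (Suc n)"
  define good where "good r T \<longleftrightarrow> (\<exists>R\<in>words (n - 1). T = r # R \<and> r \<in> adds R \<and> count_list T = count_list w)" for r T
  \<comment> \<open>A candidate for row \<open>r\<close> is a tableau \<open>T\<close> of the shape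
    of \<open>w\<close> with its largest entry in row \<open>r\<close>, together with matrix units
    linking \<open>se w\<close> and \<open>se T\<close>. One choice per row is frozen in
    \<open>M\<close>, so that the spanning set is indexed by removable rows only.\<close>
  define unit where "unit r M \<longleftrightarrow> (\<exists>T a b. good r T \<and> a \<in> An n \<and> b \<in> An n \<and> a * b = se w \<and>
      b * a = se T \<and> a * se T = a \<and> se T * b = b \<and> M = (T, a, b))" for r M
  define M where "M r = (SOME M. unit r M)" for r
  define F where "F = insert (se w) ((\<lambda>r. fst (snd (M r)) * grp ?s * snd (snd (M r))) ` removable_rows w)"
  have F: "finite F" "card F \<le> card (adds w)"
  proof -
    show "finite F" by (simp add: F_def finite_removable_rows)
    have "card F \<le> Suc (card ((\<lambda>r. fst (snd (M r)) * grp ?s * snd (snd (M r))) ` removable_rows w))"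
      unfolding F_def by (rule card_insert_le_m1[of "Suc _", simplified]) simp
    then show "card F \<le> card (adds w)"
      unfolding card_adds
      using card_image_le[OF finite_removable_rows, of "\<lambda>r. fst (snd (M r)) * grp ?s * snd (snd (M r))" w]
      by linarith
  qed
  have se_w: "c \<star> se w \<in> galg.span F" for c
    by (rule galg.span_scale, rule galg.span_base) (simp add: F_def)
  have mid: "se w * (x * grp ?s * y) * se w \<in> galg.span F"
    if n: "n = Suc m" and x: "x \<in> An n" and y: "y \<in> An n" for m x y
  proof -
    \<comment> \<open>Inserting the decomposition of 1 one level below, next to \<open>s\<close>,
      splits the element by \<open>R\<close>.\<close>
    have "se w * (x * grp ?s * y) * se w = se w * x * grp ?s * (\<Sum>R\<in>words m. se R) * y * se w"
      by (simp add: one[OF n] mult.assoc)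
    also have "\<dots> = (\<Sum>R\<in>words m. se w * x * (grp ?s * se R) * y * se w)"
      by (simp add: sum_distrib_left sum_distrib_right mult.assoc)
    also have "\<dots> \<in> galg.span F"
    proof (rule galg.span_sum)
      fix R assume R: "R \<in> words m"
      have yR: "yam R" and lR: "length R = m" using R by (auto simp: words_def)
      have AnR: "z \<in> An n" if "z \<in> An m" for z using that An_mono[of m n] n by auto
      have seR: "se R \<in> An m" using se_An[of R] lR by simp
      have comm: "grp ?s * z = z * grp ?s" if "z \<in> An m" for z
        using fswap_commute_An[OF that] n by simp
      have split: "se R * grp ?s * se R = grp ?s * se R"
        by (simp only: comm[OF seR, symmetric]) (simp add: mult.assoc se_idem[OF yR])
      note refine = se_refine_right[OF w[unfolded n] R branch[OF n R]]
      show "se w * x * (grp ?s * se R) * y * se w \<in> galg.span F"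
      proof (cases "\<exists>r. r \<in> adds R \<and> count_list (r # R) = count_list w")
        case False
        then have none: "{r. r \<in> adds R \<and> count_list (r # R) = count_list w} = {}" by blast
        have "se w * x * se R = 0"
          using refine(1)[OF x[unfolded n]] by (simp only: none sum.empty)
        then have "se w * x * se R * grp ?s * se R * y * se w = 0" by simp
        moreover have "se w * x * se R * grp ?s * se R = se w * x * (grp ?s * se R)"
          unfolding split[symmetric] by (simp only: mult.assoc)
        ultimately show ?thesis by (simp only: galg.span_zero)
      next
        case True
        then obtain r where r: "r \<in> adds R" "count_list (r # R) = count_list w" by blast
        have "count_list w (Suc r) < count_list w r"
          using yam_antimono[OF yR, of r "Suc r"] by (simp flip: r(2))
        then have rem: "r \<in> removable_rows w" by (simp add: removable_rows_def)
        have good: "good r (r # R)" using R r n by (auto simp: good_def)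
        have "yam (r # R)" using yR r(1) unfolding yam_Cons_iff by simp
        from se_matrix_units[OF yw this r(2)[symmetric]] obtain a b where
          "a \<in> An (length w)" "b \<in> An (length w)" "a * b = se w" "b * a = se (r # R)"
          "a * se (r # R) = a" "se (r # R) * b = b" .
        then have "unit r (r # R, a, b)" using good lw unfolding unit_def by blast
        then have "\<exists>M. unit r M" by blast
        then have "unit r (M r)" unfolding M_def by (rule someI_ex)
        then obtain T a b where T: "good r T" and ab: "a \<in> An n" "b \<in> An n" "a * b = se w"
          "b * a = se T" "a * se T = a" "se T * b = b" and M: "M r = (T, a, b)"
          unfolding unit_def by blast
        from T n obtain R' where R': "R' \<in> words m" "T = r # R'" "r \<in> adds R'" "count_list T = count_list w"
          unfolding good_def by auto
        have "count_list R = count_list R'"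
        proof
          fix i show "count_list R i = count_list R' i"
            using fun_cong[OF r(2), of i] fun_cong[OF R'(4), of i] R'(2) by (auto split: if_splits)
        qed
        then obtain u v where "u \<in> An (length R)" "v \<in> An (length R)" and
          uv: "u * v = se R" "v * u = se R'" "u * se R' = u" "se R' * v = v"
          using R'(1) by (auto simp: words_def elim!: se_matrix_units[OF yR])
        then have uvA: "u \<in> An m" "v \<in> An m" by (simp_all add: lR)
        note unique = se_refine_unique[OF w[unfolded n] R'(1) branch[OF n R'(1)] _ R'(3)]
        have sw: "se w * a = a" "b * se w = b"
        proof -
          have "se w * a = a * (b * a)" by (simp only: ab(3)[symmetric] mult.assoc)
          then show "se w * a = a" by (simp only: ab)
          have "b * se w = b * a * b" by (simp only: ab(3)[symmetric] mult.assoc)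
          then show "b * se w = b" by (simp only: ab)
        qed
        have "grp ?s * se R = grp ?s * u * v" by (simp only: uv(1)[symmetric] mult.assoc)
        then have "grp ?s * se R = u * grp ?s * v" by (simp only: comm[OF uvA(1)])
        then have eq: "se w * x * (grp ?s * se R) * y * se w = se w * (x * u) * grp ?s * (v * y * se w)"
          by (simp add: mult.assoc)
        \<comment> \<open>Both sides of \<open>s\<close> now carry \<open>se R'\<close>, which
          refines to \<open>se T\<close>, that is \<open>b * a\<close>. Primitivity of
          \<open>se w\<close> turns what stands outside into scalars.\<close>
        have "se w * (x * u) = se w * (x * u) * se R'"
          using uv(3) by (simp add: mult.assoc)
        also have "\<dots> = se w * (x * u) * se T"
          using unique(1)[of "x * u"] R'(2,4) x AnR[OF uvA(1)] n by (simp add: An_mult del: se.simps)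
        also have "\<dots> = se w * (x * u * b) * se w * a"
          by (simp add: mult.assoc sw ab(4))
        finally have left: "se w * (x * u) = se w * (x * u * b) * se w * a" .
        have "v * y * se w = se R' * (v * y) * se w"
          using uv(4) by (simp flip: mult.assoc)
        also have "\<dots> = se T * (v * y) * se w"
          using unique(2)[of "v * y"] R'(2,4) y AnR[OF uvA(2)] n by (simp add: An_mult del: se.simps)
        also have "\<dots> = b * se w * a * v * y * se w"
          by (simp only: sw ab(4) mult.assoc[symmetric])
        also have "\<dots> = b * (se w * (a * v * y) * se w)"
          by (simp only: mult.assoc)
        finally have right: "v * y * se w = b * (se w * (a * v * y) * se w)" .
        obtain c where c: "se w * (x * u * b) * se w = c \<star> se w"
          using se_corner[OF yw, of "x * u * b"] x AnR[OF uvA(1)] ab(2) lw An_mult by blast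
        obtain d where d: "se w * (a * v * y) * se w = d \<star> se w"
          using se_corner[OF yw, of "a * v * y"] y AnR[OF uvA(2)] ab(1) lw An_mult by blast
        have "se w * x * (grp ?s * se R) * y * se w = (d * c) \<star> (a * grp ?s * b)"
          unfolding eq left right c d by (simp add: scl_simps sw)
        moreover have "a * grp ?s * b \<in> F"
          unfolding F_def using rem M by (auto intro!: image_eqI[of _ _ r])
        ultimately show ?thesis by (simp add: galg.span_base galg.span_scale)
      qed
    qed
    finally show ?thesis .
  qed
  have "se w * x * se w \<in> galg.span F" if "x \<in> An (Suc n)" for x
    using that
  proof (induction rule: An_induct)
    case zero
    then show ?case by (simp add: galg.span_zero)
  next
    case (grp a c)
    have "se w * grp a * se w \<in> galg.span F"
    proof (cases "a \<in> Sn n")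
      case True
      then have "grp a \<in> An (length w)" using lw by simp
      from se_corner[OF yw this] show ?thesis using se_w by auto
    next
      \<comment> \<open>For \<open>n = 0\<close> the element \<open>a\<close> would fix 1 and lie in
        the trivial group, contrary to this case.\<close>
      case False
      then obtain m where n: "n = Suc m"
        using grp app_in_iff[OF grp, of "Suc 0"] Sn_Suc_fixing[of a 0] by (cases n) auto
      from Sn_Suc_double_coset[of a m] grp False n obtain b d where
        bd: "b \<in> Sn n" "d \<in> Sn n" "a = b + ?s + d" by metis
      then show ?thesis using mid[OF n, of "grp b" "grp d"] by (simp add: grp_plus)
    qed
    then have "c \<star> (se w * grp a * se w) \<in> galg.span F" by (rule galg.span_scale)
    moreover have "se w * (cst c * grp a) * se w = c \<star> (se w * grp a * se w)"
      by (simp add: scl_simps flip: scl_def del: cst_grp)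
    ultimately show ?case by simp
  next
    case (add x y)
    then show ?case by (simp add: distrib_left distrib_right galg.span_add)
  qed
  then show ?thesis using F by blast
qed

text \<open>If the refinements did not add up to \<open>se w\<close>, the defect would be one
  further nonzero idempotent in the corner, orthogonal to all of them: one independent element too
  many.\<close>

lemma se_branch_step:
  assumes w: "w \<in> words n"
    and branch: "\<And>m R. n = Suc m \<Longrightarrow> R \<in> words m \<Longrightarrow> se R = (\<Sum>r\<in>adds R. se (r # R))"
    and one: "\<And>m. n = Suc m \<Longrightarrow> (\<Sum>R\<in>words m. se R) = 1"
  shows "se w = (\<Sum>r\<in>adds w. se (r # w))"
proof (rule ccontr)
  assume ne: "se w \<noteq> (\<Sum>r\<in>adds w. se (r # w))"
  have "\<exists>F. finite F \<and> card F \<le> card (adds w) \<and> (\<forall>x\<in>An (Suc n). se w * x * se w \<in> galg.span F)"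
    by (rule se_corner_spanned[OF w]) (erule (1) branch, erule one)
  then obtain F where F: "finite F" "card F \<le> card (adds w)"
    "\<forall>x\<in>An (Suc n). se w * x * se w \<in> galg.span F" by (elim exE conjE)
  have yw: "yam w" and lw: "length w = n" using w by (auto simp: words_def)
  have yr: "yam (r # w)" if "r \<in> adds w" for r using that yw unfolding yam_Cons_iff by simp
  define g where "g r = se (r # w)" for r
  define e where "e = se w"
  define S where "S = (\<Sum>r\<in>adds w. g r)"
  \<comment> \<open>The index \<open>None\<close> stands for the defect.\<close>
  define f where "f = case_option (e - S) g"
  define I where "I = insert None (Some ` adds w)"
  have ne': "e - S \<noteq> 0" using ne by (simp only: e_def S_def g_def right_minus_eq not_False_eq_True)
  have ee: "e * e = e" unfolding e_def by (rule se_idem[OF yw])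
  have gg: "g r * g t = (if r = t then g r else 0)" if "r \<in> adds w" "t \<in> adds w" for r t
  proof (cases "r = t")
    case True
    then show ?thesis unfolding g_def using se_idem[OF yr[OF that(1)]] by (simp del: se.simps)
  next
    case False
    have "se (r # w) * se (t # w) = 0"
      by (rule se_orthogonal[OF yr[OF that(1)] yr[OF that(2)]]) (use False in auto)
    then show ?thesis unfolding g_def using False by (simp only: if_False)
  qed
  have eg: "e * g r = g r" "g r * e = g r" if "r \<in> adds w" for r
    unfolding g_def e_def by (rule se_Cons_absorb[OF yr[OF that]])+
  have Sg: "S * g t = g t" "g t * S = g t" if t: "t \<in> adds w" for t
  proof -
    have "S * g t = (\<Sum>r\<in>adds w. if r = t then g r else 0)"
      unfolding S_def sum_distrib_right by (rule sum.cong) (auto simp: gg t)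
    then show "S * g t = g t" using t finite_adds by simp
    have "g t * S = (\<Sum>r\<in>adds w. if t = r then g t else 0)"
      unfolding S_def sum_distrib_left by (rule sum.cong) (auto simp: gg t)
    then show "g t * S = g t" using t finite_adds by simp
  qed
  have eS: "e * S = S" "S * e = S"
    by (simp_all add: S_def sum_distrib_left sum_distrib_right eg)
  have SS: "S * S = S"
  proof -
    have "S * S = (\<Sum>r\<in>adds w. S * g r)" by (subst (2) S_def) (simp add: sum_distrib_left)
    also have "\<dots> = (\<Sum>r\<in>adds w. g r)" by (simp add: Sg)
    also have "\<dots> = S" by (simp only: S_def)
    finally show ?thesis .
  qed
  have "card I \<le> card F"
  proof (rule card_orthogonal_idempotents_le[of F I f])
    show "finite F" "finite I" using F finite_adds by (auto simp: I_def)
    fix i assume i: "i \<in> I"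
    show "f i \<noteq> 0"
    proof (cases i)
      case (Some r)
      then have "r \<in> adds w" using i by (auto simp: I_def)
      from se_nonzero[OF yr[OF this]] show ?thesis by (simp add: Some f_def g_def del: se.simps)
    next
      case None
      then show ?thesis using ne' by (simp only: f_def option.case not_False_eq_True)
    qed
    show "f i * f i = f i"
      using i by (cases i) (auto simp: f_def I_def gg algebra_simps ee eS SS)
    have "g r \<in> An (Suc n)" for r using se_An[of "r # w"] lw by (simp add: g_def del: se.simps)
    moreover have "e \<in> An (Suc n)" using se_An_Suc[of w] lw by (simp add: e_def)
    ultimately have "f i \<in> An (Suc n)" by (cases i) (auto simp: f_def S_def intro!: An_closed)
    moreover have "e * f i * e = f i"
      using i by (cases i) (auto simp: f_def I_def algebra_simps ee eg eS)
    ultimately show "f i \<in> galg.span F" using bspec[OF F(3), of "f i"] by (simp add: e_def)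
    fix j assume j: "j \<in> I" "i \<noteq> j"
    show "f i * f j = 0"
      using i j by (cases i; cases j) (auto simp: f_def I_def algebra_simps gg eg Sg)
  qed
  moreover have "card I = Suc (card (adds w))"
    by (simp add: I_def finite_adds card_image card_insert_if image_iff)
  ultimately show False using F(2) by simp
qed

text \<open>The claims need each other: branching at one level uses both claims one level below, and
  the decomposition of 1 passes up by branching.\<close>

lemma se_branch_and_sum: "(\<forall>w\<in>words n. se w = (\<Sum>r\<in>adds w. se (r # w))) \<and> (\<Sum>w\<in>words n. se w) = 1"
proof (induction n)
  case 0
  have "words 0 = {[]}" by (auto simp: words_def)
  then have "(\<Sum>w\<in>words 0. se w) = 1" by simp
  moreover have "se w = (\<Sum>r\<in>adds w. se (r # w))" if "w \<in> words 0" for w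
    by (rule se_branch_step[OF that]) auto
  ultimately show ?case by blast
next
  case (Suc n)
  have "(\<Sum>w\<in>words (Suc n). se w) = (\<Sum>w\<in>words n. se w)"
    unfolding sum_words_Suc by (rule sum.cong[OF refl], rule sym) (use Suc in blast)
  then have "(\<Sum>w\<in>words (Suc n). se w) = 1" by (rule trans) (rule Suc[THEN conjunct2])
  moreover have "se w = (\<Sum>r\<in>adds w. se (r # w))" if "w \<in> words (Suc n)" for w
    by (rule se_branch_step[OF that]) (use Suc in auto)
  ultimately show ?case by blast
qed

lemma se_sum: "(\<Sum>w\<in>words n. se w) = 1"
  using se_branch_and_sum by blast

section \<open>The normalising constant counts standard tableaux\<close>

text \<open>The traces of \<open>a * b\<close> and \<open>b * a\<close> agree, and the trace of a
  unit determines its \<open>theta\<close>.\<close>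

lemma theta_same_shape:
  assumes "yam w" "yam v" "count_list w = count_list v"
  shows "theta w = theta v"
proof -
  obtain a b where "a * b = se w" "b * a = se v" using se_matrix_units[OF assms] by metis
  then have "tr (se w) = tr (se v)" by (metis tr_commute)
  then show ?thesis using tr_se assms by simp
qed

lemma se_grp_se:
  assumes "yam w" "a \<in> Sn (length w)"
  shows "se w * grp a * se w = (theta w * coef (se w) (- a)) \<star> se w"
proof -
  obtain c where c: "se w * grp a * se w = c \<star> se w"
    using se_corner[OF assms(1), of "grp a"] assms(2) by auto
  have "tr (se w * grp a * se w) = tr (se w * (se w * grp a))" by (rule tr_commute)
  then have "tr (se w * grp a * se w) = coef (se w) (- a)"
    by (simp add: se_idem'[OF assms(1)] tr_mult_grp)
  moreover have "tr (se w * grp a * se w) = c / theta w"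
    unfolding c by (simp add: tr_se[OF assms(1)])
  ultimately show ?thesis using theta_nonzero[OF assms(1)] c by (simp add: field_simps)
qed

text \<open>Averaging \<open>e\<close> over conjugation gives a central element acting by \<open>\<theta>\<close> on all units of the shape of \<open>e\<close>
  and by 0 on the others; comparing traces evaluates \<open>\<theta>\<close>.\<close>

lemma theta_eq:
  assumes w: "w \<in> words n"
  shows "theta w * of_nat (card {v \<in> words n. count_list v = count_list w}) = fact n"
proof -
  have yw: "yam w" and lw: "length w = n" using w by (auto simp: words_def)
  define W where "W = (\<Sum>a\<in>Sn n. grp a * se w * grp (- a))"
  have comm_grp: "W * grp b = grp b * W" if b: "b \<in> Sn n" for b
  proof -
    have bij: "bij_betw ((+) b) (Sn n) (Sn n)"
      by (rule bij_betw_byWitness[where f' = "(+) (- b)"]) (auto simp: plus_in_Sn b)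
    have "W = (\<Sum>a\<in>Sn n. grp (b + a) * se w * grp (- (b + a)))"
      unfolding W_def by (rule sum.reindex_bij_betw[OF bij, symmetric])
    also have "\<dots> = (\<Sum>a\<in>Sn n. grp b * (grp a * se w * grp (- a)) * grp (- b))"
      by (rule sum.cong) (simp_all only: minus_add grp_plus mult.assoc)
    also have "\<dots> = grp b * W * grp (- b)"
      by (simp add: W_def sum_distrib_left sum_distrib_right)
    finally have "W = grp b * W * grp (- b)" .
    then have "W * grp b = grp b * W * grp (- b) * grp b" by (rule arg_cong)
    then show ?thesis by (simp add: mult.assoc)
  qed
  have comm: "W * x = x * W" if "x \<in> An n" for x
    using that comm_grp by (rule An_commute)
  have W_w: "se w * W = theta w \<star> se w"
  proof -
    have "se w * W = (\<Sum>a\<in>Sn n. (se w * grp a * se w) * grp (- a))"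
      by (simp add: W_def sum_distrib_left mult.assoc)
    \<comment> \<open>Each corner scalar is \<open>theta w\<close> times a coefficient of
      \<open>se w\<close>, so the sum over the group reassembles \<open>se w\<close>.\<close>
    also have "\<dots> = (\<Sum>a\<in>Sn n. theta w \<star> (se w * (coef (se w) (- a) \<star> grp (- a))))"
      by (rule sum.cong) (simp_all add: se_grp_se[OF yw] lw scl_simps)
    also have "\<dots> = theta w \<star> (se w * (\<Sum>a\<in>Sn n. coef (se w) (- a) \<star> grp (- a)))"
      by (simp add: scl_sum sum_distrib_left)
    also have "(\<Sum>a\<in>Sn n. coef (se w) (- a) \<star> grp (- a)) =
        (\<Sum>a\<in>Sn n. coef (se w) a \<star> grp a)"
      by (rule sum.reindex_bij_witness[of _ uminus uminus]) auto
    also have "\<dots> = se w"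
      using An_expand[OF se_An[of w]] lw by (simp add: scl_def)
    finally show ?thesis by (simp add: se_idem[OF yw])
  qed
  have same: "se v * W = theta w \<star> se v" if "v \<in> words n" "count_list v = count_list w" for v
  proof -
    have yv: "yam v" and lv: "length v = n" using that by (auto simp: words_def)
    from se_same_shape_factor[OF yv yw that(2)] obtain x y where
      xy: "x \<in> An n" "y \<in> An n" "se v = x * se w * y" using lv by blast
    have "se v * W = x * (se w * W) * y"
      unfolding xy(3) by (simp add: mult.assoc comm[OF xy(2)])
    then show ?thesis unfolding W_w by (simp add: scl_simps xy(3))
  qed
  have diff: "se v * W = 0" if "v \<in> words n" "count_list v \<noteq> count_list w" for v
  proof -
    have yv: "yam v" and lv: "length v = n" using that by (auto simp: words_def)
    have "se v * grp a * se w = 0" if "a \<in> Sn n" for a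
      by (rule se_different_shapes[OF yv yw]) (use \<open>count_list v \<noteq> count_list w\<close> that lv lw in auto)
    then have "se v * (grp a * se w * grp (- a)) = 0" if "a \<in> Sn n" for a
      using that by (simp flip: mult.assoc)
    then show ?thesis by (simp add: W_def sum_distrib_left)
  qed
  let ?S = "{v \<in> words n. count_list v = count_list w}"
  \<comment> \<open>The decomposition of 1 diagonalises \<open>W\<close>. Its trace counts the words
    of the given shape, since each contributes \<open>theta w\<close> times the trace of a unit,
    which is 1.\<close>
  have "W = (\<Sum>v\<in>words n. se v) * W" by (simp add: se_sum)
  also have "\<dots> = (\<Sum>v\<in>words n. if count_list v = count_list w then theta w \<star> se v else 0)"
    unfolding sum_distrib_right by (rule sum.cong) (auto simp: same diff)
  also have "\<dots> = (\<Sum>v\<in>?S. theta w \<star> se v)"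
    by (simp add: sum.inter_filter finite_words)
  finally have "tr W = (\<Sum>v\<in>?S. theta w * tr (se v))" by (simp add: lookup_sum)
  also have "\<dots> = (\<Sum>v\<in>?S. 1)"
  proof (rule sum.cong[OF refl])
    fix v assume "v \<in> ?S"
    then have "yam v" "theta v = theta w" using theta_same_shape[OF _ yw] by (auto simp: words_def)
    then show "theta w * tr (se v) = 1" using theta_nonzero[OF yw] by (simp add: tr_se)
  qed
  finally have trW: "tr W = of_nat (card ?S)" by simp
  have "tr (grp a * se w * grp (- a)) = 1 / theta w" for a
    by (subst tr_commute) (simp add: tr_se[OF yw])
  then have "tr W = fact n / theta w"
    by (simp add: W_def lookup_sum card_Sn)
  then show ?thesis using trW theta_nonzero[OF yw] by (simp add: field_simps)
qed

section \<open>Jucys--Murphy elements\<close>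

definition jm :: "nat \<Rightarrow> galg" where
  "jm n = (\<Sum>j\<in>{1..<n}. grp (fswap j n))"

definition off_diag :: "nat \<Rightarrow> (nat \<times> nat) set" where
  "off_diag n = {(a, b) \<in> {1..n} \<times> {1..n}. a \<noteq> b}"

text \<open>Summing over ordered pairs, each transposition is counted twice.\<close>

definition fswap_sum :: "nat \<Rightarrow> galg" where
  "fswap_sum n = (\<Sum>(a, b)\<in>off_diag n. grp (fswap a b))"

lemma finite_off_diag [simp]: "finite (off_diag n)"
  by (rule finite_subset[of _ "{1..n} \<times> {1..n}"]) (auto simp: off_diag_def)

lemma fswap_sym: "fswap a b = fswap b a"
  by (rule fperm_eqI) (simp add: fswap.rep_eq transpose_commute)

lemma sum_off_diag_Suc:
  fixes h :: "nat \<Rightarrow> nat \<Rightarrow> 'a::comm_monoid_add"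
  shows "(\<Sum>(a, b)\<in>off_diag (Suc n). h a b) =
    (\<Sum>(a, b)\<in>off_diag n. h a b) + ((\<Sum>a\<in>{1..n}. h a (Suc n)) + (\<Sum>a\<in>{1..n}. h (Suc n) a))"
proof -
  have "off_diag (Suc n) = off_diag n \<union> ((\<lambda>a. (a, Suc n)) ` {1..n} \<union> (\<lambda>a. (Suc n, a)) ` {1..n})"
    by (auto simp: off_diag_def le_Suc_eq)
  moreover have "off_diag n \<inter> ((\<lambda>a. (a, Suc n)) ` {1..n} \<union> (\<lambda>a. (Suc n, a)) ` {1..n}) = {}"
    "(\<lambda>a. (a, Suc n)) ` {1..n} \<inter> (\<lambda>a. (Suc n, a)) ` {1..n} = {}"
    by (auto simp: off_diag_def)
  ultimately show ?thesis
    by (simp add: sum.union_disjoint sum.reindex inj_on_def)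
qed

lemma fswap_sum_Suc: "fswap_sum (Suc n) = fswap_sum n + 2 \<star> jm (Suc n)"
proof -
  have "jm (Suc n) = (\<Sum>a\<in>{1..n}. grp (fswap a (Suc n)))"
    by (simp add: jm_def atLeastLessThanSuc_atLeastAtMost)
  moreover have "(2::complex) \<star> x = x + x" for x
    using scl_distrib(2)[of 1 1 x] by simp
  ultimately show ?thesis
    unfolding fswap_sum_def sum_off_diag_Suc by (simp add: fswap_sym[of "Suc n"])
qed

lemma grp_conj_fswap:
  assumes "a \<in> Sn n" "x \<in> {1..n}" "y \<in> {1..n}"
  shows "a + fswap x y = fswap (app a x) (app a y) + a"
proof (rule fperm_eqI)
  fix z
  have "app a x \<in> {1..n}" "app a y \<in> {1..n}" using assms app_in_iff by blast+
  then show "app (a + fswap x y) z = app (fswap (app a x) (app a y) + a) z"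
    using assms by (simp add: app_fswap Transposition.transpose_def)
qed

lemma fswap_sum_central:
  assumes "x \<in> An n"
  shows "fswap_sum n * x = x * fswap_sum n"
proof (rule An_commute[OF assms])
  fix a assume a: "a \<in> Sn n"
  have in_iff: "app a x \<in> {1..n} \<longleftrightarrow> x \<in> {1..n}" "app (- a) x \<in> {1..n} \<longleftrightarrow> x \<in> {1..n}" for x
    using app_in_iff[of a n] app_in_iff[of "- a" n] a by simp_all
  have "grp a * fswap_sum n = (\<Sum>(x, y)\<in>off_diag n. grp a * grp (fswap x y))"
    by (simp add: fswap_sum_def sum_distrib_left case_prod_unfold)
  also have "\<dots> = (\<Sum>(x, y)\<in>off_diag n. grp (fswap (app a x) (app a y)) * grp a)"
    by (rule sum.cong)
      (auto simp: off_diag_def grp_conj_fswap[OF a] simp flip: grp_plus simp del: atLeastAtMost_iff)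
  also have "\<dots> = (\<Sum>(x, y)\<in>off_diag n. grp (fswap x y) * grp a)"
    by (rule sum.reindex_bij_witness[of _ "\<lambda>(x, y). (app (- a) x, app (- a) y)" "\<lambda>(x, y). (app a x, app a y)"])
      (auto simp: off_diag_def in_iff simp del: atLeastAtMost_iff One_nat_def)
  also have "\<dots> = fswap_sum n * grp a"
    by (simp add: fswap_sum_def sum_distrib_right case_prod_unfold)
  finally show "fswap_sum n * grp a = grp a * fswap_sum n" ..
qed

text \<open>If a transposition \<open>\<tau>\<close> is a product of a row and a column permutation, then one of the two factors is
  trivial, since the row permutation must fix every entry not moved by \<open>\<tau>\<close>.\<close>

lemma symm_fswap_antisymm:
  assumes fg: "filling l n f g" and ab: "a \<in> {1..n}" "b \<in> {1..n}" "a \<noteq> b"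
  shows "symm n f * grp (fswap a b) * antisymm n g =
    ((if f a = f b then 1 else 0) - (if g a = g b then 1 else 0)) \<star> (symm n f * antisymm n g)"
proof -
  let ?t = "fswap a b"
  have t: "?t \<in> Sn n" using ab by (simp add: fswap_in_Sn)
  have inj: "x = y" if "x \<in> {1..n}" "y \<in> {1..n}" "f x = f y" "g x = g y" for x y
    using inj_onD[OF filling_inj[OF fg], of x y] that by simp
  have app_t: "app ?t x = (if x = a then b else if x = b then a else x)" for x
    using ab by (simp add: app_fswap Transposition.transpose_def)
  consider (row) "f a = f b" "g a \<noteq> g b" | (col) "f a \<noteq> f b" "g a = g b" | (none) "f a \<noteq> f b" "g a \<noteq> g b"
    using inj[of a b] ab by blast
  then show ?thesis
  proof cases
    case row
    then have "?t \<in> stab n f" using ab by (simp add: fswap_in_stab)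
    then show ?thesis using row by (simp add: grp_symm)
  next
    case col
    then have "?t \<in> stab n g" using ab by (simp add: fswap_in_stab)
    moreover have "sgn_of ?t = - 1" using ab by (simp add: sgn_of_fswap)
    ultimately show ?thesis using col by (simp add: mult.assoc grp_antisymm scl_simps flip: scl_def)
  next
    case none
    from fg t have "symm n f * grp ?t * antisymm n g = 0"
    proof (cases rule: symm_grp_antisymm_cases)
      case (2 p)
      have p_row: "f (app p x) = f x" if "x \<in> {1..n}" for x using 2(1) that by (simp add: stab_def)
      have pt_col: "g (app p (app ?t x)) = g x" if "x \<in> {1..n}" for x using 2(2) that by (simp add: stab_def)
      have p_in: "app p x \<in> {1..n}" if "x \<in> {1..n}" for x
        using 2(1) that app_in_iff[of p n x] by (simp add: stab_def)
      have p_fix: "app p x = x" if "x \<in> {1..n}" "x \<noteq> a" "x \<noteq> b" for x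
        using inj[OF p_in[OF that(1)] that(1)] p_row[OF that(1)] pt_col[OF that(1)] that by (simp add: app_t)
      have "app p a = a \<or> app p a = b"
      proof (rule ccontr)
        assume no: "\<not> (app p a = a \<or> app p a = b)"
        then have "app p (app p a) = app p a" using p_fix[OF p_in[OF ab(1)]] by blast
        then show False using no by simp
      qed
      then show ?thesis
      proof
        assume pa: "app p a = a"
        have "g (app p (app ?t b)) = g b" using pt_col[OF ab(2)] .
        then show ?thesis using pa none ab(3) by (simp add: app_t)
      next
        assume "app p a = b"
        then show ?thesis using p_row[OF ab(1)] none by simp
      qed
    qed
    then show ?thesis using none by simp
  qed
qed

text \<open>Twice the sum of the contents: a row of length k has k(k-1) ordered pairs, twice the sum
  of its column indices, and likewise for columns.\<close>

definition content_sum :: "nat list \<Rightarrow> complex" where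
  "content_sum w = (\<Sum>(a, b)\<in>off_diag (length w).
     (if row_of w a = row_of w b then 1 else 0) - (if col_of w a = col_of w b then 1 else 0))"

text \<open>Being central, \<open>fswap_sum\<close> can be moved between the two factors of
  \<open>ysym w\<close>, where each transposition acts by 1, 0 or -1.\<close>

lemma fswap_sum_ysym:
  assumes "yam w"
  shows "fswap_sum (length w) * ysym w = content_sum w \<star> ysym w"
proof -
  let ?P = "symm (length w) (row_of w)" and ?N = "antisymm (length w) (col_of w)"
  have "fswap_sum (length w) * ysym w = ?P * fswap_sum (length w) * ?N"
    unfolding ysym_def by (simp add: fswap_sum_central[OF symm_An] flip: mult.assoc)
  also have "\<dots> = (\<Sum>(a, b)\<in>off_diag (length w). ?P * grp (fswap a b) * ?N)"
    by (simp add: fswap_sum_def sum_distrib_left sum_distrib_right case_prod_unfold)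
  also have "\<dots> = content_sum w \<star> ysym w"
    unfolding content_sum_def sum_scl ysym_def
    by (rule sum.cong) (auto simp: off_diag_def symm_fswap_antisymm[OF yam_filling[OF assms]])
  finally show ?thesis .
qed

lemma fswap_sum_se:
  assumes "yam w"
  shows "fswap_sum (length w) * se w = content_sum w \<star> se w"
proof (cases w)
  case Nil
  then show ?thesis by (simp add: fswap_sum_def content_sum_def off_diag_def)
next
  case (Cons r v)
  have "fswap_sum (length w) * se w = (1 / theta w) \<star> (fswap_sum (length w) * se v * ysym w * se v)"
    by (simp add: Cons scl_simps mult.assoc)
  also have "fswap_sum (length w) * se v * ysym w * se v = se v * (fswap_sum (length w) * ysym w) * se v"
    using fswap_sum_central[of "se v" "length w"] se_An_Suc[of v] Cons by (simp add: mult.assoc)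
  finally show ?thesis unfolding fswap_sum_ysym[OF assms] by (simp add: Cons scl_simps mult.commute)
qed

text \<open>The column of the new cell consists of one cell in each row above row \<open>r\<close>:
  addability makes those rows strictly longer than row \<open>r\<close>, and the rows from
  \<open>r\<close> on do not reach the column.\<close>

lemma card_same_column:
  assumes "yam (r # w)"
  shows "card {x \<in> {1..length w}. col_of w x = count_list w r} = r"
proof -
  let ?X = "{x \<in> {1..length w}. col_of w x = count_list w r}"
  let ?F = "\<lambda>x. (row_of w x, col_of w x)"
  have yw: "yam w" and add: "addable (count_list w) r" using assms by auto
  have "count_list w r < count_list w i \<longleftrightarrow> i < r" for i
  proof
    assume "count_list w r < count_list w i"
    then show "i < r" using yam_antimono[OF yw, of r i] by (metis leD leI)
  next
    assume "i < r"
    then have "count_list w r < count_list w (r - 1)" "i \<le> r - 1" using add by (auto simp: addable_def)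
    then show "count_list w r < count_list w i"
      using yam_antimono[OF yw, of i "r - 1"] by simp
  qed
  then have "?F ` {1..length w} \<inter> (UNIV \<times> {count_list w r}) = {..<r} \<times> {count_list w r}"
    using bij_betw_cells[of w] unfolding bij_betw_def by auto
  moreover have "?F ` ?X = ?F ` {1..length w} \<inter> (UNIV \<times> {count_list w r})" by auto
  ultimately have c: "card (?F ` ?X) = r" by (simp add: card_cartesian_product)
  have "inj_on ?F ?X"
    by (rule inj_on_subset[OF filling_inj[OF yam_filling[OF yw]]]) auto
  from card_image[OF this] c show ?thesis by simp
qed

text \<open>The new entry shares its row with \<open>count_list w r\<close> older entries and its
  column with \<open>r\<close>; each pair occurs in both orders.\<close>

lemma content_sum_Cons:
  assumes "yam (r # w)"
  shows "content_sum (r # w) = content_sum w + 2 * (of_nat (count_list w r) - of_nat r)"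
proof -
  let ?n = "length w"
  let ?h = "\<lambda>v a b. ((if row_of v a = row_of v b then 1 else 0) - (if col_of v a = col_of v b then 1 else 0))
    :: complex"
  have old: "(\<Sum>(a, b)\<in>off_diag ?n. ?h (r # w) a b) = content_sum w"
    unfolding content_sum_def by (rule sum.cong) (auto simp: off_diag_def)
  have new: "(\<Sum>a\<in>{1..?n}. ?h (r # w) a (Suc ?n)) = of_nat (count_list w r) - of_nat r"
  proof -
    have "(\<Sum>a\<in>{1..?n}. ?h (r # w) a (Suc ?n)) =
        (\<Sum>a\<in>{1..?n}. if row_of w a = r then 1 else 0) -
        (\<Sum>a\<in>{1..?n}. if col_of w a = count_list w r then 1 else 0)"
      unfolding sum_subtractf[symmetric] by (rule sum.cong) auto
    also have "\<dots> = of_nat (card {a \<in> {1..?n}. row_of w a = r}) -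
        of_nat (card {a \<in> {1..?n}. col_of w a = count_list w r})"
      by (simp add: sum.If_cases Int_def)
    finally show ?thesis
      using card_same_column[OF assms] card_row[OF yam_filling, of w r] assms by simp
  qed
  have sym: "(\<Sum>a\<in>{1..?n}. ?h (r # w) (Suc ?n) a) = (\<Sum>a\<in>{1..?n}. ?h (r # w) a (Suc ?n))"
    by (simp only: eq_commute[of "row_of (r # w) (Suc ?n)"] eq_commute[of "col_of (r # w) (Suc ?n)"])
  have "content_sum (r # w) = (\<Sum>(a, b)\<in>off_diag ?n. ?h (r # w) a b) +
      ((\<Sum>a\<in>{1..?n}. ?h (r # w) a (Suc ?n)) + (\<Sum>a\<in>{1..?n}. ?h (r # w) (Suc ?n) a))"
    unfolding content_sum_def list.size add_0_right add_Suc_right by (rule sum_off_diag_Suc)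
  then show ?thesis unfolding old sym new by simp
qed

text \<open>Twice \<open>jm\<close> is the difference of two consecutive \<open>fswap_sum\<close>;
  the smaller one acts on \<open>se (r # w)\<close> through the absorbed factor
  \<open>se w\<close>.\<close>

lemma jm_se:
  assumes "yam (r # w)"
  shows "jm (Suc (length w)) * se (r # w) = (of_nat (count_list w r) - of_nat r) \<star> se (r # w)"
proof -
  let ?n = "length w" and ?e = "se (r # w)"
  have yw: "yam w" using assms by simp
  have "fswap_sum ?n * ?e = fswap_sum ?n * se w * ?e"
    using se_Cons_absorb(1)[OF assms] by (simp only: mult.assoc)
  then have "fswap_sum ?n * ?e = content_sum w \<star> ?e"
    unfolding fswap_sum_se[OF yw] scl_simps se_Cons_absorb(1)[OF assms] .
  moreover have "fswap_sum (Suc ?n) * ?e = content_sum (r # w) \<star> ?e"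
    using fswap_sum_se[OF assms] by (simp only: list.size add_0_right add_Suc_right)
  moreover have "fswap_sum (Suc ?n) * ?e = fswap_sum ?n * ?e + 2 \<star> (jm (Suc ?n) * ?e)"
    unfolding fswap_sum_Suc by (simp only: distrib_right scl_simps)
  ultimately have "2 \<star> (jm (Suc ?n) * ?e) = content_sum (r # w) \<star> ?e - content_sum w \<star> ?e"
    by (metis add_diff_cancel_left')
  also have "\<dots> = 2 \<star> ((of_nat (count_list w r) - of_nat r) \<star> ?e)"
    unfolding content_sum_Cons[OF assms] scl_distrib(4)[symmetric] scl_simps by simp
  finally show ?thesis by (rule scl_cancel[rotated]) simp
qed

lemma jm_An: "jm n \<in> An n"
  by (auto simp: jm_def fswap_in_Sn intro!: An_sum)

lemma jm_commute:
  assumes "x \<in> An n"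
  shows "jm (Suc n) * x = x * jm (Suc n)"
proof -
  have "x \<in> An (Suc n)" using assms An_mono[of n "Suc n"] by auto
  then have "fswap_sum (Suc n) * x = x * fswap_sum (Suc n)" by (rule fswap_sum_central)
  then have "2 \<star> (jm (Suc n) * x) = 2 \<star> (x * jm (Suc n))"
    using fswap_sum_central[OF assms] by (simp add: fswap_sum_Suc distrib_left distrib_right scl_simps)
  then show ?thesis by (rule scl_cancel[rotated]) simp
qed

text \<open>The letter \<^term>\<open>hd w\<close> is the row of the largest entry, so the scalars are contents, column minus row.\<close>

lemma jm_power:
  "jm (Suc n) ^ k = (\<Sum>w\<in>words (Suc n). (of_nat (count_list (tl w) (hd w)) - of_nat (hd w)) ^ k \<star> se w)"
proof (induction k)
  case 0
  then show ?case by (simp add: se_sum)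
next
  case (Suc k)
  have "jm (Suc n) * se w = (of_nat (count_list (tl w) (hd w)) - of_nat (hd w)) \<star> se w"
    if w: "w \<in> words (Suc n)" for w
  proof -
    obtain r v where rv: "w = r # v" using w by (cases w) (auto simp: words_def)
    then show ?thesis using w jm_se[of r v] by (simp add: words_def del: se.simps yam.simps)
  qed
  then show ?case
    by (simp add: Suc sum_distrib_left scl_simps mult.commute)
qed

section \<open>Shape projections\<close>

definition shape_proj :: "nat \<Rightarrow> (nat \<Rightarrow> nat) \<Rightarrow> galg" where
  "shape_proj n l = (\<Sum>w | w \<in> words n \<and> count_list w = l. se w)"

text \<open>Both products equal the sum of \<open>se w * x * se v\<close> over words
  \<open>w\<close> and \<open>v\<close> of shape \<open>l\<close>: decompose 1 on the free side and
  drop the mixed shapes.\<close>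

lemma shape_proj_central:
  assumes "x \<in> An n"
  shows "shape_proj n l * x = x * shape_proj n l"
proof -
  let ?L = "{w \<in> words n. count_list w = l}"
  have zero: "se w * x * se v = 0" if "w \<in> words n" "v \<in> words n" "count_list w \<noteq> count_list v" for w v
    using that assms by (intro se_different_shapes) (auto simp: words_def)
  have "shape_proj n l * x = shape_proj n l * x * (\<Sum>v\<in>words n. se v)" by (simp add: se_sum)
  also have "\<dots> = (\<Sum>w\<in>?L. \<Sum>v\<in>words n. se w * x * se v)"
    by (simp add: shape_proj_def sum_distrib_left sum_distrib_right)
      (rule sum.swap)
  also have "\<dots> = (\<Sum>w\<in>?L. \<Sum>v\<in>?L. se w * x * se v)"
    by (intro sum.cong refl sum.mono_neutral_right) (auto simp: finite_words intro: zero)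
  also have "\<dots> = (\<Sum>v\<in>?L. \<Sum>w\<in>?L. se w * x * se v)" by (rule sum.swap)
  also have "\<dots> = (\<Sum>v\<in>?L. \<Sum>w\<in>words n. se w * x * se v)"
    by (intro sum.cong refl sum.mono_neutral_left) (auto simp: finite_words intro: zero)
  also have "\<dots> = (\<Sum>v\<in>words n. se v) * x * shape_proj n l"
    by (simp add: shape_proj_def sum_distrib_left sum_distrib_right)
  finally show ?thesis by (simp add: se_sum)
qed

text \<open>A unit absorbs the unit of its tail and annihilates those of the other words of that
  length. Both factors on the right commute with the smaller algebra.\<close>

lemma marked_sum_eq_product:
  "(\<Sum>w | w \<in> words (Suc n) \<and> count_list w = l \<and> count_list (tl w) = l'. se w) =
    shape_proj (Suc n) l * shape_proj n l'"
proof -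
  let ?L = "{w \<in> words (Suc n). count_list w = l}" and ?L' = "{v \<in> words n. count_list v = l'}"
  have prod: "se w * se v = (if v = tl w then se w else 0)" if w: "w \<in> words (Suc n)" and v: "v \<in> words n" for w v
  proof -
    obtain r u where wu: "w = r # u" using w by (cases w) (auto simp: words_def)
    have yw: "yam (r # u)" using w wu by (simp add: words_def)
    show ?thesis
    proof (cases "v = u")
      case True
      then show ?thesis using se_Cons_absorb(2)[OF yw] by (simp only: wu list.sel if_True simp_thms)
    next
      case False
      then have "se u * se v = 0" using w v wu by (intro se_orthogonal) (auto simp: words_def)
      then have "se w * se u * se v = 0" by (simp add: mult.assoc)
      then have "se w * se v = 0" unfolding wu se_Cons_absorb(2)[OF yw] .
      then show ?thesis using False wu by simp
    qed
  qed
  have "shape_proj (Suc n) l * shape_proj n l' = (\<Sum>w\<in>?L. \<Sum>v\<in>?L'. se w * se v)"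
    unfolding shape_proj_def by (rule sum_product)
  also have "\<dots> = (\<Sum>w\<in>?L. \<Sum>v\<in>?L'. if v = tl w then se w else 0)"
    by (intro sum.cong refl) (auto simp: prod)
  also have "\<dots> = (\<Sum>w\<in>?L. if tl w \<in> ?L' then se w else 0)"
    by (intro sum.cong refl) (simp add: finite_words)
  also have "\<dots> = (\<Sum>w | w \<in> words (Suc n) \<and> count_list w = l \<and> count_list (tl w) = l'. se w)"
  proof -
    have "tl w \<in> words n" if "w \<in> words (Suc n)" for w using that by (cases w) (auto simp: words_def)
    then have "{w \<in> ?L. tl w \<in> ?L'} = {w. w \<in> words (Suc n) \<and> count_list w = l \<and> count_list (tl w) = l'}"
      by auto
    then show ?thesis by (simp add: sum.inter_filter[symmetric] finite_words)
  qed
  finally show ?thesis ..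
qed

text \<open>The last cell is a corner, so all rows below it are strictly shorter. It therefore lies
  in the lowest row of its length.\<close>

lemma last_row_determined:
  assumes "yam (r # w)" "yam (s # v)" "count_list (r # w) = count_list (s # v)"
    "count_list (r # w) r = count_list (s # v) s"
  shows "r = s" "count_list w = count_list v"
proof -
  have less: "count_list (r # w) s < count_list (r # w) r" if "yam (r # w)" "r < s" for r s w
    using yam_antimono[of w r s] that by (auto simp: le_imp_less_Suc)
  show "r = s"
    using less[OF assms(1), of s] less[OF assms(2), of r] assms(3,4) by (metis less_irrefl linorder_neqE_nat)
  then show "count_list w = count_list v"
    using assms(3) by (auto simp: fun_eq_iff split: if_splits)
qed

definition marked_words :: "nat \<Rightarrow> (nat \<Rightarrow> nat) \<Rightarrow> nat \<Rightarrow> nat list set" where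
  "marked_words n l j = {w \<in> words n. count_list w = l \<and> l (hd w) = j}"

text \<open>Shape and marked row length determine the shape of the tail, so the sum is a product of
  two shape projections.\<close>

lemma marked_words_sum_commute:
  assumes "x \<in> An n"
  shows "(\<Sum>w\<in>marked_words (Suc n) l j. se w) * x = x * (\<Sum>w\<in>marked_words (Suc n) l j. se w)"
proof (cases "marked_words (Suc n) l j = {}")
  case False
  then obtain w0 where w0: "w0 \<in> marked_words (Suc n) l j" by blast
  then obtain s v where w0_eq: "w0 = s # v" by (cases w0) (auto simp: marked_words_def words_def)
  have "marked_words (Suc n) l j =
      {w. w \<in> words (Suc n) \<and> count_list w = l \<and> count_list (tl w) = count_list v}"
  proof (rule Set.set_eqI)
    fix w
    show "w \<in> marked_words (Suc n) l j \<longleftrightarrow>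
      w \<in> {w. w \<in> words (Suc n) \<and> count_list w = l \<and> count_list (tl w) = count_list v}"
    proof (cases w)
      case Nil
      then show ?thesis by (simp add: marked_words_def words_def)
    next
      case (Cons r u)
      have sv: "yam (s # v)" "count_list (s # v) = l" "l s = j"
        using w0 by (auto simp: marked_words_def words_def w0_eq simp del: yam.simps)
      show ?thesis
      proof
        assume "w \<in> marked_words (Suc n) l j"
        then have "yam (r # u)" "count_list (r # u) = l" "l r = j" "w \<in> words (Suc n)"
          by (auto simp: marked_words_def words_def Cons simp del: yam.simps)
        then show "w \<in> {w. w \<in> words (Suc n) \<and> count_list w = l \<and> count_list (tl w) = count_list v}"
          using last_row_determined(2)[of r u s v] sv Cons by simp
      next
        assume asm: "w \<in> {w. w \<in> words (Suc n) \<and> count_list w = l \<and> count_list (tl w) = count_list v}"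
        then have l: "count_list (r # u) = l" "count_list u = count_list v" using Cons by auto
        have "r = s"
          using fun_cong[OF l(1), of r] fun_cong[OF sv(2), of r] fun_cong[OF l(2), of r]
          by (auto split: if_splits)
        then show "w \<in> marked_words (Suc n) l j"
          using asm sv(3) by (simp add: marked_words_def Cons)
      qed
    qed
  qed
  then have eq: "(\<Sum>w\<in>marked_words (Suc n) l j. se w) = shape_proj (Suc n) l * shape_proj n (count_list v)"
    by (simp only: marked_sum_eq_product)
  have "x \<in> An (Suc n)" using assms An_mono[of n "Suc n"] by auto
  then show ?thesis
    unfolding eq using shape_proj_central[OF assms, of "count_list v"] shape_proj_central[of x "Suc n" l]
    by (metis mult.assoc)
qed simp

section \<open>Comparison with the function model of the group algebra\<close>

lemma carrier_sym_group: "carrier (sym_group n) = {p. p permutes {1..n}}"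
  by (simp add: sym_group_def)

lemma carrier_sym_group_app: "carrier (sym_group n) = app ` Sn n"
  using bij_betw_app_Sn[of n] by (simp add: carrier_sym_group bij_betw_def)

lemma app_in_sym_group_iff: "app a \<in> carrier (sym_group n) \<longleftrightarrow> a \<in> Sn n"
  by (simp add: carrier_sym_group Sn_def)

lemma abelian_monoid_sym_alg: "abelian_monoid (sym_alg n)"
  by (rule abelian_monoidI) (auto simp: sym_alg_def ac_simps)

lemma finsum_sym_alg:
  assumes "finite A" "\<And>x. x \<in> A \<Longrightarrow> f x \<in> carrier (sym_alg n)"
  shows "finsum (sym_alg n) f A = (\<lambda>\<sigma>. \<Sum>x\<in>A. f x \<sigma>)"
  using assms
proof (induction A rule: finite_induct)
  case empty
  then show ?case
    by (simp add: abelian_monoid.finsum_empty[OF abelian_monoid_sym_alg]) (simp add: sym_alg_def)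
next
  case (insert x A)
  then have "finsum (sym_alg n) f (insert x A) = f x \<oplus>\<^bsub>sym_alg n\<^esub> finsum (sym_alg n) f A"
    by (intro abelian_monoid.finsum_insert[OF abelian_monoid_sym_alg]) auto
  then show ?case using insert by (simp add: sym_alg_def)
qed

text \<open>Off the finitary permutations \<open>Fperm\<close> is unspecified, so the value there is
  set to 0.\<close>

definition ev :: "galg \<Rightarrow> alg_elt" where
  "ev x = (\<lambda>\<sigma>. if \<exists>m. \<sigma> permutes {1..m} then coef x (Fperm \<sigma>) else 0)"

lemma ev_app [simp]: "ev x (app a) = coef x a"
  using app[of a] by (simp add: ev_def app_inverse)

lemma ev_outside: "x \<in> An n \<Longrightarrow> \<sigma> \<notin> carrier (sym_group n) \<Longrightarrow> ev x \<sigma> = 0"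
proof -
  assume x: "x \<in> An n" and \<sigma>: "\<sigma> \<notin> carrier (sym_group n)"
  show "ev x \<sigma> = 0"
  proof (cases "\<exists>m. \<sigma> permutes {1..m}")
    case True
    then obtain a where "\<sigma> = app a" by (metis app_Fperm)
    then show ?thesis using \<sigma> An_lookup[OF x, of a] by (simp add: app_in_sym_group_iff)
  qed (simp add: ev_def)
qed

lemma ev_carrier: "x \<in> An n \<Longrightarrow> ev x \<in> carrier (sym_alg n)"
  using ev_outside by (simp add: sym_alg_def)

lemma sym_alg_eqI:
  assumes "g \<in> carrier (sym_alg n)" "h \<in> carrier (sym_alg n)" "\<And>a. a \<in> Sn n \<Longrightarrow> g (app a) = h (app a)"
  shows "g = h"
proof
  fix \<sigma>
  show "g \<sigma> = h \<sigma>"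
    using assms by (cases "\<sigma> \<in> carrier (sym_group n)") (auto simp: sym_alg_def carrier_sym_group_app)
qed

lemma ev_sum: "ev (sum f A) = (\<lambda>\<sigma>. \<Sum>x\<in>A. ev (f x) \<sigma>)"
  by (simp add: ev_def lookup_sum fun_eq_iff)

lemma finsum_ev:
  assumes "finite A" "\<And>x. x \<in> A \<Longrightarrow> f x \<in> An n"
  shows "finsum (sym_alg n) (\<lambda>x. ev (f x)) A = ev (sum f A)"
  using assms by (subst finsum_sym_alg) (auto simp: ev_sum ev_carrier)

lemma ev_smult: "c \<odot>\<^bsub>sym_alg n\<^esub> ev x = ev (c \<star> x)"
  by (simp add: sym_alg_def ev_def fun_eq_iff)

lemma ev_grp: "ev (grp a) = of_perm (app a)"
proof
  fix \<sigma>
  show "ev (grp a) \<sigma> = of_perm (app a) \<sigma>"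
  proof (cases "\<exists>m. \<sigma> permutes {1..m}")
    case True
    then obtain b where "\<sigma> = app b" by (metis app_Fperm)
    then show ?thesis by (auto simp: of_perm_def lookup_single when_def app_inject)
  next
    case False
    then have "\<sigma> \<noteq> app a" using app[of a] by blast
    then show ?thesis using False by (simp add: ev_def of_perm_def)
  qed
qed

lemma ev_one: "ev 1 = \<one>\<^bsub>sym_alg n\<^esub>"
  using ev_grp[of 0] by (simp add: sym_alg_def zero_fperm.rep_eq)

lemma ev_mult:
  assumes x: "x \<in> An n" and y: "y \<in> An n"
  shows "ev x \<otimes>\<^bsub>sym_alg n\<^esub> ev y = ev (x * y)"
proof (rule sym_alg_eqI[of _ n])
  have sum_eq: "(ev x \<otimes>\<^bsub>sym_alg n\<^esub> ev y) \<sigma> =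
      (\<Sum>b\<in>Sn n. coef x b * ev y (app (- b) \<circ> \<sigma>))" for \<sigma>
    using sum.reindex_bij_betw[OF bij_betw_app_Sn[of n], of "\<lambda>\<rho>. ev x \<rho> * ev y (Hilbert_Choice.inv \<rho> \<circ> \<sigma>)"]
    by (simp add: sym_alg_def carrier_sym_group uminus_fperm.rep_eq)
  show "ev x \<otimes>\<^bsub>sym_alg n\<^esub> ev y \<in> carrier (sym_alg n)"
  proof -
    have "(ev x \<otimes>\<^bsub>sym_alg n\<^esub> ev y) \<sigma> = 0" if \<sigma>: "\<sigma> \<notin> carrier (sym_group n)" for \<sigma>
    proof -
      have "ev y (app (- b) \<circ> \<sigma>) = 0" if b: "b \<in> Sn n" for b
      proof (rule ev_outside[OF y], rule notI)
        assume "app (- b) \<circ> \<sigma> \<in> carrier (sym_group n)"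
        then obtain c where c: "c \<in> Sn n" "app (- b) \<circ> \<sigma> = app c" by (auto simp: carrier_sym_group_app)
        have "\<sigma> = app (b + c)"
        proof
          fix z show "\<sigma> z = app (b + c) z" using fun_cong[OF c(2), of z] by (metis app_plus app_uminus_app(2) comp_apply)
        qed
        then show False using \<sigma> b c by (simp add: app_in_sym_group_iff plus_in_Sn)
      qed
      then show ?thesis by (simp add: sum_eq)
    qed
    then show ?thesis by (simp add: sym_alg_def)
  qed
  show "ev (x * y) \<in> carrier (sym_alg n)" using assms by (simp add: An_mult ev_carrier)
  fix a
  have "app (- b) \<circ> app a = app (- b + a)" for b by (simp add: plus_fperm.rep_eq)
  then show "(ev x \<otimes>\<^bsub>sym_alg n\<^esub> ev y) (app a) = ev (x * y) (app a)"
    using x by (simp add: sum_eq lookup_times[of "Sn n"] An_def)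
qed

lemma An_power: "x \<in> An n \<Longrightarrow> x ^ k \<in> An n"
  by (induction k) (auto simp: An_mult)

lemma ev_power: "x \<in> An n \<Longrightarrow> ev x [^]\<^bsub>sym_alg n\<^esub> k = ev (x ^ k)" for k :: nat
  by (induction k) (simp_all add: nat_pow_def ev_one[symmetric] ev_mult An_power power_Suc2
      del: power_Suc)

lemma jucys_murphy_eq: "jucys_murphy n = ev (jm n)"
proof -
  have "jucys_murphy n = finsum (sym_alg n) (\<lambda>j. ev (grp (fswap j n))) {1..<n}"
    unfolding jucys_murphy_def
    by (rule abelian_monoid.finsum_cong'[OF abelian_monoid_sym_alg])
      (auto simp: ev_grp[symmetric] app_fswap[symmetric] fswap_in_Sn intro!: ev_carrier)
  also have "\<dots> = ev (jm n)"
    unfolding jm_def by (rule finsum_ev) (auto simp: fswap_in_Sn)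
  finally show ?thesis .
qed

lemma star_transpositions_eq: "star_transpositions n = (\<lambda>j. app (fswap j n)) ` {1..<n}"
  unfolding star_transpositions_def by (auto simp: app_fswap)

text \<open>Peeling off the leftmost factor mirrors the product \<open>jm n * jm n ^ r\<close>.
  Transpositions with different \<open>j\<close> differ at \<open>n\<close>, so no list is counted
  twice.\<close>

lemma card_star_factorizations:
  "of_nat (card {\<tau>s. length \<tau>s = r \<and> set \<tau>s \<subseteq> star_transpositions n \<and> foldr (\<circ>) \<tau>s id = app a}) =
    coef (jm n ^ r) a"
proof (induction r arbitrary: a)
  case 0
  have "{\<tau>s. length \<tau>s = 0 \<and> set \<tau>s \<subseteq> star_transpositions n \<and> foldr (\<circ>) \<tau>s id = app a} =
      (if a = 0 then {[]} else {})"
    by (auto simp: zero_fperm.rep_eq app_inject[symmetric])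
  then show ?case unfolding power_0 by (simp only:) (simp add: lookup_one when_def)
next
  case (Suc r)
  let ?L = "\<lambda>r a. {\<tau>s. length \<tau>s = r \<and> set \<tau>s \<subseteq> star_transpositions n \<and> foldr (\<circ>) \<tau>s id = app a}"
  let ?t = "\<lambda>j. fswap j n"
  have fin: "finite (?L r a)" for r a
    by (rule finite_subset[OF _ finite_lists_length_eq[of "star_transpositions n" r]])
      (auto simp: star_transpositions_eq)
  have step: "app (?t j) \<circ> f = app a \<longleftrightarrow> f = app (- ?t j + a)" for f j
  proof
    assume *: "app (?t j) \<circ> f = app a"
    show "f = app (- ?t j + a)"
    proof
      fix z show "f z = app (- ?t j + a) z" using fun_cong[OF *, of z, symmetric] by simp
    qed
  qed (auto simp: fun_eq_iff)
  have union: "?L (Suc r) a = (\<Union>j\<in>{1..<n}. (#) (app (?t j)) ` ?L r (- ?t j + a))"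
  proof (rule Set.set_eqI)
    fix \<tau>s
    show "\<tau>s \<in> ?L (Suc r) a \<longleftrightarrow> \<tau>s \<in> (\<Union>j\<in>{1..<n}. (#) (app (?t j)) ` ?L r (- ?t j + a))"
      by (cases \<tau>s) (auto simp: star_transpositions_eq step image_iff)
  qed
  have "card (\<Union>j\<in>{1..<n}. (#) (app (?t j)) ` ?L r (- ?t j + a)) =
      (\<Sum>j\<in>{1..<n}. card ((#) (app (?t j)) ` ?L r (- ?t j + a)))"
  proof (rule card_UN_disjoint)
    show "\<forall>i\<in>{1..<n}. \<forall>j\<in>{1..<n}. i \<noteq> j \<longrightarrow>
      (#) (app (?t i)) ` ?L r (- ?t i + a) \<inter> (#) (app (?t j)) ` ?L r (- ?t j + a) = {}"
    proof (intro ballI impI)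
      fix i j assume ij: "i \<in> {1..<n}" "j \<in> {1..<n}" "i \<noteq> j"
      then have "app (?t i) n \<noteq> app (?t j) n" by (simp add: app_fswap)
      then show "(#) (app (?t i)) ` ?L r (- ?t i + a) \<inter> (#) (app (?t j)) ` ?L r (- ?t j + a) = {}"
        by auto
    qed
  qed (use fin in auto)
  moreover have "card ((#) (app (?t j)) ` ?L r (- ?t j + a)) = card (?L r (- ?t j + a))" for j
    by (rule card_image) simp
  ultimately have "card (?L (Suc r) a) = (\<Sum>j\<in>{1..<n}. card (?L r (- ?t j + a)))"
    by (simp only: union)
  then have "of_nat (card (?L (Suc r) a)) = (\<Sum>j\<in>{1..<n}. coef (jm n ^ r) (- ?t j + a))"
    by (simp only: of_nat_sum Suc.IH)
  also have "\<dots> = coef (jm n ^ Suc r) a"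
    by (simp add: jm_def sum_distrib_right lookup_sum lookup_grp_mult)
  finally show ?case .
qed

section \<open>Marked classes\<close>

lemma finite_marked_partitions: "finite (marked_partitions n)"
proof (rule finite_subset)
  have le: "size \<mu> \<le> \<Sum>\<^sub># \<mu>" if "0 \<notin># \<mu>" for \<mu> :: "nat multiset"
    using that by (induction \<mu>) (auto simp: Suc_le_eq)
  have mem: "k \<le> \<Sum>\<^sub># \<mu>" if "k \<in># \<mu>" for k and \<mu> :: "nat multiset"
    using that by (auto dest: multi_member_split)
  show "marked_partitions n \<subseteq> (\<Union>k\<le>n. {\<mu>. set_mset \<mu> \<subseteq> {..n} \<and> size \<mu> = k}) \<times> {..n}"
    using le mem by (auto simp: marked_partitions_def partition_of_def)
  have "finite {\<mu>. set_mset \<mu> \<subseteq> {..n} \<and> size \<mu> = k}" for k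
    using finite_multisets_of_size[of "{..n}" k] by (simp add: multisets_of_size_def)
  then show "finite ((\<Union>k\<le>n. {\<mu>. set_mset \<mu> \<subseteq> {..n} \<and> size \<mu> = k}) \<times> {..n})" by auto
qed

lemma permutation_orbit_eq_iff:
  assumes "permutation \<sigma>"
  shows "orbit \<sigma> x = orbit \<sigma> y \<longleftrightarrow> x \<in> orbit \<sigma> y"
  using assms by (metis cyclic_on_orbit' orbit_cyclic_eq3 permutation_self_in_orbit)

lemma cycle_type_partition:
  assumes "\<sigma> permutes {1..n}"
  shows "cycle_type n \<sigma> \<turnstile> n"
proof -
  let ?C = "orbit \<sigma> ` {1..n}"
  have perm: "permutation \<sigma>" using assms permutation_permutes by blast
  have fin: "finite (orbit \<sigma> x)" for x
    using perm by (simp add: finite_orbit permutation_self_in_orbit)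
  have "\<Union>?C = {1..n}"
    using permutes_orbit_subset[OF assms] permutation_self_in_orbit[OF perm] by blast
  moreover have "pairwise disjnt ?C"
    unfolding pairwise_def disjnt_iff using permutation_orbit_eq_iff[OF perm] by blast
  moreover have "finite A" if "A \<in> ?C" for A using that fin by auto
  ultimately have "sum card ?C = n"
    using card_Union_disjoint[of ?C] by simp
  then have "\<Sum>\<^sub># (cycle_type n \<sigma>) = n"
    by (simp add: cycle_type_def sum_unfold_sum_mset)
  moreover have "0 \<notin># cycle_type n \<sigma>"
    using fin orbit_nonempty[of \<sigma>] by (auto simp: cycle_type_def)
  ultimately show ?thesis by (simp add: partition_of_def)
qed

lemma marked_class_exists:
  assumes "\<sigma> permutes {1..n}" "n \<ge> 1"
  shows "(cycle_type n \<sigma>, card (orbit \<sigma> n)) \<in> marked_partitions n"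
  using cycle_type_partition[OF assms(1)] assms(2)
  by (auto simp: marked_partitions_def cycle_type_def)

lemma finite_marked_class: "finite (marked_class n \<mu> j)"
  by (rule finite_subset[of _ "carrier (sym_group n)"])
    (auto simp: marked_class_def carrier_sym_group finite_permutations)

lemma class_sum_eq: "class_sum n \<mu> j = (\<lambda>\<sigma>. if \<sigma> \<in> marked_class n \<mu> j then 1 else 0)"
proof -
  have "class_sum n \<mu> j = (\<lambda>\<sigma>. \<Sum>\<tau>\<in>marked_class n \<mu> j. of_perm \<tau> \<sigma>)"
    unfolding class_sum_def
    by (rule finsum_sym_alg[OF finite_marked_class]) (auto simp: sym_alg_def of_perm_def marked_class_def)
  then show ?thesis by (simp add: of_perm_def finite_marked_class)
qed

text \<open>Each permutation lies in exactly one marked class, and only the index of that class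
  contributes at it.\<close>

lemma class_sum_combination:
  assumes "n \<ge> 1"
  shows "(\<Oplus>\<^bsub>sym_alg n\<^esub>p\<in>marked_partitions n. a p \<odot>\<^bsub>sym_alg n\<^esub> class_sum n (fst p) (snd p)) =
    (\<lambda>\<sigma>. if \<sigma> \<in> carrier (sym_group n) then a (cycle_type n \<sigma>, card (orbit \<sigma> n)) else 0)"
proof -
  have "(\<Oplus>\<^bsub>sym_alg n\<^esub>p\<in>marked_partitions n. a p \<odot>\<^bsub>sym_alg n\<^esub> class_sum n (fst p) (snd p)) =
      (\<lambda>\<sigma>. \<Sum>p\<in>marked_partitions n. (a p \<odot>\<^bsub>sym_alg n\<^esub> class_sum n (fst p) (snd p)) \<sigma>)"
    by (rule finsum_sym_alg[OF finite_marked_partitions])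
      (auto simp: sym_alg_def class_sum_eq marked_class_def)
  also have "\<dots> = (\<lambda>\<sigma>. if \<sigma> \<in> carrier (sym_group n) then a (cycle_type n \<sigma>, card (orbit \<sigma> n)) else 0)"
  proof
    fix \<sigma>
    let ?q = "(cycle_type n \<sigma>, card (orbit \<sigma> n))"
    have "(\<Sum>p\<in>marked_partitions n. (a p \<odot>\<^bsub>sym_alg n\<^esub> class_sum n (fst p) (snd p)) \<sigma>) =
        (\<Sum>p\<in>marked_partitions n. if p = ?q then if \<sigma> \<in> carrier (sym_group n) then a ?q else 0 else 0)"
      by (rule sum.cong) (auto simp: sym_alg_def class_sum_eq marked_class_def)
    also have "\<dots> = (if \<sigma> \<in> carrier (sym_group n) then a ?q else 0)"
      using marked_class_exists[OF _ assms] finite_marked_partitions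
      by (auto simp: carrier_sym_group)
    finally show "(\<Sum>p\<in>marked_partitions n. (a p \<odot>\<^bsub>sym_alg n\<^esub> class_sum n (fst p) (snd p)) \<sigma>) =
      (if \<sigma> \<in> carrier (sym_group n) then a ?q else 0)" .
  qed
  finally show ?thesis .
qed

text \<open>A function constant on marked classes expands with its own values as coefficients. The
  class of \<open>\<pi>\<close> is nonempty, so evaluating any expansion at \<open>\<pi>\<close>
  pins down the coefficient.\<close>

lemma K_coeff_eq_value:
  assumes n: "n \<ge> 1" and g: "g \<in> carrier (sym_alg n)" and pi: "\<pi> \<in> marked_class n lam i"
    and const: "\<And>\<mu> j \<sigma> \<tau>. \<sigma> \<in> marked_class n \<mu> j \<Longrightarrow> \<tau> \<in> marked_class n \<mu> j \<Longrightarrow> g \<sigma> = g \<tau>"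
  shows "K_coeff n lam i g = g \<pi>"
  unfolding K_coeff_def class_sum_combination[OF n]
proof (rule the_equality)
  \<comment> \<open>On an empty class the chosen value is arbitrary, but that class sum is
    0.\<close>
  let ?a = "\<lambda>(\<mu>, j). g (SOME \<sigma>. \<sigma> \<in> marked_class n \<mu> j)"
  have pick: "g (SOME \<tau>. \<tau> \<in> marked_class n \<mu> j) = g \<sigma>" if "\<sigma> \<in> marked_class n \<mu> j" for \<sigma> \<mu> j
    using const[OF someI[of "\<lambda>\<tau>. \<tau> \<in> marked_class n \<mu> j", OF that] that] .
  have "g = (\<lambda>\<sigma>. if \<sigma> \<in> carrier (sym_group n) then ?a (cycle_type n \<sigma>, card (orbit \<sigma> n)) else 0)"
  proof
    fix \<sigma>
    show "g \<sigma> = (if \<sigma> \<in> carrier (sym_group n) then ?a (cycle_type n \<sigma>, card (orbit \<sigma> n)) else 0)"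
      using g pick[of \<sigma> "cycle_type n \<sigma>" "card (orbit \<sigma> n)"]
      by (auto simp: sym_alg_def marked_class_def)
  qed
  moreover have "g \<pi> = ?a (lam, i)" using pick[OF pi] by simp
  ultimately show "\<exists>a. g \<pi> = a (lam, i) \<and>
    g = (\<lambda>\<sigma>. if \<sigma> \<in> carrier (sym_group n) then a (cycle_type n \<sigma>, card (orbit \<sigma> n)) else 0)" by blast
next
  fix c assume "\<exists>a. c = a (lam, i) \<and>
    g = (\<lambda>\<sigma>. if \<sigma> \<in> carrier (sym_group n) then a (cycle_type n \<sigma>, card (orbit \<sigma> n)) else 0)"
  then obtain a where "c = a (lam, i)"
    "g = (\<lambda>\<sigma>. if \<sigma> \<in> carrier (sym_group n) then a (cycle_type n \<sigma>, card (orbit \<sigma> n)) else 0)" by blast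
  then show "c = g \<pi>" using pi by (simp add: marked_class_def)
qed

section \<open>Conjugacy within a marked class\<close>

lemma bij_betw_of_image_mset_eq:
  assumes "finite A" "finite B" "image_mset f (mset_set A) = image_mset g (mset_set B)"
  shows "\<exists>h. bij_betw h A B \<and> (\<forall>x\<in>A. g (h x) = f x)"
  using assms
proof (induction A arbitrary: B rule: finite_induct)
  case empty
  then have "B = {}" by (simp add: mset_set_empty_iff)
  then show ?case by (simp add: bij_betw_def)
next
  case (insert a A)
  have "f a \<in># image_mset g (mset_set B)"
    using insert.prems(2) insert.hyps by (metis image_mset_add_mset mset_set.insert union_single_eq_member)
  then obtain b where b: "b \<in> B" "g b = f a" using insert.prems(1) by auto
  define B' where "B' = B - {b}"
  have B: "B = insert b B'" "b \<notin> B'" "finite B'" using b insert.prems(1) by (auto simp: B'_def)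
  have "image_mset f (mset_set A) = image_mset g (mset_set B')"
    using insert.prems(2) insert.hyps b(2) B(2,3) unfolding B(1) by simp
  from insert.IH[OF B(3) this] obtain h where h: "bij_betw h A B'" "\<forall>x\<in>A. g (h x) = f x" by blast
  let ?h = "h(a := b)"
  have "bij_betw ?h A B'" using h(1) insert.hyps by (subst bij_betw_cong[of A ?h h]) auto
  then have "bij_betw ?h (A \<union> {a}) (B' \<union> {?h a})"
    using insert.hyps B by (intro notIn_Un_bij_betw) auto
  then have "bij_betw ?h (insert a A) B" by (simp add: B(1))
  moreover have "\<forall>x\<in>insert a A. g (?h x) = f x" using h(2) b insert.hyps by auto
  ultimately show ?case by blast
qed

text \<open>Cancelling \<open>k\<close> steps leaves a return to \<open>b\<close>, which happens
  exactly at multiples of the least period, the orbit size.\<close>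

lemma funpow_eq_iff_dvd:
  assumes "permutation \<sigma>" "k \<le> m"
  shows "(\<sigma> ^^ k) b = (\<sigma> ^^ m) b \<longleftrightarrow> card (orbit \<sigma> b) dvd m - k"
proof -
  have "orbit \<sigma> b = set (support \<sigma> b)"
    using support_set[OF assms(1), of b] orbit_altdef_permutation[OF assms(1), of b] by auto
  then have card: "card (orbit \<sigma> b) = least_power \<sigma> b"
    using distinct_card[OF cycle_of_permutation[OF assms(1), of b]] by simp
  have "inj (\<sigma> ^^ k)" using assms(1) by (simp add: permutation_bijective bij_is_inj inj_fn)
  moreover have "(\<sigma> ^^ m) b = (\<sigma> ^^ k) ((\<sigma> ^^ (m - k)) b)"
    using assms(2) by (metis comp_apply funpow_add le_add_diff_inverse)
  ultimately have "(\<sigma> ^^ k) b = (\<sigma> ^^ m) b \<longleftrightarrow> (\<sigma> ^^ (m - k)) b = b"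
    by (metis injD)
  then show ?thesis using least_power_dvd[OF assms(1), of b "m - k"] card by simp
qed

lemma funpow_eq_transfer:
  assumes "permutation \<sigma>" "permutation \<tau>" "card (orbit \<sigma> b) = card (orbit \<tau> c)"
  shows "(\<sigma> ^^ k) b = (\<sigma> ^^ m) b \<longleftrightarrow> (\<tau> ^^ k) c = (\<tau> ^^ m) c"
proof -
  have *: "(\<sigma> ^^ k) b = (\<sigma> ^^ m) b \<longleftrightarrow> (\<tau> ^^ k) c = (\<tau> ^^ m) c" if "k \<le> m" for k m
    using funpow_eq_iff_dvd[OF assms(1) that] funpow_eq_iff_dvd[OF assms(2) that] assms(3) by simp
  show ?thesis using *[of k m] *[of m k] by (cases "k \<le> m") (auto simp: eq_commute)
qed

text \<open>The two orbits of \<open>n\<close> have equal size and are matched to each other;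
  removing them leaves equal multisets of sizes for the other cycles.\<close>

lemma marked_class_orbit_bij:
  assumes n: "n \<ge> 1" and \<sigma>: "\<sigma> \<in> marked_class n \<mu> j" and \<tau>: "\<tau> \<in> marked_class n \<mu> j"
  obtains h where "bij_betw h (orbit \<sigma> ` {1..n}) (orbit \<tau> ` {1..n})"
    "\<And>A. A \<in> orbit \<sigma> ` {1..n} \<Longrightarrow> card (h A) = card A"
    "h (orbit \<sigma> n) = orbit \<tau> n"
proof -
  define A where "A = orbit \<sigma> ` {1..n} - {orbit \<sigma> n}"
  define B where "B = orbit \<tau> ` {1..n} - {orbit \<tau> n}"
  have A: "orbit \<sigma> ` {1..n} = insert (orbit \<sigma> n) A" "orbit \<sigma> n \<notin> A" "finite A"
    using n by (auto simp: A_def)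
  have B: "orbit \<tau> ` {1..n} = insert (orbit \<tau> n) B" "orbit \<tau> n \<notin> B" "finite B"
    using n by (auto simp: B_def)
  have card_n: "card (orbit \<sigma> n) = card (orbit \<tau> n)"
    and type: "cycle_type n \<sigma> = cycle_type n \<tau>"
    using \<sigma> \<tau> by (auto simp: marked_class_def)
  have "image_mset card (mset_set A) = image_mset card (mset_set B)"
    using type card_n A(2,3) B(2,3) unfolding cycle_type_def A(1) B(1) by simp
  from bij_betw_of_image_mset_eq[OF A(3) B(3) this] obtain h where
    h: "bij_betw h A B" "\<forall>x\<in>A. card (h x) = card x" by blast
  let ?h = "h(orbit \<sigma> n := orbit \<tau> n)"
  have "bij_betw ?h A B" using h(1) A(2) by (subst bij_betw_cong[of A ?h h]) auto
  then have "bij_betw ?h (A \<union> {orbit \<sigma> n}) (B \<union> {?h (orbit \<sigma> n)})"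
    using A B by (intro notIn_Un_bij_betw) auto
  then have "bij_betw ?h (orbit \<sigma> ` {1..n}) (orbit \<tau> ` {1..n})"
    unfolding A(1) B(1) by simp
  moreover have "card (?h X) = card X" if "X \<in> orbit \<sigma> ` {1..n}" for X
    using that h(2) card_n unfolding A(1) by auto
  ultimately show ?thesis using that[of ?h] by simp
qed

text \<open>Cycles of equal length are laid over each other from chosen base points. In the cycles
  of \<open>n\<close> the base point is \<open>n\<close> itself, so the conjugating permutation
  fixes \<open>n\<close>.\<close>

lemma marked_class_conjugate:
  assumes n: "n \<ge> 1" and \<sigma>: "\<sigma> \<in> marked_class n \<mu> j" and \<tau>: "\<tau> \<in> marked_class n \<mu> j"
  shows "\<exists>\<rho>. \<rho> permutes {1..n} \<and> \<rho> n = n \<and> \<rho> \<circ> \<sigma> = \<tau> \<circ> \<rho>"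
proof -
  have ps: "\<sigma> permutes {1..n}" and pt: "\<tau> permutes {1..n}"
    using \<sigma> \<tau> by (auto simp: marked_class_def carrier_sym_group)
  then have perm: "permutation \<sigma>" "permutation \<tau>" using permutation_permutes by blast+
  from marked_class_orbit_bij[OF assms] obtain h where
    h: "bij_betw h (orbit \<sigma> ` {1..n}) (orbit \<tau> ` {1..n})"
    "\<And>A. A \<in> orbit \<sigma> ` {1..n} \<Longrightarrow> card (h A) = card A"
    "h (orbit \<sigma> n) = orbit \<tau> n" by blast
  define base where "base A = (if n \<in> A then n else SOME x. x \<in> A)" for A
  have base_in: "base A \<in> A" if "A \<noteq> {}" for A
    using that by (auto simp: base_def some_in_eq)
  define b where "b x = base (orbit \<sigma> x)" for x
  define c where "c x = base (h (orbit \<sigma> x))" for x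
  have b: "orbit \<sigma> (b x) = orbit \<sigma> x" for x
    unfolding permutation_orbit_eq_iff[OF perm(1)] b_def by (rule base_in[OF orbit_nonempty])
  have hx: "h (orbit \<sigma> x) \<in> orbit \<tau> ` {1..n}" if "x \<in> {1..n}" for x
    using h(1) that unfolding bij_betw_def by blast
  have c: "orbit \<tau> (c x) = h (orbit \<sigma> x)" if "x \<in> {1..n}" for x
  proof -
    obtain y where y: "h (orbit \<sigma> x) = orbit \<tau> y" using hx[OF \<open>x \<in> {1..n}\<close>] by blast
    have "c x \<in> orbit \<tau> y" unfolding c_def y by (rule base_in[OF orbit_nonempty])
    then show ?thesis unfolding y permutation_orbit_eq_iff[OF perm(2)] .
  qed
  have transfer: "(\<sigma> ^^ k) (b x) = (\<sigma> ^^ m) (b x) \<longleftrightarrow> (\<tau> ^^ k) (c x) = (\<tau> ^^ m) (c x)"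
    if "x \<in> {1..n}" for x k m
    by (rule funpow_eq_transfer[OF perm]) (use b c[OF that] h(2) that in auto)
  \<comment> \<open>This exponent is determined only modulo the cycle length; as matched cycles have
    the same length, \<open>transfer\<close> compares different exponents on both sides.\<close>
  define K where "K x = (SOME k. (\<sigma> ^^ k) (b x) = x)" for x
  have K: "(\<sigma> ^^ K x) (b x) = x" for x
  proof -
    have "x \<in> orbit \<sigma> (b x)" unfolding b by (rule permutation_self_in_orbit[OF perm(1)])
    then obtain k where "x = (\<sigma> ^^ k) (b x)"
      unfolding orbit_altdef_permutation[OF perm(1)] by blast
    from someI[of "\<lambda>k. (\<sigma> ^^ k) (b x) = x", OF this[symmetric]] show ?thesis unfolding K_def .
  qed
  define \<rho> where "\<rho> x = (if x \<in> {1..n} then (\<tau> ^^ K x) (c x) else x)" for x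
  have \<rho>_orbit: "orbit \<tau> (\<rho> x) = h (orbit \<sigma> x)" if "x \<in> {1..n}" for x
  proof -
    have "\<rho> x \<in> orbit \<tau> (c x)"
      using that orbit_altdef_permutation[OF perm(2)] by (auto simp: \<rho>_def)
    then have "orbit \<tau> (\<rho> x) = orbit \<tau> (c x)"
      unfolding permutation_orbit_eq_iff[OF perm(2)] .
    then show ?thesis using c[OF that] by simp
  qed
  have maps: "\<rho> x \<in> {1..n}" if x: "x \<in> {1..n}" for x
  proof -
    obtain y where y: "y \<in> {1..n}" "h (orbit \<sigma> x) = orbit \<tau> y" using hx[OF x] by blast
    have "\<rho> x \<in> orbit \<tau> y"
      using \<rho>_orbit[OF x] y(2) permutation_orbit_eq_iff[OF perm(2)] by simp
    then show ?thesis using permutes_orbit_subset[OF pt y(1)] by blast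
  qed
  have inj: "inj_on \<rho> {1..n}"
  proof (rule inj_onI)
    fix x y assume xy: "x \<in> {1..n}" "y \<in> {1..n}" "\<rho> x = \<rho> y"
    then have "h (orbit \<sigma> x) = h (orbit \<sigma> y)" using \<rho>_orbit by metis
    then have orb: "orbit \<sigma> x = orbit \<sigma> y"
      using h(1) xy unfolding bij_betw_def by (meson image_eqI inj_onD)
    then have "b x = b y" "c x = c y" by (simp_all add: b_def c_def)
    then have "(\<tau> ^^ K x) (c x) = (\<tau> ^^ K y) (c x)" using xy by (simp add: \<rho>_def)
    then have "(\<sigma> ^^ K x) (b x) = (\<sigma> ^^ K y) (b x)" using transfer[OF xy(1)] by blast
    then show "x = y" using K \<open>b x = b y\<close> by metis
  qed
  have "\<rho> ` {1..n} = {1..n}" using inj maps by (intro endo_inj_surj) auto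
  then have perm_\<rho>: "\<rho> permutes {1..n}"
    using inj by (intro bij_imp_permutes) (auto simp: bij_betw_def \<rho>_def)
  have "(\<sigma> ^^ K n) (b n) = (\<sigma> ^^ 0) (b n)"
    using K[of n] permutation_self_in_orbit[OF perm(1), of n] by (simp add: b_def base_def)
  then have "(\<tau> ^^ K n) (c n) = (\<tau> ^^ 0) (c n)" using transfer[of n "K n" 0] n by simp
  then have "\<rho> n = n"
    using n h(3) permutation_self_in_orbit[OF perm(2), of n] by (simp add: \<rho>_def c_def base_def)
  moreover have "\<rho> (\<sigma> x) = \<tau> (\<rho> x)" for x
  proof (cases "x \<in> {1..n}")
    case True
    then have in': "\<sigma> x \<in> {1..n}" using permutes_in_image[OF ps] by blast
    have "orbit \<sigma> (\<sigma> x) = orbit \<sigma> x" by (rule permutation_orbit_step[OF perm(1)])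
    then have bc: "b (\<sigma> x) = b x" "c (\<sigma> x) = c x" by (simp_all add: b_def c_def)
    have "(\<sigma> ^^ K (\<sigma> x)) (b x) = (\<sigma> ^^ Suc (K x)) (b x)" using K[of "\<sigma> x"] K[of x] bc by simp
    then have "(\<tau> ^^ K (\<sigma> x)) (c x) = (\<tau> ^^ Suc (K x)) (c x)" using transfer[OF True] by blast
    then show ?thesis using True in' bc by (simp add: \<rho>_def del: atLeastAtMost_iff)
  next
    case False
    then show ?thesis using permutes_not_in[OF ps False] permutes_not_in[OF pt False] by (simp add: \<rho>_def del: atLeastAtMost_iff)
  qed
  then have "\<rho> \<circ> \<sigma> = \<tau> \<circ> \<rho>" by auto
  ultimately show ?thesis using perm_\<rho> by blast
qed

lemma lookup_mult_grp: "coef (x * grp b) a = coef x (a + - b)"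
proof -
  have "coef (x * grp b) a = tr (x * grp b * grp (- a))" by (simp add: tr_mult_grp)
  also have "\<dots> = tr (x * grp (b + - a))" by (simp only: grp_plus mult.assoc)
  also have "\<dots> = coef x (- (b + - a))" by (rule tr_mult_grp)
  also have "- (b + - a) = a + - b" by (simp only: minus_add minus_minus)
  finally show ?thesis .
qed

text \<open>The two permutations are conjugate by some \<open>p\<close> fixing \<open>n + 1\<close>,
  with which \<open>x\<close> commutes; compare coefficients in
  \<open>x * grp p = grp p * x\<close>.\<close>

lemma ev_const_on_marked_class:
  assumes x: "x \<in> An (Suc n)" and comm: "\<And>y. y \<in> An n \<Longrightarrow> x * y = y * x"
    and "\<sigma> \<in> marked_class (Suc n) \<mu> j" "\<tau> \<in> marked_class (Suc n) \<mu> j"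
  shows "ev x \<sigma> = ev x \<tau>"
proof -
  from marked_class_conjugate[OF _ assms(3,4)] obtain \<rho> where
    \<rho>: "\<rho> permutes {1..Suc n}" "\<rho> (Suc n) = Suc n" "\<rho> \<circ> \<sigma> = \<tau> \<circ> \<rho>" by auto
  obtain a b where ab: "\<sigma> = app a" "\<tau> = app b"
    using assms(3,4) by (auto simp: marked_class_def carrier_sym_group_app)
  define p where "p = Fperm \<rho>"
  have p: "app p = \<rho>" "p \<in> Sn (Suc n)" using \<rho>(1) by (simp_all add: p_def app_Fperm Fperm_in_Sn)
  then have "p \<in> Sn n" using Sn_Suc_fixing[of p n] \<rho>(2) by simp
  then have "x * grp p = grp p * x" by (intro comm) simp
  moreover have "p + a = b + p"
    by (rule fperm_eqI) (use fun_cong[OF \<rho>(3)] in \<open>simp add: p ab\<close>)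
  ultimately have "coef (x * grp p) (b + p) = coef (grp p * x) (p + a)"
    by simp
  then have "coef x b = coef x a"
    by (simp only: lookup_mult_grp lookup_grp_mult add.assoc right_minus add_0_right) simp
  then show ?thesis by (simp add: ab)
qed

lemma K_coeff_ev:
  assumes "x \<in> An (Suc n)" "\<And>y. y \<in> An n \<Longrightarrow> x * y = y * x" "\<pi> \<in> marked_class (Suc n) lam i"
  shows "K_coeff (Suc n) lam i (ev x) = ev x \<pi>"
proof (rule K_coeff_eq_value)
  show "ev x \<sigma> = ev x \<tau>" if "\<sigma> \<in> marked_class (Suc n) \<mu> j" "\<tau> \<in> marked_class (Suc n) \<mu> j" for \<mu> j \<sigma> \<tau>
    by (rule ev_const_on_marked_class[OF assms(1,2) that])
qed (use assms in \<open>auto simp: ev_carrier\<close>)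

section \<open>Standard tableaux from lattice words\<close>

definition add_entry :: "nat \<Rightarrow> nat \<Rightarrow> tableau \<Rightarrow> tableau" where
  "add_entry r m T = (if r < length T then T[r := T ! r @ [m]] else T @ [[m]])"

primrec tab :: "nat list \<Rightarrow> tableau" where
  "tab [] = []"
| "tab (r # w) = add_entry r (Suc (length w)) (tab w)"

text \<open>Row lengths are continued by 0 so that they can be compared with
  \<open>count_list w\<close> as functions.\<close>

definition row_len :: "tableau \<Rightarrow> nat \<Rightarrow> nat" where
  "row_len T i = (if i < length T then length (T ! i) else 0)"

lemma row_len_add_entry:
  "r \<le> length T \<Longrightarrow> row_len (add_entry r m T) i = row_len T i + (if i = r then 1 else 0)"
  by (auto simp: row_len_def add_entry_def nth_append)

lemma add_entry_nonempty: "[] \<notin> set T \<Longrightarrow> [] \<notin> set (add_entry r m T)"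
  by (auto simp: add_entry_def dest: set_update_subset_insert[THEN subsetD])

lemma row_len_pos_iff: "[] \<notin> set T \<Longrightarrow> 0 < row_len T i \<longleftrightarrow> i < length T"
  by (auto simp: row_len_def in_set_conv_nth)

lemma addable_le_length:
  assumes "[] \<notin> set T" "addable (row_len T) r"
  shows "r \<le> length T"
proof (cases "r = 0")
  case False
  then have "0 < row_len T (r - 1)" using assms(2) by (simp add: addable_def)
  then show ?thesis using row_len_pos_iff[OF assms(1)] by fastforce
qed simp

lemma tab_shape:
  assumes "yam w"
  shows "[] \<notin> set (tab w)" "row_len (tab w) = count_list w"
proof -
  have "[] \<notin> set (tab w) \<and> row_len (tab w) = count_list w" using assms
  proof (induction w)
    case Nil
    then show ?case by (simp add: row_len_def fun_eq_iff)
  next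
    case (Cons r w)
    then have IH: "[] \<notin> set (tab w)" "row_len (tab w) = count_list w" "addable (row_len (tab w)) r"
      by auto
    then show ?case
      using addable_le_length[OF IH(1,3)] by (auto simp: row_len_add_entry add_entry_nonempty fun_eq_iff)
  qed
  then show "[] \<notin> set (tab w)" "row_len (tab w) = count_list w" by auto
qed

lemma tab_addable_le: "yam (r # w) \<Longrightarrow> r \<le> length (tab w)"
  using addable_le_length[of "tab w" r] tab_shape[of w] by simp

lemma tab_nth:
  assumes "yam w" "x \<in> {1..length w}"
  shows "row_of w x < length (tab w)" "col_of w x < length (tab w ! row_of w x)"
    "tab w ! row_of w x ! col_of w x = x"
proof -
  have cell: "col_of w x < row_len (tab w) (row_of w x)"
    using filling_cell[OF yam_filling[OF assms(1)] assms(2)] tab_shape(2)[OF assms(1)] by simp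
  then show "row_of w x < length (tab w)" "col_of w x < length (tab w ! row_of w x)"
    by (auto simp: row_len_def split: if_splits)
  show "tab w ! row_of w x ! col_of w x = x" using assms
  proof (induction w)
    case (Cons r w)
    have r: "r \<le> length (tab w)" using Cons.prems tab_addable_le by blast
    show ?case
    proof (cases "x = Suc (length w)")
      case True
      have "count_list w r = row_len (tab w) r" using Cons.prems tab_shape(2)[of w] by simp
      then show ?thesis using True r by (auto simp: add_entry_def row_len_def nth_append)
    next
      case False
      then have x: "x \<in> {1..length w}" and yw: "yam w" using Cons.prems by auto
      have "col_of w x < row_len (tab w) (row_of w x)"
        using filling_cell[OF yam_filling[OF yw] x] tab_shape(2)[OF yw] by simp
      then show ?thesis using Cons.IH[OF yw x] False r
        by (auto simp: add_entry_def row_len_def nth_append nth_list_update split: if_splits)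
    qed
  qed simp
qed

lemma tab_entry_cell:
  assumes "yam w" "i < length (tab w)" "c < length (tab w ! i)"
  shows "tab w ! i ! c \<in> {1..length w}" "row_of w (tab w ! i ! c) = i" "col_of w (tab w ! i ! c) = c"
proof -
  have "(i, c) \<in> {(i, c). c < count_list w i}"
    using assms tab_shape(2)[OF assms(1)] by (auto simp: row_len_def fun_eq_iff split: if_splits)
  then have "(i, c) \<in> (\<lambda>x. (row_of w x, col_of w x)) ` {1..length w}"
    using bij_betw_cells[of w] unfolding bij_betw_def by simp
  then obtain x where x: "x \<in> {1..length w}" "row_of w x = i" "col_of w x = c" by auto
  then have "tab w ! i ! c = x" using tab_nth(3)[OF assms(1) x(1)] by simp
  then show "tab w ! i ! c \<in> {1..length w}" "row_of w (tab w ! i ! c) = i" "col_of w (tab w ! i ! c) = c"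
    using x by auto
qed

lemma set_tab_row:
  assumes "yam w" "i < length (tab w)"
  shows "set (tab w ! i) = {x \<in> {1..length w}. row_of w x = i}"
proof
  show "set (tab w ! i) \<subseteq> {x \<in> {1..length w}. row_of w x = i}"
    using tab_entry_cell[OF assms] by (fastforce simp: in_set_conv_nth)
  show "{x \<in> {1..length w}. row_of w x = i} \<subseteq> set (tab w ! i)"
  proof
    fix x assume "x \<in> {x \<in> {1..length w}. row_of w x = i}"
    then have x: "x \<in> {1..length w}" "row_of w x = i" by auto
    then show "x \<in> set (tab w ! i)" using tab_nth[OF assms(1) x(1)] nth_mem by metis
  qed
qed

lemma tab_column:
  assumes "yam w"
  shows "tableau_column (tab w) c = {x \<in> {1..length w}. col_of w x = c}"
proof
  show "tableau_column (tab w) c \<subseteq> {x \<in> {1..length w}. col_of w x = c}"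
    using tab_entry_cell[OF assms] by (fastforce simp: tableau_column_def)
  show "{x \<in> {1..length w}. col_of w x = c} \<subseteq> tableau_column (tab w) c"
  proof
    fix x assume "x \<in> {x \<in> {1..length w}. col_of w x = c}"
    then have x: "x \<in> {1..length w}" "col_of w x = c" by auto
    show "x \<in> tableau_column (tab w) c"
      unfolding tableau_column_def using tab_nth[OF assms x(1)] x(2) by (auto intro!: exI[of _ "row_of w x"])
  qed
qed

section \<open>Row and column stabilizers of a tableau\<close>

lemma level_sets_preserved_iff:
  fixes n :: nat
  assumes "\<sigma> permutes {1..n}"
  shows "(\<forall>i. \<sigma> ` {x \<in> {1..n}. f x = i} = {x \<in> {1..n}. f x = i}) \<longleftrightarrow> (\<forall>x\<in>{1..n}. f (\<sigma> x) = f x)"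
proof
  assume *: "\<forall>i. \<sigma> ` {x \<in> {1..n}. f x = i} = {x \<in> {1..n}. f x = i}"
  show "\<forall>x\<in>{1..n}. f (\<sigma> x) = f x"
  proof
    fix x assume "x \<in> {1..n}"
    then have "\<sigma> x \<in> \<sigma> ` {y \<in> {1..n}. f y = f x}" by auto
    then show "f (\<sigma> x) = f x" using * by auto
  qed
next
  assume *: "\<forall>x\<in>{1..n}. f (\<sigma> x) = f x"
  show "\<forall>i. \<sigma> ` {x \<in> {1..n}. f x = i} = {x \<in> {1..n}. f x = i}"
  proof
    fix i
    show "\<sigma> ` {x \<in> {1..n}. f x = i} = {x \<in> {1..n}. f x = i}"
    proof (rule endo_inj_surj)
      show "\<sigma> ` {x \<in> {1..n}. f x = i} \<subseteq> {x \<in> {1..n}. f x = i}"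
        using * permutes_in_image[OF assms] by blast
      show "inj_on \<sigma> {x \<in> {1..n}. f x = i}" using permutes_inj_on[OF assms] .
      show "finite {x \<in> {1..n}. f x = i}" by (rule finite_subset[of _ "{1..n}"]) auto
    qed
  qed
qed

lemma app_stab_eq:
  "{\<sigma> \<in> carrier (sym_group n). \<forall>i. \<sigma> ` {x \<in> {1..n}. f x = i} = {x \<in> {1..n}. f x = i}} = app ` stab n f"
proof -
  have "{\<sigma> \<in> carrier (sym_group n). \<forall>i. \<sigma> ` {x \<in> {1..n}. f x = i} = {x \<in> {1..n}. f x = i}} =
      {\<sigma> \<in> carrier (sym_group n). \<forall>x\<in>{1..n}. f (\<sigma> x) = f x}"
    by (rule Collect_cong, rule conj_cong[OF refl], rule level_sets_preserved_iff)
      (simp add: carrier_sym_group)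
  also have "\<dots> = app ` stab n f" unfolding carrier_sym_group_app stab_def by blast
  finally show ?thesis .
qed

lemma row_stabilizer_tab:
  assumes "yam w"
  shows "row_stabilizer (length w) (tab w) = app ` stab (length w) (row_of w)"
proof -
  let ?n = "length w"
  have "(\<forall>row\<in>set (tab w). \<sigma> ` set row = set row) \<longleftrightarrow>
      (\<forall>i. \<sigma> ` {x \<in> {1..?n}. row_of w x = i} = {x \<in> {1..?n}. row_of w x = i})" for \<sigma> :: "nat \<Rightarrow> nat"
  proof -
    have "(\<forall>row\<in>set (tab w). \<sigma> ` set row = set row) \<longleftrightarrow>
        (\<forall>i<length (tab w). \<sigma> ` set (tab w ! i) = set (tab w ! i))"
      by (simp add: all_set_conv_all_nth)
    also have "\<dots> \<longleftrightarrow> (\<forall>i<length (tab w). \<sigma> ` {x \<in> {1..?n}. row_of w x = i} = {x \<in> {1..?n}. row_of w x = i})"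
      using set_tab_row[OF assms] by simp
    also have "\<dots> \<longleftrightarrow> (\<forall>i. \<sigma> ` {x \<in> {1..?n}. row_of w x = i} = {x \<in> {1..?n}. row_of w x = i})"
    proof -
      have "\<sigma> ` {x \<in> {1..?n}. row_of w x = i} = {x \<in> {1..?n}. row_of w x = i}"
        if "\<not> i < length (tab w)" for i
      proof -
        have none: "{x \<in> {1..?n}. row_of w x = i} = {}" using tab_nth(1)[OF assms] that by blast
        show ?thesis unfolding none by (rule image_empty)
      qed
      then show ?thesis by blast
    qed
    finally show ?thesis .
  qed
  then show ?thesis unfolding row_stabilizer_def app_stab_eq[symmetric] by (simp only:)
qed

lemma column_stabilizer_tab:
  assumes "yam w"
  shows "column_stabilizer (length w) (tab w) = app ` stab (length w) (col_of w)"
  unfolding column_stabilizer_def tab_column[OF assms] by (rule app_stab_eq)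

lemma finsum_app:
  assumes "S \<subseteq> Sn n" "\<And>a. a \<in> S \<Longrightarrow> f (app a) = ev (h a)" "\<And>a. a \<in> S \<Longrightarrow> h a \<in> An n"
  shows "finsum (sym_alg n) f (app ` S) = ev (sum h S)"
proof -
  have fin: "finite S" using assms(1) finite_Sn finite_subset by blast
  have inj: "inj_on app S" by (simp add: inj_on_def app_inject)
  have "finsum (sym_alg n) f (app ` S) = (\<lambda>\<sigma>. \<Sum>\<tau>\<in>app ` S. f \<tau> \<sigma>)"
    using assms fin by (intro finsum_sym_alg) (auto simp: ev_carrier)
  also have "\<dots> = ev (sum h S)"
    by (simp add: sum.reindex[OF inj] ev_sum assms(2) fun_eq_iff)
  finally show ?thesis .
qed

lemma row_symmetrizer_tab:
  "yam w \<Longrightarrow> row_symmetrizer (length w) (tab w) = ev (symm (length w) (row_of w))"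
  unfolding row_symmetrizer_def row_stabilizer_tab symm_def
  using stab_subset by (intro finsum_app) (auto simp: ev_grp intro!: An_single)

lemma column_antisymmetrizer_tab:
  "yam w \<Longrightarrow> column_antisymmetrizer (length w) (tab w) = ev (antisymm (length w) (col_of w))"
  unfolding column_antisymmetrizer_def column_stabilizer_tab antisymm_def
proof (rule finsum_app[OF stab_subset])
  fix a assume "a \<in> stab (length w) (col_of w)"
  then show "cst (sgn_of a) * grp a \<in> An (length w)" by (simp add: mult_single stab_def)
  show "of_int (sign (app a)) \<odot>\<^bsub>sym_alg (length w)\<^esub> of_perm (app a) = ev (cst (sgn_of a) * grp a)"
    unfolding ev_grp[symmetric] ev_smult sgn_of_def scl_def ..
qed

section \<open>Adding and removing the largest entry\<close>

lemma remove_add_entry: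
  assumes "m \<notin> set (concat T)" "[] \<notin> set T"
  shows "remove_entry m (add_entry r m T) = T"
proof -
  have rem: "map (removeAll m) T = T"
    using assms(1) by (intro map_idI removeAll_id) auto
  have filt: "filter (\<lambda>row. row \<noteq> []) T = T" using assms(2) by (auto simp: filter_id_conv)
  show ?thesis
  proof (cases "r < length T")
    case True
    then have "m \<notin> set (T ! r)" using assms(1) by auto
    then have "map (removeAll m) (T[r := T ! r @ [m]]) = T"
      by (simp add: map_update rem)
    then show ?thesis using True filt by (simp add: remove_entry_def add_entry_def)
  next
    case False
    then show ?thesis using rem filt by (simp add: remove_entry_def add_entry_def)
  qed
qed

lemma standard_add_entry:
  assumes T: "standard_tableau n T" and add: "addable (row_len T) r"
  shows "standard_tableau (Suc n) (add_entry r (Suc n) T)"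
proof -
  have ne: "[] \<notin> set T" and sorted: "sorted_wrt (\<ge>) (map length T)"
    and dist: "distinct (concat T)" and set: "set (concat T) = {1..n}"
    and rows: "\<forall>row\<in>set T. sorted_wrt (<) row"
    and cols: "\<And>r c. Suc r < length T \<Longrightarrow> c < length (T ! Suc r) \<Longrightarrow> T ! r ! c < T ! Suc r ! c"
    using T by (auto simp: standard_tableau_def)
  have r: "r \<le> length T" using addable_le_length[OF ne add] .
  have entry: "T ! i ! c < Suc n" if "i < length T" "c < length (T ! i)" for i c
  proof -
    have "T ! i ! c \<in> set (concat T)" using that by (auto intro!: bexI[of _ "T ! i"])
    then have "T ! i ! c \<in> {1..n}" unfolding set .
    then show ?thesis by simp
  qed
  have lens: "length (T ! j) \<le> length (T ! i)" if "i < j" "j < length T" for i j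
    using sorted_wrt_nth_less[OF sorted, of i j] that by simp
  show ?thesis
  proof (cases "r < length T")
    case True
    let ?T = "T[r := T ! r @ [Suc n]]"
    have split: "T = take r T @ T ! r # drop (Suc r) T" by (rule id_take_nth_drop[OF True])
    have split': "?T = take r T @ (T ! r @ [Suc n]) # drop (Suc r) T" by (rule upd_conv_take_nth_drop[OF True])
    have "add_mset (Suc n) (mset (concat T)) =
        add_mset (Suc n) (mset (concat (take r T @ T ! r # drop (Suc r) T)))"
      by (rule arg_cong[OF split])
    also have "\<dots> = mset (concat ?T)" unfolding split' by simp
    finally have concat: "mset (concat ?T) = add_mset (Suc n) (mset (concat T))" ..
    have notin: "Suc n \<notin> set (concat T)" using set by auto
    have long: "length (T ! r) < length (T ! i)" if "i < r" for i
    proof -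
      have "length (T ! r) < length (T ! (r - 1))"
        using add that True by (auto simp: addable_def row_len_def split: if_splits)
      moreover have "length (T ! (r - 1)) \<le> length (T ! i)"
        using lens[of i "r - 1"] that True by (cases "i = r - 1") auto
      ultimately show ?thesis by simp
    qed
    have "standard_tableau (Suc n) ?T"
      unfolding standard_tableau_def
    proof (intro conjI allI impI)
      show "[] \<notin> set ?T" using ne by (auto dest: set_update_subset_insert[THEN subsetD])
      show "sorted_wrt (\<ge>) (map length ?T)"
        unfolding sorted_wrt_iff_nth_less
      proof (intro allI impI)
        fix i j assume ij: "i < j" "j < length (map length ?T)"
        then have ij': "i < length T" "j < length T" by auto
        have upd: "?T ! k = (if k = r then T ! r @ [Suc n] else T ! k)" if "k < length T" for k
          using that by (simp add: nth_list_update)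
        show "map length ?T ! i \<ge> map length ?T ! j"
          using lens[OF ij(1) ij'(2)] long[of i] ij(1) upd[OF ij'(1)] upd[OF ij'(2)] ij' by auto
      qed
      have "distinct (Suc n # concat T)" using dist notin by simp
      then show "distinct (concat ?T)" using concat by (metis mset.simps(2) mset_eq_imp_distinct_iff)
      have "set (concat ?T) = insert (Suc n) (set (concat T))"
        using concat by (metis set_mset_add_mset_insert set_mset_mset)
      then show "set (concat ?T) = {1..Suc n}" using set by auto
      have "\<forall>x\<in>set (T ! r). x < Suc n"
        using entry[OF True] by (auto simp: in_set_conv_nth)
      then show "\<forall>row\<in>set ?T. sorted_wrt (<) row"
        using rows True by (auto simp: sorted_wrt_append dest!: set_update_subset_insert[THEN subsetD])
      fix k c assume k: "Suc k < length ?T" "c < length (?T ! Suc k)"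
      show "?T ! k ! c < ?T ! Suc k ! c"
      proof (cases "Suc k = r")
        case True
        then show ?thesis
          using k cols[of k c] entry[of k c] long[of k] by (auto simp: nth_append nth_list_update)
      next
        case False
        then show ?thesis
          using k cols[of k c] lens[of k "Suc k"] \<open>r < length T\<close>
          by (auto simp: nth_append nth_list_update)
      qed
    qed
    then show ?thesis using True by (simp add: add_entry_def)
  next
    case False
    let ?T = "T @ [[Suc n]]"
    have one: "1 \<le> length row" if "row \<in> set T" for row using ne that by (cases row) auto
    have "standard_tableau (Suc n) ?T"
      unfolding standard_tableau_def
    proof (intro conjI allI impI)
      show "[] \<notin> set ?T" using ne by simp
      show "sorted_wrt (\<ge>) (map length ?T)" using sorted one by (auto simp: sorted_wrt_append)
      show "distinct (concat ?T)" "set (concat ?T) = {1..Suc n}" using dist set by auto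
      show "\<forall>row\<in>set ?T. sorted_wrt (<) row" using rows by auto
      fix k c assume k: "Suc k < length ?T" "c < length (?T ! Suc k)"
      show "?T ! k ! c < ?T ! Suc k ! c"
      proof (cases "Suc k = length T")
        case True
        then have "c = 0" "?T ! Suc k ! c = Suc n" "?T ! k = T ! k" using k by (auto simp: nth_append)
        moreover have "0 < length (T ! k)" using one[of "T ! k"] True by (simp add: Suc_le_eq)
        ultimately show ?thesis using entry[of k 0] True by simp
      next
        case False
        then show ?thesis using k cols[of k c] by (auto simp: nth_append)
      qed
    qed
    then show ?thesis using False by (simp add: add_entry_def)
  qed
qed

lemma standard_tab: "yam w \<Longrightarrow> standard_tableau (length w) (tab w)"
proof (induction w)
  case Nil
  then show ?case by (simp add: standard_tableau_def)
next
  case (Cons r w)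
  then show ?case using standard_add_entry[of "length w" "tab w" r] tab_shape(2)[of w] by simp
qed

lemma remove_entry_tab:
  assumes "yam (r # w)"
  shows "remove_entry (Suc (length w)) (tab (r # w)) = tab w"
proof -
  have "standard_tableau (length w) (tab w)" using standard_tab assms by simp
  then show ?thesis by (auto simp: standard_tableau_def intro!: remove_add_entry)
qed

text \<open>The largest entry ends its row, and column strictness keeps the rows below no longer
  than the shortened row; so it sits in a corner.\<close>

lemma standard_tableau_remove_last:
  assumes T: "standard_tableau (Suc n) T"
  shows "\<exists>r T'. standard_tableau n T' \<and> addable (row_len T') r \<and> T = add_entry r (Suc n) T'"
proof -
  have ne: "[] \<notin> set T" and sorted: "sorted_wrt (\<ge>) (map length T)"
    and dist: "distinct (concat T)" and set: "set (concat T) = {1..Suc n}"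
    and rows: "\<And>row. row \<in> set T \<Longrightarrow> sorted_wrt (<) row"
    and cols: "\<And>r c. Suc r < length T \<Longrightarrow> c < length (T ! Suc r) \<Longrightarrow> T ! r ! c < T ! Suc r ! c"
    using T by (auto simp: standard_tableau_def)
  have "Suc n \<in> set (concat T)" using set by simp
  then obtain t where "t \<in> set T" "Suc n \<in> set t" by auto
  then obtain r where r: "r < length T" "Suc n \<in> set (T ! r)" by (metis in_set_conv_nth)
  have le: "x \<le> Suc n" if "i < length T" "x \<in> set (T ! i)" for i x
  proof -
    have "x \<in> set (concat T)" using that by (auto intro!: bexI[of _ "T ! i"])
    then have "x \<in> {1..Suc n}" unfolding set .
    then show ?thesis by simp
  qed
  obtain row where row: "T ! r = row @ [Suc n]"
  proof -
    from split_list[OF r(2)] obtain ys zs where s: "T ! r = ys @ Suc n # zs" by blast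
    have "zs = []"
    proof (rule ccontr)
      assume "zs \<noteq> []"
      then have "hd zs \<in> set zs" by simp
      moreover have "sorted_wrt (<) (ys @ Suc n # zs)" using rows[OF nth_mem[OF r(1)]] s by simp
      ultimately have "Suc n < hd zs" by (simp add: sorted_wrt_append)
      moreover have "hd zs \<le> Suc n" using le[OF r(1), of "hd zs"] s \<open>hd zs \<in> set zs\<close> by simp
      ultimately show False by simp
    qed
    then show ?thesis using that s by simp
  qed
  define A where "A = take r T"
  define B where "B = drop (Suc r) T"
  have T_eq: "T = A @ (row @ [Suc n]) # B" and lenA: "length A = r"
    using id_take_nth_drop[OF r(1)] r(1) row by (auto simp: A_def B_def)
  have lens: "length (T ! j) \<le> length (T ! i)" if "i < j" "j < length T" for i j
    using sorted_wrt_nth_less[OF sorted, of i j] that by simp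
  have short: "length (T ! j) \<le> length row" if "r < j" "j < length T" for j
  proof -
    have "length (T ! Suc r) \<le> length row"
    proof (rule ccontr)
      assume "\<not> length (T ! Suc r) \<le> length row"
      then have c: "length row < length (T ! Suc r)" by simp
      have "T ! r ! length row < T ! Suc r ! length row" using cols[of r "length row"] c that by simp
      moreover have "T ! Suc r ! length row \<le> Suc n" using le[of "Suc r"] c that by simp
      ultimately show False using row by simp
    qed
    moreover have "length (T ! j) \<le> length (T ! Suc r)"
      using lens[of "Suc r" j] that by (cases "j = Suc r") auto
    ultimately show ?thesis by simp
  qed
  have set': "Suc n \<notin> set (concat (A @ row # B))"
    and dist': "distinct (concat (A @ row # B))"
    using dist unfolding T_eq by auto
  have "set (concat T) = insert (Suc n) (set (concat (A @ row # B)))" unfolding T_eq by auto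
  then have "set (concat (A @ row # B)) = {1..Suc n} - {Suc n}"
    using set' unfolding set by (metis Diff_insert_absorb)
  then have set'': "set (concat (A @ row # B)) = {1..n}" by (simp only:) auto
  have row_sorted: "sorted_wrt (<) row"
    using rows[OF nth_mem[OF r(1)]] row by (simp add: sorted_wrt_append)
  have add: "r = 0 \<or> length row < length (T ! (r - 1)) \<and> r - 1 < length T"
    using lens[of "r - 1" r] r(1) row by (cases "r = 0") auto
  show ?thesis
  proof (cases "row = []")
    case False
    let ?T = "A @ row # B"
    have upd: "?T = T[r := row]" "T = ?T[r := row @ [Suc n]]"
      unfolding T_eq using lenA by (simp_all add: list_update_append)
    have nth: "?T ! i = (if i = r then row else T ! i)" if "i < length T" for i
      using that unfolding upd(1) by (simp add: nth_list_update)
    have len: "length ?T = length T" unfolding upd(1) by simp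
    have "standard_tableau n ?T"
      unfolding standard_tableau_def
    proof (intro conjI allI impI)
      show "[] \<notin> set ?T" using ne False unfolding T_eq by auto
      show "sorted_wrt (\<ge>) (map length ?T)"
        unfolding sorted_wrt_iff_nth_less
      proof (intro allI impI)
        fix i j assume "i < j" "j < length (map length ?T)"
        then have ij: "i < j" "j < length T" using len by simp_all
        then have "map length ?T ! i = length (?T ! i)" "map length ?T ! j = length (?T ! j)"
          using len by (simp_all only: length_map nth_map)
        then show "map length ?T ! i \<ge> map length ?T ! j"
          using ij lens[of i j] short[of j] row by (auto simp: nth split: if_splits)
      qed
      show "distinct (concat ?T)" by (rule dist')
      show "set (concat ?T) = {1..n}" by (rule set'')
      show "\<forall>row\<in>set ?T. sorted_wrt (<) row" using rows row_sorted unfolding T_eq by auto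
      fix k c assume k: "Suc k < length ?T" "c < length (?T ! Suc k)"
      then have k': "Suc k < length T" using len by simp
      then have "c < length (T ! Suc k)" using k(2) row by (auto simp: nth split: if_splits)
      then have "T ! k ! c < T ! Suc k ! c" using cols k' by blast
      moreover have "c < length row" if "Suc k = r" using k(2) k' that by (simp add: nth)
      moreover have "c < length row" if "k = r"
        using k(2) k' that short[of "Suc k"] by (simp add: nth)
      moreover have rc: "T ! r ! c = row ! c" if "c < length row" using row that by (simp add: nth_append)
      moreover have "?T ! k = (if k = r then row else T ! k)" "?T ! Suc k = (if Suc k = r then row else T ! Suc k)"
        using nth[of k] nth[OF k'] k' by simp_all
      ultimately show "?T ! k ! c < ?T ! Suc k ! c"
        by (cases "Suc k = r"; cases "k = r") auto
    qed
    moreover have "addable (row_len ?T) r"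
      using add r(1) len nth[OF r(1)] nth[of "r - 1"] by (auto simp: addable_def row_len_def)
    moreover have "T = add_entry r (Suc n) ?T"
      using upd(2) len r(1) nth[OF r(1)] by (simp add: add_entry_def)
    ultimately show ?thesis by blast
  next
    case True
    \<comment> \<open>A row emptied by the deletion was the last one, since rows below it would be
      empty too.\<close>
    have "B = []"
    proof (rule ccontr)
      assume "B \<noteq> []"
      then have "Suc r < length T" using lenA unfolding T_eq by simp
      then have "length (T ! Suc r) = 0" using short[of "Suc r"] True by simp
      then show False using ne \<open>Suc r < length T\<close> by (metis length_0_conv nth_mem)
    qed
    then have T_A: "T = A @ [[Suc n]]" using T_eq True by simp
    have "standard_tableau n A"
      unfolding standard_tableau_def
    proof (intro conjI allI impI)
      show "[] \<notin> set A" "sorted_wrt (\<ge>) (map length A)" "\<forall>row\<in>set A. sorted_wrt (<) row"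
        using ne sorted rows unfolding T_A by (auto simp: sorted_wrt_append)
      show "distinct (concat A)" "set (concat A) = {1..n}"
        using dist' set'' True \<open>B = []\<close> by auto
      fix k c assume "Suc k < length A" "c < length (A ! Suc k)"
      then show "A ! k ! c < A ! Suc k ! c" using cols[of k c] unfolding T_A by (simp add: nth_append)
    qed
    moreover have "addable (row_len A) r"
    proof (cases "r = 0")
      case False
      then have "A ! (r - 1) \<in> set A" using lenA by (intro nth_mem) simp
      then have "A ! (r - 1) \<noteq> []" using ne unfolding T_A by auto
      then show ?thesis using lenA False by (simp add: addable_def row_len_def)
    qed (simp add: addable_def)
    moreover have "T = add_entry r (Suc n) A" using T_A lenA by (simp add: add_entry_def)
    ultimately show ?thesis by blast
  qed
qed

lemma standard_tableau_is_tab: "standard_tableau n T \<Longrightarrow> \<exists>w\<in>words n. T = tab w"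
proof (induction n arbitrary: T)
  case 0
  have "T = []"
  proof (rule ccontr)
    assume "T \<noteq> []"
    then have "hd T \<in> set T" by simp
    then have "hd T = []" using 0 by (simp add: standard_tableau_def)
    then show False using 0 \<open>hd T \<in> set T\<close> by (simp add: standard_tableau_def)
  qed
  then show ?case by (auto simp: words_def intro!: bexI[of _ "[]"])
next
  case (Suc n)
  from standard_tableau_remove_last[OF Suc.prems] obtain r T' where
    T': "standard_tableau n T'" "addable (row_len T') r" "T = add_entry r (Suc n) T'" by blast
  from Suc.IH[OF T'(1)] obtain w where w: "w \<in> words n" "T' = tab w" by blast
  then have "r # w \<in> words (Suc n)" using T'(2) tab_shape(2)[of w] by (simp add: words_def)
  moreover have "T = tab (r # w)" using T'(3) w by (simp add: words_def)
  ultimately show ?case by blast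
qed

text \<open>Deleting the largest entry recovers the tail, and the shape then recovers the removed
  letter.\<close>

lemma inj_on_tab: "inj_on tab (words n)"
proof (induction n)
  case 0
  show ?case by (auto simp: inj_on_def words_def)
next
  case (Suc n)
  show ?case
  proof (rule inj_onI)
    fix u v assume u: "u \<in> words (Suc n)" and v: "v \<in> words (Suc n)" and eq: "tab u = tab v"
    obtain r u' s v' where uv: "u = r # u'" "v = s # v'"
      using u v by (cases u; cases v) (auto simp: words_def)
    have y: "yam (r # u')" "yam (s # v')" "length u' = n" "length v' = n"
      using u v uv by (auto simp: words_def)
    have "tab u' = tab v'"
      using remove_entry_tab[OF y(1)] remove_entry_tab[OF y(2)] eq by (simp only: uv y(3,4))
    then have same: "u' = v'" using inj_onD[OF Suc.IH, of u' v'] y by (simp add: words_def)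
    have "count_list u = count_list v"
      using tab_shape(2)[of u] tab_shape(2)[of v] eq u v by (simp add: words_def)
    then have "count_list (r # u') = count_list (s # u')" by (simp only: uv same)
    then have "r = s" by (rule count_list_Cons_eq_imp_same_row)
    then show "u = v" by (simp only: uv same)
  qed
qed

lemma standard_tableaux_eq: "{T. standard_tableau n T} = tab ` words n"
  using standard_tableau_is_tab standard_tab by (auto simp: words_def)

lemma standard_shape_list:
  assumes "standard_tableau n T" "standard_tableau n U" "tableau_shape T = tableau_shape U"
  shows "map length T = map length U"
proof -
  have s: "sorted (rev (map length T))" "sorted (rev (map length U))"
    using assms(1,2) unfolding standard_tableau_def sorted_wrt_rev by auto
  have "mset (rev (map length T)) = mset (rev (map length U))"
    using assms(3) by (simp add: tableau_shape_def)
  then have "rev (map length T) = rev (map length U)"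
    using properties_for_sort[OF _ s(1), of "rev (map length U)"] sorted_sort_id[OF s(2)] by simp
  then show ?thesis by simp
qed

lemma tab_shape_eq_iff:
  assumes w: "w \<in> words n" and v: "v \<in> words n"
  shows "tableau_shape (tab v) = tableau_shape (tab w) \<longleftrightarrow> count_list v = count_list w"
proof
  have y: "yam w" "yam v" "length w = n" "length v = n" using w v by (auto simp: words_def)
  {
    assume "tableau_shape (tab v) = tableau_shape (tab w)"
    then have eq: "map length (tab v) = map length (tab w)"
      using standard_shape_list[of n] standard_tab y by metis
    then have "row_len (tab v) = row_len (tab w)"
      unfolding row_len_def fun_eq_iff by (metis length_map nth_map)
    then show "count_list v = count_list w" using tab_shape(2) y by simp
  }
  assume "count_list v = count_list w"
  then have eq: "row_len (tab v) = row_len (tab w)" using tab_shape(2) y by simp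
  then have "i < length (tab v) \<longleftrightarrow> i < length (tab w)" for i
    using row_len_pos_iff[OF tab_shape(1)[OF y(1)], of i] row_len_pos_iff[OF tab_shape(1)[OF y(2)], of i] by simp
  then have len: "length (tab v) = length (tab w)" by (metis less_irrefl linorder_neqE_nat)
  have "map length (tab v) = map length (tab w)"
  proof (rule nth_equalityI)
    fix i assume "i < length (map length (tab v))"
    then show "map length (tab v) ! i = map length (tab w) ! i"
      using fun_cong[OF eq, of i] len by (simp add: row_len_def)
  qed (simp add: len)
  then show "tableau_shape (tab v) = tableau_shape (tab w)" by (simp add: tableau_shape_def)
qed

lemma size_tableau_shape:
  assumes "standard_tableau n T"
  shows "\<Sum>\<^sub># (tableau_shape T) = n" "0 \<notin># tableau_shape T"
proof -
  have "sum_list (map length T) = length (concat T)" by (simp add: length_concat)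
  also have "\<dots> = card (set (concat T))"
    by (rule distinct_card[symmetric]) (use assms in \<open>simp add: standard_tableau_def\<close>)
  also have "\<dots> = n" using assms by (simp add: standard_tableau_def del: set_concat)
  finally show "\<Sum>\<^sub># (tableau_shape T) = n" unfolding tableau_shape_def sum_mset_sum_list .
  show "0 \<notin># tableau_shape T" using assms by (auto simp: tableau_shape_def standard_tableau_def)
qed

lemma SYT_eq:
  assumes "\<Sum>\<^sub># \<mu> = n"
  shows "SYT \<mu> = tab ` {w \<in> words n. tableau_shape (tab w) = \<mu>}"
proof -
  have "SYT \<mu> = {T \<in> {T. standard_tableau n T}. tableau_shape T = \<mu>}"
    using assms by (auto simp: SYT_def)
  then show ?thesis unfolding standard_tableaux_eq by auto
qed

lemma num_SYT_tab:
  assumes w: "w \<in> words n"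
  shows "num_SYT (tableau_shape (tab w)) = card {v \<in> words n. count_list v = count_list w}"
proof -
  have "standard_tableau n (tab w)" using standard_tab[of w] w by (auto simp: words_def)
  then have "SYT (tableau_shape (tab w)) = tab ` {v \<in> words n. tableau_shape (tab v) = tableau_shape (tab w)}"
    by (intro SYT_eq size_tableau_shape)
  also have "{v \<in> words n. tableau_shape (tab v) = tableau_shape (tab w)} =
      {v \<in> words n. count_list v = count_list w}"
    using tab_shape_eq_iff[OF w] by blast
  finally have "SYT (tableau_shape (tab w)) = tab ` {v \<in> words n. count_list v = count_list w}" .
  moreover have "inj_on tab {v \<in> words n. count_list v = count_list w}"
    by (rule inj_on_subset[OF inj_on_tab]) auto
  ultimately show ?thesis
    unfolding num_SYT_def by (simp only: card_image)
qed

text \<open>The prefactor in the definition becomes \<open>1 / theta w\<close>, since the tableaux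
  of this shape correspond to the words counted in \<open>theta_eq\<close>.\<close>

lemma young_symmetrizer_tab:
  assumes "w \<in> words n"
  shows "young_symmetrizer n (tab w) = ev ((1 / theta w) \<star> ysym w)"
proof -
  have y: "yam w" "length w = n" using assms by (auto simp: words_def)
  have "of_nat (num_SYT (tableau_shape (tab w))) / fact n = 1 / theta w"
    using theta_eq[OF assms] theta_nonzero[OF y(1)] num_SYT_tab[OF assms] by (simp add: field_simps)
  then show ?thesis
    unfolding young_symmetrizer_def
    using row_symmetrizer_tab[OF y(1)] column_antisymmetrizer_tab[OF y(1)] y(2)
    by (simp add: ev_mult symm_An antisymm_An ev_smult ysym_def)
qed

lemma seminormal_unit_tab: "w \<in> words n \<Longrightarrow> seminormal_unit n (tab w) = ev (se w)"
proof (induction n arbitrary: w)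
  case 0
  then have "w = []" by (simp add: words_def)
  then show ?case by (simp add: ev_one[symmetric])
next
  case (Suc n)
  obtain r v where w: "w = r # v" using Suc.prems by (cases w) (auto simp: words_def)
  have y: "yam (r # v)" "length v = n" and v: "v \<in> words n" using Suc.prems w by (auto simp: words_def)
  let ?Y = "(1 / theta w) \<star> ysym w"
  have "seminormal_unit n (remove_entry (Suc n) (tab w)) = ev (se v)"
    using remove_entry_tab[OF y(1)] Suc.IH[OF v] y(2) w by (simp del: tab.simps)
  then have "seminormal_unit (Suc n) (tab w) =
      ev (se v) \<otimes>\<^bsub>sym_alg (Suc n)\<^esub> ev ?Y \<otimes>\<^bsub>sym_alg (Suc n)\<^esub> ev (se v)"
    unfolding seminormal_unit.simps young_symmetrizer_tab[OF Suc.prems] by (simp only:)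
  also have "\<dots> = ev (se v * ?Y * se v)"
  proof -
    have "se v \<in> An (Suc n)" using se_An_Suc[of v] y(2) by simp
    moreover have "?Y \<in> An (Suc n)" using ysym_An[of w] y(2) w by (simp add: An_scl)
    ultimately show ?thesis by (simp only: ev_mult An_mult)
  qed
  also have "se v * ?Y * se v = se w" by (simp add: w scl_simps)
  finally show ?case .
qed

lemma SYT_marked_eq:
  "SYT_marked (Suc n) \<mu> j =
    tab ` {w \<in> words (Suc n). tableau_shape (tab w) = \<mu> \<and> count_list w (hd w) = j}"
proof -
  have iff: "(\<exists>row\<in>set (tab w). length row = j \<and> last row = Suc n) \<longleftrightarrow> count_list w (hd w) = j"
    if w: "w \<in> words (Suc n)" for w
  proof -
    obtain r v where rv: "w = r # v" using w by (cases w) (auto simp: words_def)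
    have y: "yam w" "length w = Suc n" "length v = n" using w rv by (auto simp: words_def)
    have row_n: "row_of w (Suc n) = r" "col_of w (Suc n) = count_list v r" using y(3) rv by auto
    have in_n: "Suc n \<in> {1..length w}" using y by simp
    have r: "r < length (tab w)" using tab_nth(1)[OF y(1) in_n] row_n by simp
    have len: "length (tab w ! r) = count_list w r"
      using fun_cong[OF tab_shape(2)[OF y(1)], of r] r by (simp add: row_len_def)
    moreover have "count_list w r = Suc (count_list v r)" using rv by simp
    ultimately have "tab w ! r ! (length (tab w ! r) - 1) = Suc n"
      using tab_nth(3)[OF y(1) in_n] row_n by simp
    moreover have "tab w ! r \<noteq> []" using len rv by auto
    ultimately have last: "last (tab w ! r) = Suc n" by (simp add: last_conv_nth)
    have uniq: "row = tab w ! r" if row: "row \<in> set (tab w)" "last row = Suc n" for row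
    proof -
      obtain i where i: "i < length (tab w)" "row = tab w ! i" using row(1) by (metis in_set_conv_nth)
      have "row \<noteq> []" using row(1) tab_shape(1)[OF y(1)] by auto
      then have "Suc n \<in> set (tab w ! i)" using row(2) i(2) last_in_set by metis
      then have "row_of w (Suc n) = i" using set_tab_row[OF y(1) i(1)] by simp
      then show ?thesis using i row_n by simp
    qed
    show ?thesis
    proof
      assume "\<exists>row\<in>set (tab w). length row = j \<and> last row = Suc n"
      then show "count_list w (hd w) = j" using uniq len rv by auto
    next
      assume "count_list w (hd w) = j"
      then have "length (tab w ! r) = j" using len rv by simp
      then show "\<exists>row\<in>set (tab w). length row = j \<and> last row = Suc n"
        using last r by (intro bexI[of _ "tab w ! r"]) auto
    qed
  qed
  have "SYT_marked (Suc n) \<mu> j = {T \<in> {T. standard_tableau (Suc n) T}. tableau_shape T = \<mu> \<and>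
      (\<exists>row\<in>set T. length row = j \<and> last row = Suc n)}"
    by (auto simp: SYT_marked_def)
  also have "\<dots> = tab ` {w \<in> words (Suc n). tableau_shape (tab w) = \<mu> \<and>
      (\<exists>row\<in>set (tab w). length row = j \<and> last row = Suc n)}"
    unfolding standard_tableaux_eq by blast
  also have "\<dots> = tab ` {w \<in> words (Suc n). tableau_shape (tab w) = \<mu> \<and> count_list w (hd w) = j}"
    using iff by (metis (mono_tags, lifting) Collect_cong)
  finally show ?thesis .
qed

definition shape_words :: "nat \<Rightarrow> nat multiset \<Rightarrow> nat \<Rightarrow> nat list set" where
  "shape_words n \<mu> j = {w \<in> words n. tableau_shape (tab w) = \<mu> \<and> count_list w (hd w) = j}"

lemma Gamma_elt_eq: "Gamma_elt (Suc n) \<mu> j = ev (\<Sum>w\<in>shape_words (Suc n) \<mu> j. se w)"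
proof -
  let ?W = "shape_words (Suc n) \<mu> j"
  have W: "?W \<subseteq> words (Suc n)" by (auto simp: shape_words_def)
  have fin: "finite ?W" using W finite_words finite_subset by blast
  have inj: "inj_on tab ?W" using inj_on_subset[OF inj_on_tab W] .
  have An: "se w \<in> An (Suc n)" if "w \<in> words (Suc n)" for w using se_An[of w] that by (simp add: words_def)
  have "Gamma_elt (Suc n) \<mu> j = (\<lambda>\<sigma>. \<Sum>T\<in>tab ` ?W. seminormal_unit (Suc n) T \<sigma>)"
    unfolding Gamma_elt_def SYT_marked_eq shape_words_def[symmetric]
    using fin W by (intro finsum_sym_alg) (auto simp: seminormal_unit_tab ev_carrier An simp del: seminormal_unit.simps)
  also have "\<dots> = ev (\<Sum>w\<in>?W. se w)"
    unfolding ev_sum sum.reindex[OF inj] o_def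
    by (intro ext sum.cong refl) (use W in \<open>auto simp: seminormal_unit_tab simp del: seminormal_unit.simps\<close>)
  finally show ?thesis .
qed

lemma shape_words_sum_commute:
  assumes "x \<in> An n"
  shows "(\<Sum>w\<in>shape_words (Suc n) \<mu> j. se w) * x = x * (\<Sum>w\<in>shape_words (Suc n) \<mu> j. se w)"
proof (cases "shape_words (Suc n) \<mu> j = {}")
  case False
  then obtain w0 where w0: "w0 \<in> words (Suc n)" "tableau_shape (tab w0) = \<mu>" by (auto simp: shape_words_def)
  have "shape_words (Suc n) \<mu> j = marked_words (Suc n) (count_list w0) j"
    using tab_shape_eq_iff[OF w0(1)] w0(2) unfolding shape_words_def marked_words_def by auto
  then show ?thesis using marked_words_sum_commute[OF assms] by simp
qed simp

text \<open>The largest entry occupies a corner, so the rows at least as long as its row are the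
  rows 0 to \<open>r\<close>, \<open>r + 1\<close> in number. This extra 1 cancels against
  \<open>count_list (r # v) r = count_list v r + 1\<close>.\<close>

lemma end_content_tab:
  assumes w: "r # v \<in> words n"
  shows "end_content (tableau_shape (tab (r # v))) (count_list (r # v) r) = int (count_list v r) - int r"
proof -
  let ?w = "r # v"
  let ?T = "tab ?w" and ?j = "count_list ?w r"
  have y: "yam ?w" using w by (simp add: words_def del: yam.simps)
  have row: "row_len ?T = count_list ?w" by (rule tab_shape(2)[OF y])
  have "(\<Sum>k | k \<in># tableau_shape ?T \<and> ?j \<le> k. count (tableau_shape ?T) k) =
      size (filter_mset (\<lambda>k. ?j \<le> k) (tableau_shape ?T))"
    unfolding size_multiset_overloaded_eq by (rule sum.cong) auto
  also have "\<dots> = length (filter (\<lambda>k. ?j \<le> k) (map length ?T))"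
    unfolding tableau_shape_def mset_filter[symmetric] size_mset ..
  also have "\<dots> = card {i. i < length ?T \<and> ?j \<le> length (?T ! i)}"
    unfolding length_filter_conv_card by (metis (mono_tags, lifting) Collect_cong length_map nth_map)
  also have "{i. i < length ?T \<and> ?j \<le> length (?T ! i)} = {..r}"
  proof (rule Set.set_eqI)
    fix i
    have pos: "0 < ?j" by simp
    have "i < length ?T \<and> ?j \<le> length (?T ! i) \<longleftrightarrow> ?j \<le> row_len ?T i"
      using pos by (auto simp: row_len_def simp del: count_list.simps tab.simps)
    also have "\<dots> \<longleftrightarrow> ?j \<le> count_list ?w i" unfolding row ..
    also have "\<dots> \<longleftrightarrow> i \<le> r"
    proof
      assume "?j \<le> count_list ?w i"
      then show "i \<le> r" using yam_antimono[of v r i] y by (cases "i \<le> r") auto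
    next
      assume "i \<le> r"
      then show "?j \<le> count_list ?w i" by (rule yam_antimono[OF y])
    qed
    finally show "i \<in> {i. i < length ?T \<and> ?j \<le> length (?T ! i)} \<longleftrightarrow> i \<in> {..r}" by simp
  qed
  finally have "(\<Sum>k | k \<in># tableau_shape ?T \<and> ?j \<le> k. count (tableau_shape ?T) k) = Suc r" by simp
  then show ?thesis unfolding end_content_def by (simp del: tab.simps)
qed

lemma word_marked_partition:
  assumes "w \<in> words (Suc n)"
  shows "(tableau_shape (tab w), count_list w (hd w)) \<in> marked_partitions (Suc n)"
proof -
  have y: "yam w" "length w = Suc n" using assms by (auto simp: words_def)
  have std: "standard_tableau (Suc n) (tab w)" using standard_tab[OF y(1)] y(2) by simp
  have "hd w \<in> set w" using y(2) by (cases w) auto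
  then have "0 < count_list w (hd w)" by (metis count_list_0_iff gr0I)
  then have "0 < row_len (tab w) (hd w)" using tab_shape(2)[OF y(1)] by simp
  then have "hd w < length (tab w)" "count_list w (hd w) = length (tab w ! hd w)"
    using fun_cong[OF tab_shape(2)[OF y(1)], of "hd w"] by (auto simp: row_len_def split: if_splits)
  then have "count_list w (hd w) \<in># tableau_shape (tab w)" by (simp add: tableau_shape_def)
  then show ?thesis using size_tableau_shape[OF std] by (simp add: marked_partitions_def partition_of_def)
qed

theorem theorem4p1:
  fixes n r i :: nat and lam :: "nat multiset" and \<pi> :: "nat \<Rightarrow> nat"
  assumes "lam \<turnstile> n" and "i \<in># lam" and "r \<ge> 1" and "\<pi> \<in> marked_class n lam i"
  shows "of_nat (card {\<tau>s. length \<tau>s = r \<and> set \<tau>s \<subseteq> star_transpositions n \<and> foldr (\<circ>) \<tau>s id = \<pi>})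
           = K_coeff n lam i (jucys_murphy n [^]\<^bsub>sym_alg n\<^esub> r)
       \<and> K_coeff n lam i (jucys_murphy n [^]\<^bsub>sym_alg n\<^esub> r)
           = (\<Sum>(\<mu>, j)\<in>marked_partitions n.
                of_nat (num_SYT \<mu>) / fact n * gen_char n \<mu> j lam i * of_int (end_content \<mu> j) ^ r)"
proof -
  have "i \<noteq> 0" "i \<le> n" using assms(1,2) by (auto simp: partition_of_def dest: multi_member_split)
  then obtain m where n: "n = Suc m" by (cases n) auto
  obtain a where a: "\<pi> = app a" using assms(4) by (auto simp: marked_class_def carrier_sym_group_app)
  have pi: "\<pi> \<in> marked_class (Suc m) lam i" using assms(4) n by simp
  have pow_comm: "jm (Suc m) ^ r * y = y * jm (Suc m) ^ r" if "y \<in> An m" for y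
    using jm_commute[OF that] by (metis power_commuting_commutes)
  have pow: "K_coeff n lam i (jucys_murphy n [^]\<^bsub>sym_alg n\<^esub> r) = coef (jm (Suc m) ^ r) a"
    unfolding n jucys_murphy_eq ev_power[OF jm_An]
    using K_coeff_ev[OF An_power[OF jm_An] pow_comm pi] by (simp add: a)
  have count: "of_nat (card {\<tau>s. length \<tau>s = r \<and> set \<tau>s \<subseteq> star_transpositions n \<and> foldr (\<circ>) \<tau>s id = \<pi>}) =
      coef (jm (Suc m) ^ r) a"
    unfolding a n by (rule card_star_factorizations)
  have seA: "(\<Sum>w\<in>shape_words (Suc m) \<mu> j. se w) \<in> An (Suc m)" for \<mu> j
  proof (rule An_sum)
    show "se w \<in> An (Suc m)" if "w \<in> shape_words (Suc m) \<mu> j" for w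
      using se_An[of w] that by (simp add: shape_words_def words_def)
  qed
  have Gamma: "K_coeff n lam i (Gamma_elt n \<mu> j) = (\<Sum>w\<in>shape_words (Suc m) \<mu> j. coef (se w) a)" for \<mu> j
    unfolding n Gamma_elt_eq using K_coeff_ev[OF seA shape_words_sum_commute pi] by (simp add: a lookup_sum)
  let ?c = "\<lambda>w. of_nat (count_list (tl w) (hd w)) - of_nat (hd w) :: complex"
  have summand: "of_nat (num_SYT \<mu>) / fact n * gen_char n \<mu> j lam i * of_int (end_content \<mu> j) ^ r =
      (\<Sum>w\<in>{w \<in> words (Suc m). (tableau_shape (tab w), count_list w (hd w)) = (\<mu>, j)}.
        ?c w ^ r * coef (se w) a)"
    if mu: "(\<mu>, j) \<in> marked_partitions n" for \<mu> j
  proof -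
    have sets: "{w \<in> words (Suc m). (tableau_shape (tab w), count_list w (hd w)) = (\<mu>, j)} = shape_words (Suc m) \<mu> j"
      by (auto simp: shape_words_def)
    have c: "of_int (end_content \<mu> j) = ?c w" if w: "w \<in> shape_words (Suc m) \<mu> j" for w
    proof -
      obtain s v where sv: "w = s # v" using w by (cases w) (auto simp: shape_words_def words_def)
      have "end_content \<mu> j = int (count_list v s) - int s"
        using end_content_tab[of s v "Suc m"] w sv by (simp add: shape_words_def del: tab.simps)
      then show ?thesis using sv by simp
    qed
    have "of_nat (num_SYT \<mu>) / fact n * gen_char n \<mu> j lam i =
        (\<Sum>w\<in>shape_words (Suc m) \<mu> j. coef (se w) a)"
    \<comment> \<open>If there were no tableau of shape \<open>\<mu>\<close>, the denominator in
      \<open>gen_char\<close> would be 0; the sum over words is then empty and both sides are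
      0.\<close>
    proof (cases "num_SYT \<mu> = 0")
      case True
      have "SYT \<mu> = tab ` {w \<in> words n. tableau_shape (tab w) = \<mu>}"
        using mu by (intro SYT_eq) (simp add: marked_partitions_def partition_of_def)
      then have "{w \<in> words n. tableau_shape (tab w) = \<mu>} = {}"
        using True finite_words unfolding num_SYT_def by simp
      then have "shape_words (Suc m) \<mu> j = {}" unfolding n shape_words_def by blast
      then show ?thesis using True by simp
    next
      case False
      then show ?thesis by (simp add: gen_char_def Gamma)
    qed
    then show ?thesis
      unfolding sets by (simp only: sum_distrib_right) (intro sum.cong refl, simp only: c mult.commute)
  qed
  have "(\<Sum>(\<mu>, j)\<in>marked_partitions n.
      of_nat (num_SYT \<mu>) / fact n * gen_char n \<mu> j lam i * of_int (end_content \<mu> j) ^ r) =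
      (\<Sum>p\<in>marked_partitions n. \<Sum>w\<in>{w \<in> words (Suc m). (tableau_shape (tab w), count_list w (hd w)) = p}.
        ?c w ^ r * coef (se w) a)"
    by (rule sum.cong) (auto simp only: summand split: prod.split)
  \<comment> \<open>Each word belongs to exactly one marked partition: its shape with the length of
    the row of its largest entry.\<close>
  also have "\<dots> = (\<Sum>w\<in>words (Suc m). ?c w ^ r * coef (se w) a)"
    by (rule sum.group) (use word_marked_partition finite_words finite_marked_partitions n in auto)
  also have "\<dots> = coef (jm (Suc m) ^ r) a"
    unfolding jm_power by (simp add: lookup_sum)
  finally show ?thesis using pow count by simp
qed

end
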